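(* Let $n\ge 1$ be an integer and let $K_n$ be the $(-2,3,2n+1)$-pretzel knot. Let $m$ be a non-zero complex number, let $s$ be a non-zero complex solution of $r_0=0$, and let $\alpha,\beta$ and $\rho_m:G(K_n)\to SL_2(\mathbb{C})$ be as defined in the context, with all denominators occurring in $\rho_m$ and in the formulas below non-zero. Put $$H = 1 - m^2 s + m^2 s^{2n+1} - s^{2n+2},$$ $$\eta_1 = m\alpha - m s^{2n+1}\alpha + s^{2n}\beta + m^2 s^{2n}\beta,$$ $$\eta_2 = -m s\alpha + m s^{2n+1}\alpha - s^{2n}\beta - s^{2n+1}\beta .$$ Then the twisted Alexander polynomial of $K_n$ associated to $\rho_m$ is given, up to multiplication by a power of $t$, by $$\Delta_{K_n,\rho_m}(t) = 1 + \sum_{i=0}^{2n-1}\lambda_i\,\bigl(t^{i+3}+t^{4n-i+3}\bigr) + t^{4n+6},$$ where $$\lambda_i = \frac{(1+m^2)\bigl(H s^{i/2+1}\beta - s\,(s^{i/2+1}-s^{-(i/2+1)})(\eta_1+\eta_2)\bigr)}{H m\beta}\quad\text{if } 0\le i\le 2n-2 \text{ and } i \text{ is even},$$ $$\lambda_i = \frac{s^{(i-1)/2}-s^{-(i-1)/2}}{s-s^{-1}}\quad\text{if } 0\le i\le 2n-2 \text{ and } i \text{ is odd},$$ $$\lambda_{2n-1} = \frac{s^{n-1}-s^{-(n-1)}}{s-s^{-1}} - \frac{(s^2-1)\eta_1}{H s^n\beta}.$$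
   Context: **Knot group.** $K_n\subset S^3$ is the $(-2,3,2n+1)$-pretzel knot. Its knot group $G(K_n)=\pi_1(S^3\setminus K_n)$ has the presentation $$G(K_n)=\langle a,b,x \mid \{axba(xb)^{-1}\}^{-1}x = xb\{axba(xb)^{-1}\}^{-1}(axb)^{-1}xb,\ \ x=\{axba(xb)^{-1}\}^n\rangle,$$ equivalently, putting $c=xb$, $$G(K_n)=\langle a,c \mid (acac^{-1})^{n-1}=c(acac^{-1})^{-1}(ac)^{-1}c\rangle .$$ Here $a,b$ are meridians; the abelianization $G(K_n)\to\langle t\rangle\cong\mathbb{Z}$ sends $a,b\mapsto t$, $x\mapsto t^{2n}$, $c\mapsto t^{2n+1}$. **The quantities $r_0,\alpha,\beta$.** For non-zero complex $m,s$ put $$\begin{aligned} r_0={}& m^8(s-1)(s+1)^2(s^{2n}-s^2)s^{2n+2}\\ &-m^6\{s^{6n+3}+(2s^6+s^5-4s^4+s^3+s^2-s-1)s^{4n+1}-(s^6+s^5-s^4-s^3+4s^2-s-2)s^{2n+2}+s^6\}\\ &+m^4\{(s^2+1)s^{6n+2}+(s^6+2s^5-3s^4-2s^3+6s^2-4s-2)s^{4n+3}\\ &\qquad-(2s^6+4s^5-6s^4+2s^3+3s^2-2s-1)s^{2n}+(s^2+1)s^5\}\\ &-m^2\{s^{6n+3}+(2s^6+s^5-4s^4+s^3+s^2-s-1)s^{4n+1}-(s^6+s^5-s^4-s^3+4s^2-s-2)s^{2n+2}+s^6\}\\ &+(s-1)(s+1)^2(s^{2n}-s^2)s^{2n+2},\end{aligned}$$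 $$\begin{aligned}\alpha={}&(s^2-1)s^{2n}\{-m^6(s-1)s^2(s^{2n+1}+1)+m^4(s^{2n+2}(s^4-2s^2+3s-1)+s^4-3s^3+2s^2-1)\\ &-m^2s(s^{2n}(2s^3-s^2+1)-s(s^3-s+2))+s^2(s^{2n}-s^2)\},\end{aligned}$$ $$\begin{aligned}\beta={}&m^7s^{2n+2}(s^2-1)(s^3+1)\\ &-m^5s^3\{s^{4n}(s^3-s^2+1)+s^{2n-2}(s-1)(s^3+s+1)(s^3+s^2+1)-(s^3-s+1)\}\\ &+m^3s^2(s^3+1)(s^{2n}-1)(s^{2n}+s^2)-ms^3(s^{2n}-s^2)(s^{2n}+s).\end{aligned}$$ **The representation $\rho_m$.** For $m\ne0$ and $s\neq 0$ with $r_0=0$ and the denominators below non-zero, $\rho_m:G(K_n)\to SL_2(\mathbb{C})$ is the representation with $$\rho_m(a)=\begin{pmatrix} m & -\frac{(m^2-s)(s^{2n+1}+1)}{m(s+1)}\\ 0& m^{-1}\end{pmatrix},\quad \rho_m(b)=\frac{1}{s\alpha}\begin{pmatrix}\beta & -\frac{(s\alpha-m\beta)(ms\alpha-\beta)}{m\beta}\\ \beta & \frac{m(ms\alpha-\beta)+s\alpha}{m}\end{pmatrix},$$ $$\rho_m(x)=\begin{pmatrix}s^n&0\\ \frac{s^n-s^{-n}}{s^{2n+1}+1}& s^{-n}\end{pmatrix}.$$ **Twisted Alexander polynomial (Wada).** Let $G(K)=\langle x_1,\dots,x_N\mid r_1,\dots,r_{N-1}\rangle$ be a presentation of the group of a knot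 $K$, $\Gamma$ the free group on $x_1,\dots,x_N$, $\phi:\mathbb{Z}\Gamma\to\mathbb{Z}G(K)$ the natural ring homomorphism, $\rho:G(K)\to GL_d(\mathbb{F})$ a representation over a field $\mathbb{F}$, and $\mathrm{ab}:G(K)\to\langle t\rangle$ the abelianization. Let $\Phi:\mathbb{Z}\Gamma\to M_d(\mathbb{F}[t,t^{-1}])$ be the ring homomorphism $\Phi=(\tilde\rho\otimes\widetilde{\mathrm{ab}})\circ\phi$, i.e. $\Phi(g)=\mathrm{ab}(\phi(g))\,\rho(\phi(g))$ for $g\in\Gamma$. Let $\partial/\partial x_j:\mathbb{Z}\Gamma\to\mathbb{Z}\Gamma$ be the Fox derivative: the additive map with $\frac{\partial x_i}{\partial x_j}=\delta_{ij}$ and $\frac{\partial (gg')}{\partial x_j}=\frac{\partial g}{\partial x_j}+g\frac{\partial g'}{\partial x_j}$ for $g,g'\in\Gamma$. Put $A_{i,j}=\Phi(\partial r_i/\partial x_j)$, and let $A_{\rho,k}$ be the $d(N-1)\times d(N-1)$ matrix obtained from $(A_{i,j})$ by removing the $k$-th block column. Then $$\Delta_{K,\rho}(t)=\frac{\det A_{\rho,k}}{\det\Phi(x_k-1)},$$ for $k$ with non-zero denominator. A relation $u=v$ is regarded as the relator $uv^{-1}$. For $SL_2$-representations of knot groups, $\Delta_{K,\rho}$ is regarded up to multiplication by powers of $t$. *)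

theory Defs
  imports
    Complex_Main
    "HOL-Library.Poly_Mapping"
    "HOL-Computational_Algebra.Polynomial_Factorial"
    "HOL-Algebra.Generated_Groups"
    "HOL-Algebra.Elementary_Groups"
    "HOL-Algebra.Coset"
    "Jordan_Normal_Form.Determinant"
begin

section \<open>Free groups\<close>

text \<open>
  The free group on a type of generators, as words modulo free cancellation. The letter
  \<open>(x, True)\<close> stands for \<open>x\<close> and \<open>(x, False)\<close> for its inverse. The group operation is written
  additively (class \<^class>\<open>group_add\<close>, which is not assumed commutative), so that the library type
  \<open>'g free_group \<Rightarrow>\<^sub>0 int\<close> with its convolution product is the integral group ring.
  Thus \<open>u + v\<close>, \<open>- u\<close> and \<open>u - v\<close> are the products and inverses \<open>uv\<close>, \<open>u\<close> inverse and \<open>u\<close> times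
  \<open>v\<close> inverse, and \<open>0\<close> is the neutral element.
\<close>

inductive free_eq :: "('g \<times> bool) list \<Rightarrow> ('g \<times> bool) list \<Rightarrow> bool" where
  cancel: "free_eq [(x, e), (x, \<not> e)] []"
| refl: "free_eq u u"
| sym: "free_eq u v \<Longrightarrow> free_eq v u"
| trans: "free_eq u v \<Longrightarrow> free_eq v w \<Longrightarrow> free_eq u w"
| append: "free_eq u u' \<Longrightarrow> free_eq v v' \<Longrightarrow> free_eq (u @ v) (u' @ v')"

quotient_type 'g free_group = "('g \<times> bool) list" / free_eq
  by (auto intro!: equivpI reflpI sympI transpI intro: free_eq.intros)

definition inv_word :: "('g \<times> bool) list \<Rightarrow> ('g \<times> bool) list" where
  "inv_word w = rev (map (\<lambda>(x, e). (x, \<not> e)) w)"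

lemma free_eq_inv_word: "free_eq u v \<Longrightarrow> free_eq (inv_word u) (inv_word v)"
proof (induction rule: free_eq.induct)
  case (cancel x e)
  then show ?case using free_eq.cancel[of x e] by (simp add: inv_word_def)
qed (auto simp: inv_word_def intro: free_eq.intros)

lemma free_eq_inv_word_append: "free_eq (inv_word w @ w) []"
proof (induction w)
  case Nil
  then show ?case by (simp add: inv_word_def free_eq.refl)
next
  case (Cons l w)
  obtain x e where l: "l = (x, e)" by (cases l)
  have "free_eq ([(x, \<not> e), (x, e)] @ w) ([] @ w)"
    using free_eq.cancel[of x "\<not> e"] by (intro free_eq.append free_eq.refl) simp
  then have "free_eq (inv_word w @ ([(x, \<not> e), (x, e)] @ w)) (inv_word w @ w)"
    by (intro free_eq.append free_eq.refl) simp
  then show ?case using Cons.IH by (auto simp: l inv_word_def intro: free_eq.trans)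
qed

instantiation free_group :: (type) group_add
begin

lift_definition zero_free_group :: "'a free_group" is "[]" .

lift_definition plus_free_group :: "'a free_group \<Rightarrow> 'a free_group \<Rightarrow> 'a free_group" is "(@)"
  by (rule free_eq.append)

lift_definition uminus_free_group :: "'a free_group \<Rightarrow> 'a free_group" is inv_word
  by (rule free_eq_inv_word)

definition minus_free_group :: "'a free_group \<Rightarrow> 'a free_group \<Rightarrow> 'a free_group" where
  "minus_free_group u v = u + - v"

instance
proof
  fix u v w :: "'a free_group"
  show "u + v + w = u + (v + w)" by transfer (simp add: free_eq.refl)
  show "0 + u = u" by transfer (simp add: free_eq.refl)
  show "u + 0 = u" by transfer (simp add: free_eq.refl)
  show "- u + u = 0" by transfer (rule free_eq_inv_word_append)
  show "u + - v = u - v" by (simp add: minus_free_group_def)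
qed

end

lift_definition gen :: "'g \<Rightarrow> 'g free_group" is "\<lambda>x. [(x, True)]" .

definition free_grp :: "'g free_group monoid" where
  "free_grp = \<lparr>carrier = UNIV, monoid.mult = (+), one = 0\<rparr>"

lemma group_free_grp: "group free_grp"
  by (rule groupI) (auto simp: free_grp_def add.assoc intro: left_minus)

section \<open>Fox derivatives\<close>

text \<open>
  The value on an inverse letter, \<open>- x\<^sup>-\<^sup>1\<close> for the derivative of \<open>x\<^sup>-\<^sup>1\<close> by \<open>x\<close>, is forced by
  the product rule; see \<open>fox_gen\<close> and \<open>fox_add\<close> below for the defining properties.
\<close>

fun fox_word :: "'g \<Rightarrow> ('g \<times> bool) list \<Rightarrow> ('g free_group \<Rightarrow>\<^sub>0 int)" where
  "fox_word j [] = 0"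
| "fox_word j ((x, True) # w) = (if x = j then 1 else 0) + frag_of (gen x) * fox_word j w"
| "fox_word j ((x, False) # w) =
     (if x = j then - frag_of (- gen x) else 0) + frag_of (- gen x) * fox_word j w"

lemma abs_Cons_True: "abs_free_group ((x, True) # w) = gen x + abs_free_group w"
  by (simp add: gen.abs_eq plus_free_group.abs_eq)

lemma abs_Cons_False: "abs_free_group ((x, False) # w) = - gen x + abs_free_group w"
  by (simp add: gen.abs_eq plus_free_group.abs_eq uminus_free_group.abs_eq inv_word_def)

lemma frag_of_mult: "frag_of u * frag_of v = frag_of (u + v)" for u v :: "'g free_group"
  by (simp add: Poly_Mapping.mult_single)

lemma frag_of_zero: "frag_of (0 :: 'g free_group) = 1"
  by simp

lemma fox_word_append:
  "fox_word j (u @ v) = fox_word j u + frag_of (abs_free_group u) * fox_word j v"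
proof (induction j u rule: fox_word.induct)
  case (1 j)
  have "abs_free_group [] = (0 :: 'a free_group)" by (simp add: zero_free_group.abs_eq)
  then show ?case by simp
qed (simp_all add: abs_Cons_True abs_Cons_False frag_of_mult[symmetric] algebra_simps)

lemma fox_word_free_eq: "free_eq u v \<Longrightarrow> fox_word j u = fox_word j v"
proof (induction rule: free_eq.induct)
  case (cancel x e)
  then show ?case by (cases e) (simp_all add: frag_of_mult)
next
  case (append u u' v v')
  then show ?case by (simp add: fox_word_append free_group.abs_eq_iff[THEN iffD2])
qed simp_all

lift_definition fox_elem :: "'g \<Rightarrow> 'g free_group \<Rightarrow> ('g free_group \<Rightarrow>\<^sub>0 int)" is fox_word
  by (rule fox_word_free_eq)

definition fox :: "'g \<Rightarrow> ('g free_group \<Rightarrow>\<^sub>0 int) \<Rightarrow> ('g free_group \<Rightarrow>\<^sub>0 int)" where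
  "fox j = frag_extend (fox_elem j)"

lemma fox_additive: "fox j (p + q) = fox j p + fox j q"
  by (simp add: fox_def frag_extend_add)

lemma fox_gen: "fox j (frag_of (gen i)) = (if i = j then 1 else 0)"
  by (simp add: fox_def gen.abs_eq fox_elem.abs_eq)

lemma fox_add: "fox j (frag_of (u + v)) = fox j (frag_of u) + frag_of u * fox j (frag_of v)"
proof (induction u; induction v)
  fix u v :: "('a \<times> bool) list"
  show "fox j (frag_of (abs_free_group u + abs_free_group v)) =
    fox j (frag_of (abs_free_group u)) + frag_of (abs_free_group u) * fox j (frag_of (abs_free_group v))"
    by (simp add: fox_def plus_free_group.abs_eq fox_elem.abs_eq fox_word_append)
qed

section \<open>Group presentations and the twisted Alexander polynomial\<close>

definition normal_closure :: "'g free_group list \<Rightarrow> 'g free_group set" where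
  "normal_closure rels = generate free_grp {u + r - u | u r. r \<in> set rels}"

definition presented_group :: "'g free_group list \<Rightarrow> 'g free_group set monoid" where
  "presented_group rels = free_grp Mod normal_closure rels"

lemma normal_normal_closure:
  fixes rels :: "'g free_group list"
  shows "normal (normal_closure rels) free_grp"
proof -
  interpret group "free_grp :: 'g free_group monoid" by (rule group_free_grp)
  have inv: "inv\<^bsub>free_grp\<^esub> g = - g" for g :: "'g free_group"
    by (rule inv_equality) (auto simp: free_grp_def)
  show ?thesis unfolding normal_closure_def
  proof (rule normal_generateI)
    fix h g :: "'g free_group"
    assume "h \<in> {u + r - u | u r. r \<in> set rels}" and "g \<in> carrier free_grp"
    then obtain u r where h: "h = u + r - u" and r: "r \<in> set rels" by blast
    have "g + (u + r - u) + - g = (g + u) + r - (g + u)"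
      by (simp add: add.assoc diff_conv_add_uminus minus_add del: add_uminus_conv_diff)
    then show "g \<otimes>\<^bsub>free_grp\<^esub> h \<otimes>\<^bsub>free_grp\<^esub> inv\<^bsub>free_grp\<^esub> g \<in> {u + r - u | u r. r \<in> set rels}"
      unfolding inv h using r by (auto simp: free_grp_def)
  qed (auto simp: free_grp_def)
qed

lemma group_presented_group: "group (presented_group rels)"
  unfolding presented_group_def by (rule normal.factorgroup_is_group[OF normal_normal_closure])

definition proj :: "'g free_group list \<Rightarrow> 'g free_group \<Rightarrow> 'g free_group set" where
  "proj rels u = normal_closure rels #>\<^bsub>free_grp\<^esub> u"

definition special_linear :: "nat \<Rightarrow> 'a::comm_ring_1 mat monoid" where
  "special_linear d = \<lparr>carrier = {A \<in> carrier_mat d d. det A = 1}, monoid.mult = (*), one = 1\<^sub>m d\<rparr>"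

text \<open>
  Laurent polynomials in \<open>t\<close> over a field are handled inside the field of rational functions
  \<open>'a poly fract\<close>, where the quotient of determinants lives. The abelianization takes values in
  the additive group of integers, \<open>k\<close> standing for the \<open>k\<close>-th power of \<open>t\<close>.
\<close>

definition tvar :: "'a::field poly fract" where
  "tvar = to_fract [:0, 1:]"

definition const_fract :: "'a::field \<Rightarrow> 'a poly fract" where
  "const_fract c = to_fract [:c:]"

definition twist ::
  "nat \<Rightarrow> 'g free_group list \<Rightarrow> ('g free_group set \<Rightarrow> 'a::field mat) \<Rightarrow> ('g free_group set \<Rightarrow> int)
    \<Rightarrow> ('g free_group \<Rightarrow>\<^sub>0 int) \<Rightarrow> 'a poly fract mat" where
  "twist d rels \<rho> ab p = mat d d (\<lambda>(i, j).
     \<Sum>u \<in> Poly_Mapping.keys p. of_int (Poly_Mapping.lookup p u) *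
       (tvar powi ab (proj rels u) * const_fract (\<rho> (proj rels u) $$ (i, j))))"

definition twisted_alexander_matrix ::
  "nat \<Rightarrow> 'g list \<Rightarrow> 'g free_group list \<Rightarrow> ('g free_group set \<Rightarrow> 'a::field mat)
    \<Rightarrow> ('g free_group set \<Rightarrow> int) \<Rightarrow> nat \<Rightarrow> 'a poly fract mat" where
  "twisted_alexander_matrix d gens rels \<rho> ab k =
     (let cols = take k gens @ drop (Suc k) gens in
      mat (d * length rels) (d * length cols) (\<lambda>(p, q).
        twist d rels \<rho> ab (fox (cols ! (q div d)) (frag_of (rels ! (p div d)))) $$ (p mod d, q mod d)))"

definition twisted_alexander_denom ::
  "nat \<Rightarrow> 'g list \<Rightarrow> 'g free_group list \<Rightarrow> ('g free_group set \<Rightarrow> 'a::field mat)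
    \<Rightarrow> ('g free_group set \<Rightarrow> int) \<Rightarrow> nat \<Rightarrow> 'a poly fract" where
  "twisted_alexander_denom d gens rels \<rho> ab k = det (twist d rels \<rho> ab (frag_of (gen (gens ! k)) - 1))"

definition twisted_alexander ::
  "nat \<Rightarrow> 'g list \<Rightarrow> 'g free_group list \<Rightarrow> ('g free_group set \<Rightarrow> 'a::field mat)
    \<Rightarrow> ('g free_group set \<Rightarrow> int) \<Rightarrow> nat \<Rightarrow> 'a poly fract" where
  "twisted_alexander d gens rels \<rho> ab k =
     det (twisted_alexander_matrix d gens rels \<rho> ab k) / twisted_alexander_denom d gens rels \<rho> ab k"

section \<open>The \<open>(-2,3,2n+1)\<close>-pretzel knots\<close>

datatype pretzel_gen = GenA | GenB | GenX

definition pretzel_gens :: "pretzel_gen list" where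
  "pretzel_gens = [GenA, GenB, GenX]"

definition pretzel_rels :: "nat \<Rightarrow> pretzel_gen free_group list" where
  "pretzel_rels n =
     (let a = gen GenA; b = gen GenB; x = gen GenX;
          w = a + x + b + a - (x + b)
      in [(- w + x) - (x + b - w - (a + x + b) + x + b),
          x - sum_list (replicate n w)])"

definition pretzel_group :: "nat \<Rightarrow> pretzel_gen free_group set monoid" where
  "pretzel_group n = presented_group (pretzel_rels n)"

definition pretzel_elem :: "nat \<Rightarrow> pretzel_gen \<Rightarrow> pretzel_gen free_group set" where
  "pretzel_elem n g = proj (pretzel_rels n) (gen g)"

definition r0 :: "nat \<Rightarrow> complex \<Rightarrow> complex \<Rightarrow> complex" where
  "r0 n m s =
     m^8 * (s - 1) * (s + 1)^2 * (s^(2*n) - s^2) * s^(2*n+2)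
   - m^6 * (s^(6*n+3) + (2*s^6 + s^5 - 4*s^4 + s^3 + s^2 - s - 1) * s^(4*n+1)
            - (s^6 + s^5 - s^4 - s^3 + 4*s^2 - s - 2) * s^(2*n+2) + s^6)
   + m^4 * ((s^2 + 1) * s^(6*n+2) + (s^6 + 2*s^5 - 3*s^4 - 2*s^3 + 6*s^2 - 4*s - 2) * s^(4*n+3)
            - (2*s^6 + 4*s^5 - 6*s^4 + 2*s^3 + 3*s^2 - 2*s - 1) * s^(2*n) + (s^2 + 1) * s^5)
   - m^2 * (s^(6*n+3) + (2*s^6 + s^5 - 4*s^4 + s^3 + s^2 - s - 1) * s^(4*n+1)
            - (s^6 + s^5 - s^4 - s^3 + 4*s^2 - s - 2) * s^(2*n+2) + s^6)
   + (s - 1) * (s + 1)^2 * (s^(2*n) - s^2) * s^(2*n+2)"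

definition alpha :: "nat \<Rightarrow> complex \<Rightarrow> complex \<Rightarrow> complex" where
  "alpha n m s = (s^2 - 1) * s^(2*n) *
     (- (m^6 * (s - 1) * s^2 * (s^(2*n+1) + 1))
      + m^4 * (s^(2*n+2) * (s^4 - 2*s^2 + 3*s - 1) + s^4 - 3*s^3 + 2*s^2 - 1)
      - m^2 * s * (s^(2*n) * (2*s^3 - s^2 + 1) - s * (s^3 - s + 2))
      + s^2 * (s^(2*n) - s^2))"

definition beta :: "nat \<Rightarrow> complex \<Rightarrow> complex \<Rightarrow> complex" where
  "beta n m s =
     m^7 * s^(2*n+2) * (s^2 - 1) * (s^3 + 1)
   - m^5 * s^3 * (s^(4*n) * (s^3 - s^2 + 1)
       + s^(2*n-2) * (s - 1) * (s^3 + s + 1) * (s^3 + s^2 + 1) - (s^3 - s + 1))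
   + m^3 * s^2 * (s^3 + 1) * (s^(2*n) - 1) * (s^(2*n) + s^2)
   - m * s^3 * (s^(2*n) - s^2) * (s^(2*n) + s)"

definition rho_a :: "nat \<Rightarrow> complex \<Rightarrow> complex \<Rightarrow> complex mat" where
  "rho_a n m s = mat_of_rows_list 2
     [[m, - ((m^2 - s) * (s^(2*n+1) + 1) / (m * (s + 1)))],
      [0, inverse m]]"

definition rho_b :: "nat \<Rightarrow> complex \<Rightarrow> complex \<Rightarrow> complex mat" where
  "rho_b n m s =
     (let \<alpha> = alpha n m s; \<beta> = beta n m s in
      (1 / (s * \<alpha>)) \<cdot>\<^sub>m mat_of_rows_list 2
        [[\<beta>, - ((s * \<alpha> - m * \<beta>) * (m * s * \<alpha> - \<beta>) / (m * \<beta>))],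
         [\<beta>, (m * (m * s * \<alpha> - \<beta>) + s * \<alpha>) / m]])"

definition rho_x :: "nat \<Rightarrow> complex \<Rightarrow> complex mat" where
  "rho_x n s = mat_of_rows_list 2
     [[s^n, 0],
      [(s^n - s powi (- int n)) / (s^(2*n+1) + 1), s powi (- int n)]]"

definition Hfac :: "nat \<Rightarrow> complex \<Rightarrow> complex \<Rightarrow> complex" where
  "Hfac n m s = 1 - m^2 * s + m^2 * s^(2*n+1) - s^(2*n+2)"

definition eta1 :: "nat \<Rightarrow> complex \<Rightarrow> complex \<Rightarrow> complex" where
  "eta1 n m s =
     (let \<alpha> = alpha n m s; \<beta> = beta n m s in
      m * \<alpha> - m * s^(2*n+1) * \<alpha> + s^(2*n) * \<beta> + m^2 * s^(2*n) * \<beta>)"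

definition eta2 :: "nat \<Rightarrow> complex \<Rightarrow> complex \<Rightarrow> complex" where
  "eta2 n m s =
     (let \<alpha> = alpha n m s; \<beta> = beta n m s in
      - (m * s * \<alpha>) + m * s^(2*n+1) * \<alpha> - s^(2*n) * \<beta> - s^(2*n+1) * \<beta>)"

definition lam :: "nat \<Rightarrow> complex \<Rightarrow> complex \<Rightarrow> nat \<Rightarrow> complex" where
  "lam n m s i =
     (let H = Hfac n m s; \<beta> = beta n m s; \<eta>1 = eta1 n m s; \<eta>2 = eta2 n m s in
      if i = 2*n - 1 then
        (s powi (int n - 1) - s powi (- (int n - 1))) / (s - inverse s)
          - (s^2 - 1) * \<eta>1 / (H * s^n * \<beta>)
      else if even i then
        (1 + m^2) * (H * s^(i div 2 + 1) * \<beta>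
            - s * (s^(i div 2 + 1) - s powi (- int (i div 2 + 1))) * (\<eta>1 + \<eta>2)) / (H * m * \<beta>)
      else
        (s^((i - 1) div 2) - s powi (- int ((i - 1) div 2))) / (s - inverse s))"

end

theory Submission
  imports Defs
begin

text \<open>
  Write \<open>w = axba(xb)\<^sup>-\<^sup>1\<close> and \<open>c = xb\<close>, so that \<open>aca = wc\<close> and \<open>x\<close> is the \<open>n\<close>-th power of \<open>w\<close>. In the
  group, the first relator becomes \<open>acw = cwb\<close>, and the two relations together say that \<open>a\<close> is the
  word \<open>wb\<^sup>-\<^sup>1w\<^sup>-\<^sup>1b\<^sup>-\<^sup>1wb\<close> and that \<open>ax = xbwbw\<^sup>-\<^sup>1b\<^sup>-\<^sup>1\<close>. Hence the group has a presentation with the two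
  generators \<open>b\<close>, \<open>w\<close> and the single relator given by the last equation, and removing the column
  of \<open>w\<close> from its Alexander matrix leaves the \<open>2 \<times> 2\<close> Fox derivative by \<open>b\<close>, called \<open>reduced\<close>
  below. Up to a power of \<open>t\<close> the invariant is therefore the determinant of \<open>reduced\<close> divided by
  \<open>det (\<Phi> w - 1) = t\<^sup>4 - (s + s\<^sup>-\<^sup>1) t\<^sup>2 + 1\<close>. For the given presentation with three generators
  this is proved by block elimination (\<open>det_without_a\<close>); Fox's fundamental formula then shows that
  the choice of the removed column does not matter (\<open>twisted_quotient\<close>).

  Since \<open>\<Phi>\<close> of \<open>w\<close>, \<open>b\<close>, \<open>x\<close> is \<open>t\<^sup>2\<close>, \<open>t\<close>, \<open>t\<^sup>2\<^sup>n\<close> times a matrix of determinant one, the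
  determinant of \<open>reduced\<close> is a combination of traces of words, and cyclicity of the trace and the
  two relations leave only short ones (\<open>mdet_reduced\<close>). In the common eigenbasis of \<open>w\<close> and \<open>x\<close>
  let \<open>F\<close>, \<open>G\<close> be the diagonal entries of the image of \<open>b\<close>. All traces that occur are then
  functions of \<open>s\<close>, \<open>F\<close>, \<open>G\<close> and one more number \<open>\<nu>\<close> (\<open>eigenbasis_traces\<close>).

  On the other side, the coefficients with even index satisfy
  \<open>\<lambda>\<^sub>2\<^sub>j = F s\<^sup>j\<^sup>+\<^sup>1 + G s\<^sup>-\<^sup>j\<^sup>-\<^sup>1\<close>, those with odd index are the quotients
  \<open>(s\<^sup>j - s\<^sup>-\<^sup>j) / (s - s\<^sup>-\<^sup>1)\<close>, and the middle one is such a quotient minus \<open>\<nu>\<close>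
  (\<open>lam_closed_form\<close>). Both families satisfy the linear recurrence with characteristic
  polynomial \<open>z\<^sup>2 - (s + s\<^sup>-\<^sup>1) z + 1\<close>, so multiplication by \<open>det (\<Phi> w - 1)\<close> telescopes the sum
  (\<open>alexander_sum\<close>), and the result agrees with the determinant of \<open>reduced\<close>.

  What remains is that \<open>F\<close>, \<open>G\<close>, \<open>\<nu>\<close>, which are given in terms of \<open>\<alpha>\<close> and \<open>\<beta>\<close>, have the required
  properties. This rests on two quadratic equations for \<open>m \<alpha> / \<beta>\<close> that are implied by \<open>r0 = 0\<close>
  (\<open>first_quadratic_identity\<close>, \<open>second_quadratic_identity\<close>). The first says that \<open>w\<close> is mapped to
  a triangular matrix with diagonal entries \<open>s\<close> and \<open>s\<^sup>-\<^sup>1\<close>; the second yields a quadratic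
  equation for \<open>\<nu>\<close>. The defining
  relations of the group provide the rest (\<open>eigenbasis_relations\<close>, \<open>pretzel_traces\<close>).
\<close>

section \<open>Two-by-two matrices as a ring\<close>

text \<open>
Matrices of the fixed size two form a ring, so noncommutative identities between words in the
images of group elements become plain ring computations.
\<close>
datatype 'a m2 = M2 'a 'a 'a 'a

instantiation m2 :: (comm_ring_1) ring_1
begin

definition zero_m2 :: "'a m2" where "0 = M2 0 0 0 0"
definition one_m2 :: "'a m2" where "1 = M2 1 0 0 1"
fun plus_m2 :: "'a m2 \<Rightarrow> 'a m2 \<Rightarrow> 'a m2" where
  "M2 a b c d + M2 a' b' c' d' = M2 (a + a') (b + b') (c + c') (d + d')"
fun uminus_m2 :: "'a m2 \<Rightarrow> 'a m2" where
  "- M2 a b c d = M2 (- a) (- b) (- c) (- d)"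
fun minus_m2 :: "'a m2 \<Rightarrow> 'a m2 \<Rightarrow> 'a m2" where
  "M2 a b c d - M2 a' b' c' d' = M2 (a - a') (b - b') (c - c') (d - d')"
fun times_m2 :: "'a m2 \<Rightarrow> 'a m2 \<Rightarrow> 'a m2" where
  "M2 a b c d * M2 a' b' c' d' =
     M2 (a * a' + b * c') (a * b' + b * d') (c * a' + d * c') (c * b' + d * d')"

instance
proof
  fix x y z :: "'a m2"
  show "x + y + z = x + (y + z)" "x + y = y + x" "x * y * z = x * (y * z)"
    "(x + y) * z = x * z + y * z" "x * (y + z) = x * y + x * z" "x - y = x + - y"
    by (cases x; cases y; cases z; simp add: algebra_simps)+
  show "0 + x = x" "- x + x = 0" "1 * x = x" "x * 1 = x"
    by (cases x; simp add: zero_m2_def one_m2_def)+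
  show "(0::'a m2) \<noteq> 1"
    by (simp add: zero_m2_def one_m2_def)
qed

end

fun mdet :: "'a::comm_ring_1 m2 \<Rightarrow> 'a" where "mdet (M2 a b c d) = a * d - b * c"
fun mtr :: "'a::comm_ring_1 m2 \<Rightarrow> 'a" where "mtr (M2 a b c d) = a + d"
fun madj :: "'a::comm_ring_1 m2 \<Rightarrow> 'a m2" where "madj (M2 a b c d) = M2 d (- b) (- c) a"
fun smul :: "'a::comm_ring_1 \<Rightarrow> 'a m2 \<Rightarrow> 'a m2" where
  "smul k (M2 a b c d) = M2 (k * a) (k * b) (k * c) (k * d)"

lemma smul_mult [simp]: "smul k x * y = smul k (x * y)" "x * smul k y = smul k (x * y)"
  by (cases x; cases y; simp add: algebra_simps)+

lemma smul_smul [simp]: "smul k (smul l x) = smul (k * l) x"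
  and smul_one [simp]: "smul 1 x = x"
  by (cases x; simp add: algebra_simps)+

lemma smul_zero [simp]: "smul 0 x = 0" and smul_neg [simp]: "smul (- k) x = - smul k x"
  and smul_add_left: "smul (k + l) x = smul k x + smul l x"
  by (cases x; simp add: zero_m2_def algebra_simps)+

lemma smul_minus: "smul k (x - y) = smul k x - smul k y"
  by (cases x; cases y) (simp add: algebra_simps)

lemma mdet_mult: "mdet (x * y) = mdet x * mdet y"
  by (cases x; cases y) (simp add: algebra_simps)

lemma mdet_one [simp]: "mdet 1 = 1"
  by (simp add: one_m2_def)

lemma mdet_uminus [simp]: "mdet (- x) = mdet x"
  by (cases x) simp

lemma mdet_smul [simp]: "mdet (smul k x) = k\<^sup>2 * mdet x"
  by (cases x) (simp add: power2_eq_square algebra_simps)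

lemma mtr_minus: "mtr (x - y) = mtr x - mtr y"
  by (cases x; cases y) simp

lemma mtr_cyclic: "mtr (x * y) = mtr (y * x)"
  by (cases x; cases y) (simp add: algebra_simps)

lemma mtr_smul [simp]: "mtr (smul k x) = k * mtr x" and madj_smul [simp]: "madj (smul k x) = smul k (madj x)"
  by (cases x; simp add: algebra_simps)+

lemma madj_mult: "madj (x * y) = madj y * madj x"
  by (cases x; cases y) (simp add: algebra_simps)

lemma madj_minus: "madj (x - y) = madj x - madj y"
  by (cases x; cases y) simp

lemma madj_madj [simp]: "madj (madj x) = x"
  by (cases x) simp

lemma madj_one [simp]: "madj 1 = 1"
  by (simp add: one_m2_def)

lemma mult_madj: "x * madj x = smul (mdet x) 1" and madj_times: "madj x * x = smul (mdet x) 1"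
  by (cases x; simp add: one_m2_def algebra_simps)+

lemma mdet_add: "mdet (x + y) = mdet x + mdet y + mtr (x * madj y)"
  by (cases x; cases y) (simp add: algebra_simps)

lemma mdet_minus: "mdet (x - y) = mdet x + mdet y - mtr (x * madj y)"
  by (cases x; cases y) (simp add: algebra_simps)

lemma mdet_one_minus: "mdet (1 - x) = 1 - mtr x + mdet x"
  by (cases x) (simp add: one_m2_def algebra_simps)

text \<open>
Sylvester's determinant identity.
\<close>
lemma mdet_one_minus_commute: "mdet (1 - x * y) = mdet (1 - y * x)"
  by (simp add: mdet_one_minus mdet_mult mtr_cyclic[of x y])

lemma m2_commute_inverse:
  fixes x y :: "'a::comm_ring_1 m2"
  assumes "x * y = 1"
  shows "y * x = 1"
proof -
  have d: "mdet x * mdet y = 1" using assms by (simp flip: mdet_mult)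
  have "y = smul (mdet y) (madj x * x * y)"
    using d by (simp add: madj_times mult.commute)
  also have "\<dots> = smul (mdet y) (madj x)" by (simp add: assms mult.assoc)
  finally have "y * x = smul (mdet y) (madj x) * x" by simp
  then show ?thesis using d by (simp add: madj_times mult.commute)
qed

lemma mdet_inverse:
  assumes "mdet (z :: 'a::field m2) \<noteq> 0"
  obtains z' where "z * z' = 1" "z' * z = 1"
proof
  let ?z' = "smul (inverse (mdet z)) (madj z)"
  show "z * ?z' = 1" and "?z' * z = 1" using assms by (simp_all add: mult_madj madj_times)
qed

lemma m2_conjugate:
  fixes E :: "'a::comm_ring_1 m2"
  assumes "mdet E = 1"
  defines "cj \<equiv> \<lambda>z. madj E * z * E"
  shows "cj (x * y) = cj x * cj y" and "cj (madj x) = madj (cj x)" and "mtr (cj x) = mtr x"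
    and "mdet (cj x) = mdet x"
proof -
  have E: "E * (madj E * z) = z" "madj E * (E * z) = z" "E * madj E = 1" for z
    by (simp_all add: mult.assoc[symmetric] mult_madj madj_times assms)
  show "cj (x * y) = cj x * cj y" "cj (madj x) = madj (cj x)"
    by (simp_all add: cj_def mult.assoc E madj_mult)
  show "mtr (cj x) = mtr x"
    unfolding cj_def by (simp add: mult.assoc mtr_cyclic[of "madj E"] E)
  have "mdet (madj E) = 1" by (metis E(3) assms mdet_mult mdet_one mult_1)
  then show "mdet (cj x) = mdet x" by (simp add: cj_def mdet_mult assms)
qed

section \<open>Determinants of block matrices\<close>

fun to_mat :: "'a::comm_ring_1 m2 \<Rightarrow> 'a mat" where
  "to_mat (M2 a b c d) =
     mat 2 2 (\<lambda>(i, j). if i = 0 then if j = 0 then a else b else if j = 0 then c else d)"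

lemma to_mat_carrier [simp]: "to_mat x \<in> carrier_mat 2 2"
  by (cases x) simp

lemma dim_to_mat [simp]: "dim_row (to_mat x) = 2" "dim_col (to_mat x) = 2"
  using to_mat_carrier[of x] by (simp_all del: to_mat_carrier)

lemma to_mat_add: "to_mat (x + y) = to_mat x + to_mat y"
  by (cases x; cases y; rule eq_matI) auto

lemma to_mat_mult: "to_mat (x * y) = to_mat x * to_mat y"
  by (cases x; cases y; rule eq_matI) (auto simp: scalar_prod_def numeral_2_eq_2)

lemma to_mat_zero: "to_mat 0 = 0\<^sub>m 2 2"
  by (rule eq_matI) (auto simp: zero_m2_def)

lemma det_to_mat: "det (to_mat x) = mdet x"
proof (cases x)
  case (M2 a b c d)
  have "det (to_mat x) = (\<Sum>j<2. to_mat x $$ (0, j) * cofactor (to_mat x) 0 j)"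
    by (rule laplace_expansion_row) auto
  also have "\<dots> = mdet x"
    by (auto simp: M2 numeral_2_eq_2 cofactor_def mat_delete_def det_single)
  finally show ?thesis .
qed

text \<open>
The Alexander matrices of the pretzel presentation have two relators and two remaining generators,
hence \<open>2 \<times> 2\<close> blocks.
\<close>
definition blocks :: "'a::comm_ring_1 m2 \<Rightarrow> 'a m2 \<Rightarrow> 'a m2 \<Rightarrow> 'a m2 \<Rightarrow> 'a mat" where
  "blocks x y z w = four_block_mat (to_mat x) (to_mat y) (to_mat z) (to_mat w)"

lemma blocks_carrier: "blocks x y z w \<in> carrier_mat 4 4"
proof -
  have "blocks x y z w \<in> carrier_mat (2 + 2) (2 + 2)"
    unfolding blocks_def by (rule four_block_carrier_mat) auto
  then show ?thesis by simp
qed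

lemma blocks_mult:
  "blocks x y z w * blocks x' y' z' w' =
     blocks (x * x' + y * z') (x * y' + y * w') (z * x' + w * z') (z * y' + w * w')"
  unfolding blocks_def to_mat_add to_mat_mult
  by (rule mult_four_block_mat[where ?nr1.0 = 2 and ?n1.0 = 2 and ?n2.0 = 2 and ?nr2.0 = 2
        and ?nc1.0 = 2 and ?nc2.0 = 2]) auto

lemma det_blocks_lower: "det (blocks x 0 z w) = mdet x * mdet (w :: 'a::idom m2)"
  unfolding blocks_def to_mat_zero
  by (subst det_four_block_mat_upper_right_zero[where n = 2 and m = 2]) (auto simp: det_to_mat)

lemma det_blocks_upper: "det (blocks x y 0 w) = mdet x * mdet (w :: 'a::idom m2)"
  unfolding blocks_def to_mat_zero
  by (subst det_four_block_mat_lower_left_zero[where n = 2 and m = 2]) (auto simp: det_to_mat)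

lemma det_blocks_mult: "det (blocks x y z w * blocks x' y' z' w') =
    det (blocks x y z w) * det (blocks x' y' z' (w' :: 'a::idom m2))"
  by (rule det_mult[OF blocks_carrier blocks_carrier])

text \<open>
The block columns are swapped by a product of block transvections, so up to the sign of one block,
which an even size does not see, nothing changes.
\<close>
lemma det_blocks_zero_left: "det (blocks 0 x y z) = mdet x * mdet (y :: 'a::idom m2)"
proof -
  have "blocks 0 1 (- 1) 1 = blocks 1 1 0 1 * blocks 1 0 (- 1) (1 :: 'a m2)"
    by (simp add: blocks_mult)
  then have "det (blocks 0 1 (- 1) (1 :: 'a m2)) = 1"
    by (simp add: det_blocks_mult det_blocks_lower det_blocks_upper)
  moreover have "blocks 0 1 (- 1) 0 = blocks 0 1 (- 1) 1 * blocks 1 1 0 (1 :: 'a m2)"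
    by (simp add: blocks_mult)
  ultimately have "det (blocks 0 1 (- 1) (0 :: 'a m2)) = 1"
    by (simp add: det_blocks_mult det_blocks_upper)
  moreover have "blocks 0 x y z * blocks 0 1 (- 1) 0 = blocks (- x) 0 (- z) y"
    by (simp add: blocks_mult)
  ultimately show ?thesis
    using det_blocks_mult[of 0 x y z 0 1 "- 1" 0] by (simp add: det_blocks_lower)
qed

lemma det_blocks_schur: "det (blocks x y z 1) = mdet (x - y * z :: 'a::idom m2)"
proof -
  have "det (blocks 1 (- y) 0 1 * blocks x y z 1) = det (blocks (x - y * z) 0 z 1)"
    by (simp add: blocks_mult)
  then show ?thesis
    unfolding det_blocks_mult by (simp add: det_blocks_lower det_blocks_upper)
qed

text \<open>
The three block columns \<open>ja\<close>, \<open>jb\<close>, \<open>jx\<close> satisfy a linear relation with coefficients \<open>pa\<close>, \<open>pb\<close>,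
\<open>px\<close>, by Fox's fundamental formula in the application. Multiplying one column by its coefficient
trades it for another; the signs disappear because the blocks have even size.
\<close>
lemma det_blocks_exchange:
  fixes pa :: "'a::idom m2"
  assumes "ja1 * pa + jb1 * pb + jx1 * px = 0" and "ja2 * pa + jb2 * pb + jx2 * px = 0"
  shows "det (blocks jb1 jx1 jb2 jx2) * mdet px = det (blocks ja1 jb1 ja2 jb2) * mdet pa"
    and "det (blocks jb1 jx1 jb2 jx2) * mdet pb = det (blocks ja1 jx1 ja2 jx2) * mdet pa"
proof -
  have solve: "c = - a - b \<and> b = - a - c" if "a + b + c = 0" for a b c :: "'a m2"
  proof -
    have "c = (a + b + c) - a - b" and "b = (a + b + c) - a - c" by simp_all
    then show ?thesis by (simp add: that)
  qed
  have eq: "jx1 * px = - (ja1 * pa) - jb1 * pb" "jx2 * px = - (ja2 * pa) - jb2 * pb"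
    "jb1 * pb = - (ja1 * pa) - jx1 * px" "jb2 * pb = - (ja2 * pa) - jx2 * px"
    using solve[OF assms(1)] solve[OF assms(2)] by blast+
  have "blocks jb1 jx1 jb2 jx2 * blocks 1 0 0 px = blocks ja1 jb1 ja2 jb2 * blocks 0 (- pa) 1 (- pb)"
    by (simp add: blocks_mult eq(1,2))
  from arg_cong[OF this, of det]
  show "det (blocks jb1 jx1 jb2 jx2) * mdet px = det (blocks ja1 jb1 ja2 jb2) * mdet pa"
    by (simp add: det_blocks_mult det_blocks_lower det_blocks_zero_left)
  have "blocks jb1 jx1 jb2 jx2 * blocks pb 0 0 1 = blocks ja1 jx1 ja2 jx2 * blocks (- pa) 0 (- px) 1"
    by (simp add: blocks_mult eq(3,4))
  from arg_cong[OF this, of det]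
  show "det (blocks jb1 jx1 jb2 jx2) * mdet pb = det (blocks ja1 jx1 ja2 jx2) * mdet pa"
    by (simp add: det_blocks_mult det_blocks_lower)
qed

section \<open>The group ring and Fox derivatives under a representation\<close>

lemma of_int_mult_m2: "of_int k * x = smul (of_int k) (x :: 'a::comm_ring_1 m2)"
proof -
  have nat: "of_nat n * x = smul (of_nat n) x" for n
    by (induction n) (simp_all add: smul_add_left distrib_right)
  show ?thesis
    by (cases k rule: int_cases2) (simp_all add: nat)
qed

text \<open>
The linear extension of a map on the free group to the integral group ring; it is multiplicative
when the map is.
\<close>
definition ev :: "('g free_group \<Rightarrow> 'a::comm_ring_1 m2) \<Rightarrow> ('g free_group \<Rightarrow>\<^sub>0 int) \<Rightarrow> 'a m2" where
  "ev \<Phi> p = (\<Sum>u\<in>Poly_Mapping.keys p. of_int (Poly_Mapping.lookup p u) * \<Phi> u)"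

lemma ev_superset:
  assumes "finite S" "Poly_Mapping.keys p \<subseteq> S"
  shows "ev \<Phi> p = (\<Sum>u\<in>S. of_int (Poly_Mapping.lookup p u) * \<Phi> u)"
  unfolding ev_def using assms by (intro sum.mono_neutral_left) (auto simp: in_keys_iff)

lemma ev_zero [simp]: "ev \<Phi> 0 = 0"
  by (simp add: ev_def)

lemma ev_add: "ev \<Phi> (p + q) = ev \<Phi> p + ev \<Phi> q"
proof -
  let ?S = "Poly_Mapping.keys p \<union> Poly_Mapping.keys q"
  have "Poly_Mapping.keys (p + q) \<subseteq> ?S" by (rule Poly_Mapping.keys_add)
  then show ?thesis
    by (simp add: ev_superset[of ?S] lookup_add algebra_simps sum.distrib)
qed

lemma ev_minus: "ev \<Phi> (p - q) = ev \<Phi> p - ev \<Phi> q"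
  using ev_add[of \<Phi> "p - q" q] by (simp add: algebra_simps)

lemma ev_frag_of [simp]: "ev \<Phi> (frag_of u) = \<Phi> u"
  by (simp add: ev_def)

lemma ev_one [simp]: "ev \<Phi> 1 = \<Phi> 0"
  by (metis ev_frag_of frag_of_zero)

lemma ev_frag_of_mult:
  assumes "\<And>u v. \<Phi> (u + v) = \<Phi> u * \<Phi> v"
  shows "ev \<Phi> (frag_of u * q) = \<Phi> u * ev \<Phi> q"
  by (rule frag_induction[where S = UNIV and c = q])
    (simp_all add: frag_of_mult assms right_diff_distrib ev_minus)

text \<open>
The image of the Fox derivative under a representation. Composing early means that the product
rule is only ever used inside a matrix ring.
\<close>
definition der :: "('g free_group \<Rightarrow> 'a::comm_ring_1 m2) \<Rightarrow> 'g \<Rightarrow> 'g free_group \<Rightarrow> 'a m2" where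
  "der \<Phi> j u = ev \<Phi> (fox j (frag_of u))"

lemma free_group_induct [case_names zero gen inv]:
  assumes "P 0" and "\<And>x u. P u \<Longrightarrow> P (gen x + u)" and "\<And>x u. P u \<Longrightarrow> P (- gen x + u)"
  shows "P u"
proof (induction u)
  fix w :: "('a \<times> bool) list"
  show "P (abs_free_group w)"
  proof (induction w)
    case Nil
    then show ?case using assms(1) by (simp add: zero_free_group.abs_eq)
  next
    case (Cons l w)
    obtain x e where "l = (x, e)" by (cases l)
    then show ?case using Cons assms(2,3) by (cases e) (simp_all add: abs_Cons_True abs_Cons_False)
  qed
qed

locale free_group_rep =
  fixes \<Phi> :: "'g free_group \<Rightarrow> 'a::comm_ring_1 m2"
  assumes hom_plus: "\<Phi> (u + v) = \<Phi> u * \<Phi> v" and hom_zero: "\<Phi> 0 = 1"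
begin

lemma inv_left: "\<Phi> (- u) * \<Phi> u = 1" and inv_right: "\<Phi> u * \<Phi> (- u) = 1"
  by (simp_all flip: hom_plus add: hom_zero)

lemma inv_left_mult: "\<Phi> (- u) * (\<Phi> u * z) = z" and inv_right_mult: "\<Phi> u * (\<Phi> (- u) * z) = z"
  by (simp_all add: mult.assoc[symmetric] inv_left inv_right)

lemmas inv_simps = inv_left inv_right inv_left_mult inv_right_mult

lemma der_plus: "der \<Phi> j (u + v) = der \<Phi> j u + \<Phi> u * der \<Phi> j v"
  by (simp add: der_def fox_add ev_add ev_frag_of_mult hom_plus)

lemma der_gen: "der \<Phi> j (gen i) = (if i = j then 1 else 0)"
  by (simp add: der_def fox_gen hom_zero)

lemma der_zero: "der \<Phi> j 0 = 0"
  using der_plus[of j 0 0] by (simp add: hom_zero)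

lemma der_uminus: "der \<Phi> j (- u) = - (\<Phi> (- u) * der \<Phi> j u)"
  using der_plus[of j "- u" u] by (simp add: der_zero eq_neg_iff_add_eq_0)

lemma der_minus: "der \<Phi> j (u - v) = der \<Phi> j u - \<Phi> (u - v) * der \<Phi> j v"
  using der_plus[of j u "- v"] hom_plus[of u "- v"] by (simp add: der_uminus mult.assoc)

text \<open>
Fox's fundamental formula. Both sides satisfy the product rule of a derivation, so it is enough to
look at the generators and their inverses.
\<close>
lemma fundamental_formula:
  assumes fin: "finite (UNIV :: 'g set)"
  shows "(\<Sum>j\<in>UNIV. der \<Phi> j u * (\<Phi> (gen j) - 1)) = \<Phi> u - 1"
proof -
  have on_gen: "(\<Sum>j\<in>UNIV. der \<Phi> j (gen x) * (\<Phi> (gen j) - 1)) = \<Phi> (gen x) - 1" for x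
    using fin by (simp add: der_gen if_distrib[of "\<lambda>y. y * _"] cong: if_cong)
  have split: "(\<Sum>j\<in>UNIV. der \<Phi> j (v + u) * (\<Phi> (gen j) - 1)) =
      (\<Sum>j\<in>UNIV. der \<Phi> j v * (\<Phi> (gen j) - 1)) + \<Phi> v * (\<Sum>j\<in>UNIV. der \<Phi> j u * (\<Phi> (gen j) - 1))"
    for u v
    by (simp add: der_plus distrib_right sum.distrib sum_distrib_left mult.assoc)
  show ?thesis
  proof (induction u rule: free_group_induct)
    case zero
    then show ?case by (simp add: der_zero hom_zero)
  next
    case (gen x u)
    show ?case unfolding split on_gen hom_plus gen by (simp add: right_diff_distrib)
  next
    case (inv x u)
    have "(\<Sum>j\<in>UNIV. der \<Phi> j (- gen x) * (\<Phi> (gen j) - 1)) = - (\<Phi> (- gen x) * (\<Phi> (gen x) - 1))"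
      by (simp add: der_uminus mult.assoc sum_negf sum_distrib_left[symmetric] on_gen)
    also have "\<dots> = \<Phi> (- gen x) - 1"
      by (simp add: right_diff_distrib inv_left)
    finally have "(\<Sum>j\<in>UNIV. der \<Phi> j (- gen x) * (\<Phi> (gen j) - 1)) = \<Phi> (- gen x) - 1" .
    then show ?case unfolding split hom_plus inv by (simp add: right_diff_distrib)
  qed
qed

end


lemma (in free_group_rep) image_uminus:
  assumes "mdet (\<Phi> u) = 1" shows "\<Phi> (- u) = madj (\<Phi> u)"
proof -
  have "madj (\<Phi> u) * \<Phi> u * \<Phi> (- u) = \<Phi> (- u)" by (simp add: madj_times assms)
  then show ?thesis by (simp add: mult.assoc inv_right)
qed

section \<open>The twisted Alexander matrix in blocks\<close>

lemma const_fract_add: "const_fract (a + b) = const_fract a + const_fract b"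
  and const_fract_mult: "const_fract (a * b) = const_fract a * const_fract b"
  and const_fract_one: "const_fract 1 = 1" and const_fract_zero: "const_fract 0 = 0"
  and const_fract_uminus: "const_fract (- a) = - const_fract a"
  by (simp_all add: const_fract_def flip: to_fract_add to_fract_mult to_fract_uminus one_pCons)


lemma const_fract_minus: "const_fract (a - b) = const_fract a - const_fract b"
  by (simp add: const_fract_def flip: to_fract_diff)

lemma const_fract_divide: "const_fract (a / b) = const_fract a / const_fract b"
proof (cases "b = 0")
  case False
  then have "const_fract b \<noteq> 0" by (simp add: const_fract_def)
  moreover have "const_fract (a / b) * const_fract b = const_fract a"
    using False by (simp flip: const_fract_mult)
  ultimately show ?thesis by (simp add: eq_divide_eq)
qed (simp add: const_fract_zero)

lemma const_fract_power: "const_fract (a ^ j) = const_fract a ^ j"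
  by (induction j) (simp_all add: const_fract_one const_fract_mult)

lemma const_fract_eq_0_iff: "const_fract a = 0 \<longleftrightarrow> a = 0"
  by (simp add: const_fract_def)

lemma const_fract_numeral: "const_fract (numeral k) = numeral k"
proof -
  have "const_fract (of_nat j) = of_nat j" for j
    by (induction j) (simp_all add: const_fract_zero const_fract_one const_fract_add)
  from this[of "numeral k"] show ?thesis by simp
qed

lemmas const_fract_simps = const_fract_add const_fract_minus const_fract_uminus const_fract_mult
  const_fract_divide const_fract_power const_fract_one const_fract_zero const_fract_numeral

text \<open>
The tensor product of the representation and the abelianization. All of its values are matrices of
constants times a power of the variable.
\<close>
definition twisted_rep :: "'g free_group list \<Rightarrow> ('g free_group set \<Rightarrow> 'a::field mat) \<Rightarrow> ('g free_group set \<Rightarrow> int)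
    \<Rightarrow> 'g free_group \<Rightarrow> 'a poly fract m2" where
  "twisted_rep rels \<rho> ab u = (let c = (\<lambda>i j. tvar powi ab (proj rels u) * const_fract (\<rho> (proj rels u) $$ (i, j)))
     in M2 (c 0 0) (c 0 1) (c 1 0) (c 1 1))"

lemma to_mat_sum: "i < 2 \<Longrightarrow> j < 2 \<Longrightarrow> to_mat (sum f S) $$ (i, j) = (\<Sum>x\<in>S. to_mat (f x) $$ (i, j))"
proof (induction S rule: infinite_finite_induct)
  case (insert x S)
  then show ?case using insert by (simp add: to_mat_add)
qed (simp_all add: to_mat_zero)

lemma twist_eq_to_mat: "twist 2 rels \<rho> ab p = to_mat (ev (twisted_rep rels \<rho> ab) p)"
proof (rule eq_matI)
  show "dim_row (twist 2 rels \<rho> ab p) = dim_row (to_mat (ev (twisted_rep rels \<rho> ab) p))"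
    "dim_col (twist 2 rels \<rho> ab p) = dim_col (to_mat (ev (twisted_rep rels \<rho> ab) p))"
    by (simp_all add: twist_def)
  fix i j assume "i < dim_row (to_mat (ev (twisted_rep rels \<rho> ab) p))" "j < dim_col (to_mat (ev (twisted_rep rels \<rho> ab) p))"
  then have "i < 2" "j < 2" by simp_all
  then show "twist 2 rels \<rho> ab p $$ (i, j) = to_mat (ev (twisted_rep rels \<rho> ab) p) $$ (i, j)"
    by (auto simp: twist_def ev_def to_mat_sum of_int_mult_m2 twisted_rep_def Let_def less_2_cases_iff
        intro!: sum.cong)
qed

lemma twisted_alexander_matrix_blocks:
  assumes "take k gens @ drop (Suc k) gens = [g, h]"
  shows "twisted_alexander_matrix 2 gens [r1, r2] \<rho> ab k =
    (let d = der (twisted_rep [r1, r2] \<rho> ab) in blocks (d g r1) (d h r1) (d g r2) (d h r2))"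
proof -
  have div: "i div 2 = (if i < 2 then 0 else 1)" "i mod 2 = (if i < 2 then i else i - 2)" if "i < 4" for i :: nat
    using that by (auto simp: mod_if div_if)
  show ?thesis unfolding twisted_alexander_matrix_def assms Let_def blocks_def
    by (rule eq_matI) (auto simp: twist_eq_to_mat der_def div)
qed

lemma twisted_alexander_denom_mdet:
  "twisted_alexander_denom 2 gens rels \<rho> ab k =
     mdet (ev (twisted_rep rels \<rho> ab) (frag_of (gen (gens ! k)) - 1))"
  by (simp add: twisted_alexander_denom_def twist_eq_to_mat det_to_mat)

lemma proj_plus: "proj rels (u + v) = proj rels u \<otimes>\<^bsub>presented_group rels\<^esub> proj rels v"
proof -
  interpret normal "normal_closure rels" free_grp by (rule normal_normal_closure)
  show ?thesis
    using rcos_sum[of u v]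
    by (simp add: proj_def presented_group_def FactGroup_def) (simp add: free_grp_def)
qed

lemma proj_carrier: "proj rels u \<in> carrier (presented_group rels)"
  by (auto simp: proj_def presented_group_def FactGroup_def RCOSETS_def free_grp_def)

lemma proj_relator: 
  assumes "r \<in> set rels" shows "proj rels r = proj rels 0"
proof -
  interpret normal "normal_closure rels" free_grp by (rule normal_normal_closure)
  have "0 + r - 0 \<in> {u + r - u | u r. r \<in> set rels}" using assms by blast
  then have r: "r \<in> normal_closure rels" unfolding normal_closure_def by (auto intro: generate.incl)
  then have "normal_closure rels #>\<^bsub>free_grp\<^esub> r = normal_closure rels"
    by (intro coset_join2 subgroup_axioms) (simp_all add: free_grp_def)
  moreover have "normal_closure rels #>\<^bsub>free_grp\<^esub> 0 = normal_closure rels"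
    by (intro coset_join2 subgroup_axioms) (use subgroup.one_closed[OF subgroup_axioms] in \<open>simp_all add: free_grp_def\<close>)
  ultimately show ?thesis by (simp add: proj_def)
qed

section \<open>The Jacobian of the pretzel presentation\<close>

lemma sum_powers_telescope: "(\<Sum>i<n. w ^ i) * (w - 1) = w ^ n - (1 :: 'a::ring_1)"
proof (induction n)
  case (Suc n)
  show ?case
    by (simp only: sum.lessThan_Suc distrib_right Suc) (simp add: right_diff_distrib power_commutes)
qed simp

text \<open>
The left-hand side contains the Schur complement that is left of the Jacobian when \<open>a\<close> is removed
and \<open>x\<close> is eliminated by the second relator. Dividing \<open>a - w\<close> by \<open>w - 1\<close>, with quotient \<open>Y\<close>,
turns the geometric sum \<open>N\<close> into \<open>x - 1\<close>. The first factor on the right is the derivative by \<open>c\<close>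
of the relation \<open>w = acac\<^sup>-\<^sup>1\<close> once \<open>a\<close> is replaced by a word in \<open>w\<close>, \<open>x\<close> and \<open>c\<close>.
\<close>
lemma elimination_identity:
  fixes a c w x :: "'a::ring_1"
  assumes inv: "w' * w = 1" "w * w' = 1" "x' * x = 1" "c' * c = 1"
    and aca: "a * c * a = w * c" and va: "c * w' * c' = w' * x * c' * a" and g: "c * x' * w * (w' * x * c') = 1"
    and N: "N * (w - 1) = x - 1" and Y: "(w - 1) * Y = a - w"
  defines "g' \<equiv> c * x' * w"
  shows "(1 + a * c) * g' * ((w' * N - w' + c * w') * (a - w) - 1 + c * w' * c' - w' * x * c') =
    (- (1 + a * c) * (g' + 1 - a) - (a - w)) * (1 - (c - 1) * Y)"
proof -
  let ?v = "c * w' * c'" and ?g = "w' * x * c'"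
  let ?M = "(w' * N - w' + c * w') * (a - w) - 1 + ?v - ?g"
  \<comment> \<open>Fundamental formula for the relation \<open>aca = wc\<close>.\<close>
  have aw: "(a - w) * (c - 1) = (w - 1) - (1 + a * c) * (a - 1)"
    by (simp add: algebra_simps aca[unfolded mult.assoc])
  have "(w' * N - w' + c * w') * (a - w) = w' * (N * (w - 1)) * Y + (c - 1) * (w' * (w - 1)) * Y"
    unfolding Y[symmetric] by (simp add: algebra_simps)
  also have "\<dots> = (w' * x + c - 1 - c * w') * Y"
    unfolding N right_diff_distrib[of w'] inv by (simp add: algebra_simps)
  finally have M: "?M = (w' * x + c - 1 - c * w') * Y - 1 + ?v - ?g" by simp
  have gx: "g' * (w' * x) = c"
    unfolding g'_def by (metis inv(2,3) mult.assoc mult.right_neutral)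
  have gv: "g' * ?v = a"
    unfolding va g'_def by (metis g mult.assoc mult_1)
  have gcw: "g' * (c * w') = a * c"
    by (metis gv inv(4) mult.assoc mult.right_neutral)
  have "g' * ?M = (g' * (w' * x) + g' * c - g' - g' * (c * w')) * Y - g' + g' * ?v - g' * ?g"
    unfolding M by (simp add: algebra_simps)
  also have "\<dots> = (c + g' * c - g' - a * c) * Y - g' + a - 1"
    unfolding gx gcw gv by (simp add: g'_def g)
  also have "\<dots> = - (g' + 1 - a) * (1 - (c - 1) * Y) + (1 - a) * Y"
    by (simp add: algebra_simps)
  finally have gM: "g' * ?M = - (g' + 1 - a) * (1 - (c - 1) * Y) + (1 - a) * Y" .
  have "(a - w) * (1 - (c - 1) * Y) = (a - w) - ((a - w) * (c - 1)) * Y"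
    by (simp only: right_diff_distrib[of "a - w" 1] mult_1_right mult.assoc)
  also have "\<dots> = (a - w) - (w - 1) * Y + (1 + a * c) * (a - 1) * Y"
    unfolding aw by (simp add: left_diff_distrib)
  also have "\<dots> = - ((1 + a * c) * ((1 - a) * Y))"
    unfolding Y by (simp add: algebra_simps)
  finally have aw': "(1 + a * c) * ((1 - a) * Y) = - ((a - w) * (1 - (c - 1) * Y))" by simp
  have "(1 + a * c) * g' * ?M = (1 + a * c) * (- (g' + 1 - a) * (1 - (c - 1) * Y)) + (1 + a * c) * ((1 - a) * Y)"
    unfolding mult.assoc[of "1 + a * c" g'] gM by (rule distrib_left)
  also have "\<dots> = (- (1 + a * c) * (g' + 1 - a) - (a - w)) * (1 - (c - 1) * Y)"
    unfolding aw'
    by (simp only: left_diff_distrib mult.assoc mult_minus_left mult_minus_right add_uminus_conv_diff)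
  finally show ?thesis .
qed

text \<open>
The relator \<open>aca = wc\<close>, after \<open>a\<close> and \<open>x\<close> are eliminated, is conjugate to the relator
\<open>ax = xbwbw\<^sup>-\<^sup>1b\<^sup>-\<^sup>1\<close> with \<open>a = wb\<^sup>-\<^sup>1w\<^sup>-\<^sup>1b\<^sup>-\<^sup>1wb\<close>. Their derivatives by \<open>b\<close> therefore differ by units only.
\<close>
lemma reduced_jacobian:
  fixes a b c w x :: "'a::ring_1"
  assumes inv: "w * w' = 1" "x' * x = 1" "b * b' = 1"
    and c: "c = x * b" and aca: "a * c * a = w * c" and acw: "a * c * w = c * w * b" and xw: "x * w = w * x"
  shows "(- (1 + a * c) * (c * x' * w + 1 - a) - (a - w)) * x =
    a * c * (w * b' * w' * b' * w - w * b' - w * b' * w' * b' - x - x * b * w + a * x)"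
proof -
  have 1: "c * x' * w * x = c * w"
    by (metis inv(2) mult.assoc mult.right_neutral xw)
  have 2: "a * c * (w * b') = c * w"
    by (metis acw inv(3) mult.assoc mult.right_neutral)
  have 3: "a * c * (w * b' * w' * b') = x"
    using 2 by (metis c inv(1,3) mult.assoc mult.right_neutral)
  have 4: "a * c * (w * b' * w' * b' * w) = w * x"
    using 3 by (metis mult.assoc xw)
  have 5: "x * b * w = c * w" by (simp add: c)
  have "(- (1 + a * c) * (c * x' * w + 1 - a) - (a - w)) * x =
    - (c * x' * w * x) - x - a * c * (c * x' * w * x) - a * c * x + a * c * a * x + w * x"
    by (simp add: algebra_simps)
  also have "\<dots> = - (c * w) - x - a * c * (c * w) - a * c * x + a * c * a * x + w * x"
    unfolding 1 ..
  also have "\<dots> = a * c * (w * b' * w' * b' * w) - a * c * (w * b') - a * c * (w * b' * w' * b') - a * c * x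
      - a * c * (x * b * w) + a * c * (a * x)"
    unfolding 2 3 4 5 by (simp add: algebra_simps)
  finally show ?thesis by (simp only: right_diff_distrib distrib_left)
qed

definition pretzel_word :: "pretzel_gen free_group" where
  "pretzel_word = gen GenA + gen GenX + gen GenB + gen GenA - (gen GenX + gen GenB)"

locale pretzel_rep = free_group_rep \<Phi> for \<Phi> :: "pretzel_gen free_group \<Rightarrow> 'a::field m2" +
  fixes n :: nat
  assumes relators: "\<forall>r\<in>set (pretzel_rels n). \<Phi> r = 1"
begin

abbreviation "pa \<equiv> \<Phi> (gen GenA)"
abbreviation "pb \<equiv> \<Phi> (gen GenB)"
abbreviation "px \<equiv> \<Phi> (gen GenX)"
abbreviation "pb' \<equiv> \<Phi> (- gen GenB)"
abbreviation "px' \<equiv> \<Phi> (- gen GenX)"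
abbreviation "pc \<equiv> \<Phi> (gen GenX + gen GenB)"
abbreviation "pc' \<equiv> \<Phi> (- (gen GenX + gen GenB))"
abbreviation "pw \<equiv> \<Phi> pretzel_word"
abbreviation "pw' \<equiv> \<Phi> (- pretzel_word)"

text \<open>
The Fox derivative by \<open>b\<close> of the relator \<open>wb\<^sup>-\<^sup>1w\<^sup>-\<^sup>1b\<^sup>-\<^sup>1wbx = xbwbw\<^sup>-\<^sup>1b\<^sup>-\<^sup>1\<close> of the presentation with
generators \<open>b\<close> and \<open>w\<close>.
\<close>
definition reduced :: "'a m2" where
  "reduced = pw * pb' * pw' * pb' * pw - pw * pb' - pw * pb' * pw' * pb' - px - px * pb * pw + pa * px"

abbreviation "rel1 \<equiv> pretzel_rels n ! 0"
abbreviation "rel2 \<equiv> pretzel_rels n ! 1"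

lemma rel1: "rel1 = (- pretzel_word + gen GenX) - (gen GenX + gen GenB - pretzel_word
    - (gen GenA + gen GenX + gen GenB) + gen GenX + gen GenB)"
  and rel2: "rel2 = gen GenX - sum_list (replicate n pretzel_word)"
  by (simp_all add: pretzel_rels_def pretzel_word_def Let_def)

lemma rels_image: "\<Phi> rel1 = 1" "\<Phi> rel2 = 1"
  using relators by (simp_all add: pretzel_rels_def Let_def)

lemma image_eqI: "\<Phi> (u - v) = 1 \<Longrightarrow> \<Phi> u = \<Phi> v"
  using hom_plus[of "u - v" v] by simp

lemma image_sum_list: "\<Phi> (sum_list (replicate k u)) = \<Phi> u ^ k"
  by (induction k) (simp_all add: hom_zero hom_plus)

lemma px_eq: "px = pw ^ n"
  using image_eqI[OF rels_image(2)[unfolded rel2]] by (simp add: image_sum_list)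

lemma px_commute: "px * pw = pw * px"
  by (simp add: px_eq power_commutes)

lemma pc_eq: "pc = px * pb" by (simp add: hom_plus)

lemma aca: "pa * pc * pa = pw * pc"
proof -
  have "gen GenA + (gen GenX + gen GenB) + gen GenA = pretzel_word + (gen GenX + gen GenB)"
    by (simp add: pretzel_word_def add.assoc)
  from arg_cong[OF this, of \<Phi>] show ?thesis by (simp add: hom_plus mult.assoc)
qed

lemma rel1_image: "pw' * px = pc * pw' * pc' * \<Phi> (- gen GenA) * pc"
proof -
  have "gen GenX + gen GenB - pretzel_word - (gen GenA + gen GenX + gen GenB) + gen GenX + gen GenB
    = (gen GenX + gen GenB) + - pretzel_word + - (gen GenX + gen GenB) + - gen GenA + (gen GenX + gen GenB)"
    by (simp add: minus_add add.assoc diff_conv_add_uminus del: add_uminus_conv_diff)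
  then show ?thesis
    using image_eqI[OF rels_image(1)[unfolded rel1]] by (simp add: hom_plus mult.assoc del: add_uminus_conv_diff)
qed

lemma va: "pc * pw' * pc' = pw' * px * pc' * pa"
  unfolding rel1_image by (simp add: mult.assoc inv_simps)

lemma acw: "pa * pc * pw = pc * pw * pb"
proof -
  have "pa * pc * pw = pc * px' * pw * (pw' * px * pc' * pa) * pc * pw"
    by (simp add: mult.assoc inv_simps)
  also have "\<dots> = pc * px' * (pw * pc)"
    unfolding va[symmetric] by (simp add: mult.assoc inv_simps)
  also have "pw * pc = px * (pw * pb)"
    by (simp add: pc_eq mult.assoc[symmetric] px_commute)
  finally show ?thesis by (simp add: mult.assoc inv_simps)
qed

lemma der_word:
  defines "d \<equiv> der \<Phi>"
  shows "d j pretzel_word = d j (gen GenA) + pa * pc * d j (gen GenA) + (pa - pw) * d j (gen GenX + gen GenB)"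
  using der_minus[of j "gen GenA + gen GenX + gen GenB + gen GenA" "gen GenX + gen GenB"]
  unfolding d_def pretzel_word_def[symmetric] by (simp add: der_plus hom_plus algebra_simps)

lemma der_rel2: "der \<Phi> j rel2 = der \<Phi> j (gen GenX) - (\<Sum>i<n. pw ^ i) * der \<Phi> j pretzel_word"
proof -
  have "der \<Phi> j (sum_list (replicate k u)) = (\<Sum>i<k. \<Phi> u ^ i) * der \<Phi> j u" for k u
  proof (induction k)
    case (Suc k)
    have "(\<Sum>i<Suc k. \<Phi> u ^ i) = 1 + \<Phi> u * (\<Sum>i<k. \<Phi> u ^ i)"
      by (subst sum.lessThan_Suc_shift) (simp add: sum_distrib_left)
    then show ?case using Suc by (simp add: der_plus distrib_right mult.assoc)
  qed (simp add: der_zero)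
  then show ?thesis
    using rels_image(2) unfolding rel2 by (simp add: der_minus)
qed

lemma der_rel1:
  defines "dc \<equiv> \<lambda>j. der \<Phi> j (gen GenX + gen GenB)"
  defines "g \<equiv> pw' * px * pc'" 
  shows "der \<Phi> j rel1 = (pc * pw' - pw') * der \<Phi> j pretzel_word + pw' * der \<Phi> j (gen GenX)
    + g * der \<Phi> j (gen GenA) + (pc * pw' * pc' - 1 - g) * dc j"
proof -
  let ?ac = "gen GenA + gen GenX + gen GenB" and ?c = "gen GenX + gen GenB"
  let ?u = "?c - pretzel_word - ?ac"
  have u: "\<Phi> ?u = g"
  proof -
    have "?u = ?c + - pretzel_word + - ?c + - gen GenA"
      by (simp add: minus_add add.assoc diff_conv_add_uminus del: add_uminus_conv_diff)
    then have "\<Phi> ?u = pc * pw' * pc' * \<Phi> (- gen GenA)" by (simp only: hom_plus)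
    also have "\<dots> = g" unfolding va g_def by (simp add: mult.assoc inv_simps)
    finally show ?thesis .
  qed
  have "der \<Phi> j (?u + gen GenX + gen GenB) = der \<Phi> j ?u + g * dc j"
    unfolding add.assoc[of ?u] der_plus[of j ?u] u dc_def ..
  also have "der \<Phi> j ?u = dc j - pc * pw' * der \<Phi> j pretzel_word - g * (der \<Phi> j (gen GenA) + pa * dc j)"
    unfolding der_minus u using hom_plus[of ?c "- pretzel_word"]
    by (simp add: dc_def add.assoc der_plus[of j "gen GenA"])
  finally have v: "der \<Phi> j (?u + gen GenX + gen GenB) =
      dc j - pc * pw' * der \<Phi> j pretzel_word - g * (der \<Phi> j (gen GenA) + pa * dc j) + g * dc j" .
  have "der \<Phi> j rel1 = der \<Phi> j (- pretzel_word + gen GenX) - der \<Phi> j (?u + gen GenX + gen GenB)"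
    using rels_image(1) unfolding rel1 der_minus[of j "- pretzel_word + gen GenX"] by simp
  also have "\<dots> = (pc * pw' - pw') * der \<Phi> j pretzel_word + pw' * der \<Phi> j (gen GenX)
    + g * der \<Phi> j (gen GenA) + (g * pa - 1 - g) * dc j"
    unfolding v by (simp add: der_plus der_uminus algebra_simps)
  also have "g * pa = pc * pw' * pc'" by (simp add: g_def va)
  finally show ?thesis .
qed

text \<open>
In terms of \<open>c = xb\<close> the column of \<open>b\<close> is the column of \<open>c\<close> times \<open>x\<close>, and the column of \<open>x\<close> is the
column of \<open>c\<close> plus the explicit derivative by \<open>x\<close>, whose lower block is \<open>1\<close>. So the Jacobian has
a Schur complement of size two, to which \<open>elimination_identity\<close> and \<open>reduced_jacobian\<close> apply.
\<close>
lemma det_without_a: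
  assumes w1: "mdet (pw - 1) \<noteq> 0" and ac1: "mdet (1 + pa * pc) \<noteq> 0"
  defines "d \<equiv> der \<Phi>"
  shows "mdet pw * mdet (pw - 1) * det (blocks (d GenB rel1) (d GenX rel1) (d GenB rel2) (d GenX rel2))
    = mdet pa * mdet px * mdet reduced * mdet (pa - 1)"
proof -
  define N where "N = (\<Sum>i<n. pw ^ i)"
  define v g g' where "v = pc * pw' * pc'" and "g = pw' * px * pc'" and "g' = pc * px' * pw"
  define m1 m2 where "m1 = (pc * pw' - pw') * (pa - pw) + v - 1 - g" and "m2 = - (N * (pa - pw))"
  define E where "E = - (1 + pa * pc) * (g' + 1 - pa) - (pa - pw)"
  have db: "d GenB rel1 = m1 * px" "d GenB rel2 = m2 * px" and dx: "d GenX rel1 = m1 + pw'" "d GenX rel2 = m2 + 1"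
    by (simp_all add: d_def der_rel1 der_rel2 der_word der_plus der_gen m1_def m2_def v_def g_def N_def algebra_simps
        del: One_nat_def)
  have "blocks m1 pw' m2 1 * blocks px 1 0 1 = blocks (m1 * px) (m1 + pw') (m2 * px) (m2 + 1)"
    by (simp add: blocks_mult)
  then have "det (blocks (m1 * px) (m1 + pw') (m2 * px) (m2 + 1)) = det (blocks m1 pw' m2 1) * mdet px"
    by (metis det_blocks_mult det_blocks_upper mdet_one mult.right_neutral)
  then have J: "det (blocks (d GenB rel1) (d GenX rel1) (d GenB rel2) (d GenX rel2)) = mdet (m1 - pw' * m2) * mdet px"
    unfolding db dx det_blocks_schur .
  obtain z where z: "(pw - 1) * z = 1" using mdet_inverse[OF w1] .
  define Y where "Y = z * (pa - pw)"
  have Y: "(pw - 1) * Y = pa - pw" unfolding Y_def by (simp add: mult.assoc[symmetric] z)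
  have M: "m1 - pw' * m2 = (pw' * N - pw' + pc * pw') * (pa - pw) - 1 + v - g"
    by (simp add: m1_def m2_def algebra_simps)
  have gg: "g' * g = 1" unfolding g_def g'_def by (simp add: mult.assoc inv_simps)
  have "(1 + pa * pc) * g' * (m1 - pw' * m2) = E * (1 - (pc - 1) * Y)"
    unfolding M E_def v_def g_def g'_def
    using elimination_identity[OF inv_left inv_right inv_left inv_left aca va gg[unfolded g_def g'_def] _ Y, of N]
    by (simp add: N_def sum_powers_telescope px_eq[symmetric])
  then have 1: "mdet (1 + pa * pc) * mdet g' * mdet (m1 - pw' * m2) = mdet E * mdet (1 - Y * (pc - 1))"
    by (metis mdet_mult mdet_one_minus_commute)
  have "(pw - 1) * (1 - Y * (pc - 1)) = (pw - 1) - ((pw - 1) * Y) * (pc - 1)"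
    by (simp add: right_diff_distrib mult.assoc)
  also have "\<dots> = (1 + pa * pc) * (pa - 1)"
    unfolding Y by (simp add: algebra_simps aca[unfolded mult.assoc])
  \<comment> \<open>Sylvester's identity has moved \<open>Y\<close> to the left, next to the factor \<open>w - 1\<close> that clears its denominator.\<close>
  finally have 2: "mdet (pw - 1) * mdet (1 - Y * (pc - 1)) = mdet (1 + pa * pc) * mdet (pa - 1)"
    by (metis mdet_mult)
  have "mdet (1 + pa * pc) * (mdet (pw - 1) * mdet g' * mdet (m1 - pw' * m2)) =
      mdet (pw - 1) * (mdet (1 + pa * pc) * mdet g' * mdet (m1 - pw' * m2))"
    by (simp add: ac_simps)
  also have "\<dots> = mdet E * (mdet (pw - 1) * mdet (1 - Y * (pc - 1)))"
    unfolding 1 by (simp add: ac_simps)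
  also have "\<dots> = mdet (1 + pa * pc) * (mdet E * mdet (pa - 1))"
    unfolding 2 by (simp add: ac_simps)
  finally have 3: "mdet (pw - 1) * mdet g' * mdet (m1 - pw' * m2) = mdet E * mdet (pa - 1)"
    using ac1 by simp
  have "E * px = pa * pc * reduced"
    unfolding E_def g'_def reduced_def
    by (rule reduced_jacobian[OF inv_right inv_left inv_right pc_eq aca acw px_commute])
  then have 4: "mdet E * mdet px = mdet pa * mdet pc * mdet reduced" by (metis mdet_mult)
  have "g' * px = pc * pw" unfolding g'_def by (simp add: mult.assoc px_commute[symmetric] inv_simps)
  then have 5: "mdet g' * mdet px = mdet pc * mdet pw" by (metis mdet_mult)
  have "mdet pc * mdet pc' = 1" by (metis inv_right mdet_mult mdet_one)
  then have pc0: "mdet pc \<noteq> 0" by auto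
  have "mdet pc * (mdet pw * mdet (pw - 1) * (mdet (m1 - pw' * m2) * mdet px)) =
      (mdet pc * mdet pw) * (mdet (pw - 1) * mdet (m1 - pw' * m2) * mdet px)"
    by (simp add: ac_simps)
  also have "\<dots> = (mdet (pw - 1) * mdet g' * mdet (m1 - pw' * m2)) * (mdet px * mdet px)"
    unfolding 5[symmetric] by (simp add: ac_simps)
  also have "\<dots> = (mdet E * mdet px) * (mdet (pa - 1) * mdet px)"
    unfolding 3 by (simp add: ac_simps)
  also have "\<dots> = mdet pc * (mdet pa * mdet px * mdet reduced * mdet (pa - 1))"
    unfolding 4 by (simp add: ac_simps)
  finally have "mdet pc * (mdet pw * mdet (pw - 1) * (mdet (m1 - pw' * m2) * mdet px)) =
      mdet pc * (mdet pa * mdet px * mdet reduced * mdet (pa - 1))" .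
  then show ?thesis unfolding J using pc0 by simp
qed

lemma twisted_quotient:
  assumes w1: "mdet (pw - 1) \<noteq> 0" and ac1: "mdet (1 + pa * pc) \<noteq> 0" and a1: "mdet (pa - 1) \<noteq> 0"
  defines "d \<equiv> der \<Phi>" and "q \<equiv> mdet pa * mdet px * mdet reduced / (mdet pw * mdet (pw - 1))"
  shows "det (blocks (d GenB rel1) (d GenX rel1) (d GenB rel2) (d GenX rel2)) = q * mdet (pa - 1)"
    and "det (blocks (d GenA rel1) (d GenX rel1) (d GenA rel2) (d GenX rel2)) = q * mdet (pb - 1)"
    and "det (blocks (d GenA rel1) (d GenB rel1) (d GenA rel2) (d GenB rel2)) = q * mdet (px - 1)"
proof -
  have "mdet pw * mdet pw' = 1" by (metis inv_right mdet_mult mdet_one)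
  then have w0: "mdet pw \<noteq> 0" by auto
  show A: "det (blocks (d GenB rel1) (d GenX rel1) (d GenB rel2) (d GenX rel2)) = q * mdet (pa - 1)"
    using det_without_a[OF w1 ac1] w0 w1 unfolding d_def q_def by (simp add: field_simps)
  have UNIV: "(UNIV :: pretzel_gen set) = {GenA, GenB, GenX}"
    using pretzel_gen.exhaust by auto
  have ff: "d GenA r * (pa - 1) + d GenB r * (pb - 1) + d GenX r * (px - 1) = 0" if "\<Phi> r = 1" for r
    using fundamental_formula[of r] that by (simp add: UNIV d_def add.assoc)
  note ex = det_blocks_exchange[OF ff[OF rels_image(1)] ff[OF rels_image(2)]]
  show "det (blocks (d GenA rel1) (d GenX rel1) (d GenA rel2) (d GenX rel2)) = q * mdet (pb - 1)"
    using ex(2) a1 unfolding A by (simp add: mult.assoc mult.commute)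
  show "det (blocks (d GenA rel1) (d GenB rel1) (d GenA rel2) (d GenB rel2)) = q * mdet (px - 1)"
    using ex(1) a1 unfolding A by (simp add: mult.assoc mult.commute)
qed

end

text \<open>
With \<open>x\<close> the \<open>n\<close>-th power of \<open>w\<close>, these two equations present the group on the generators \<open>b\<close> and \<open>w\<close>.
\<close>
lemma (in pretzel_rep) meridian_relations:
  shows "pa = pw * (pb' * pw' * pb') * pw * pb" and "pa * px = px * pb * pw * pb * pw' * pb'"
proof -
  have "pa * px * pb * pw = px * pb * pw * pb" using acw by (simp add: pc_eq mult.assoc)
  then have "pa * px * pb * pw * pw' * pb' = px * pb * pw * pb * pw' * pb'" by simp
  then show ax: "pa * px = px * pb * pw * pb * pw' * pb'" by (simp add: mult.assoc inv_simps)
  have "(pa * px) * pb * pa = px * (pw * pb)" 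
    using aca by (simp add: pc_eq mult.assoc[symmetric] px_commute)
  then have "px * (pb * pw * pb * pw' * pa) = px * (pw * pb)"
    unfolding ax by (simp add: mult.assoc inv_simps)
  then have "px' * (px * (pb * pw * pb * pw' * pa)) = px' * (px * (pw * pb))" by simp
  then have "pb * pw * pb * pw' * pa = pw * pb" by (simp add: mult.assoc inv_simps)
  then have "pw * pb' * pw' * pb' * (pb * pw * pb * pw' * pa) = pw * pb' * pw' * pb' * (pw * pb)" by simp
  then show "pa = pw * (pb' * pw' * pb') * pw * pb" by (simp add: mult.assoc inv_simps)
qed

section \<open>The determinant of the reduced Jacobian\<close>

text \<open>
With \<open>r\<^sub>0\<close> the part free of \<open>x\<close> and \<open>x r\<^sub>1\<close> the rest, the determinant is
\<open>det r\<^sub>0 + det (x r\<^sub>1) + tr (r\<^sub>0 adj (x r\<^sub>1))\<close>. Up to units and conjugation, \<open>r\<^sub>0\<close> and \<open>r\<^sub>1\<close> are \<open>- 1\<close> plus a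
product of \<open>b\<close> or \<open>b\<^sup>-\<^sup>1\<close> with factors in \<open>w\<close>, so their determinants only involve the traces of \<open>W\<close>, \<open>B\<close>
and \<open>WB\<close>. The mixed term is a sum of nine traces; in two of them the relations make the word
collapse after conjugation by \<open>A\<close>. The variable \<open>ti\<close> is the inverse of \<open>t\<close>.
\<close>
lemma mdet_reduced:
  fixes W B X A :: "'a::field m2"
  assumes dets: "mdet W = 1" "mdet B = 1" "mdet X = 1" and comm: "X * W = W * X" and t: "ti * t = 1"
  defines "W' \<equiv> madj W" and "B' \<equiv> madj B" and "X' \<equiv> madj X"
  defines "V \<equiv> B' * W' * B'"
  assumes A: "A = W * V * W * B" "A * X = X * B * W * B * W' * B'"
  defines "D \<equiv> t ^ 4 - mtr W * t\<^sup>2 + 1"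
  shows "t ^ 4 * mdet (W * V * W - smul t (W * B') - smul (ti\<^sup>2) (W * V)
      + smul \<tau> (smul t (A * X) - X - smul (t ^ 3) (X * B * W))) =
    (D + t ^ 3 * (mtr (W * B) - mtr B * t\<^sup>2 + t ^ 3))
    + \<tau> * t ^ 4 * (mtr (W * V * X') * (t ^ 4 + ti\<^sup>2) - mtr (W * V * W * X') * (t\<^sup>2 + 1)
        + (mtr (B' * X') + mtr (W * B' * X') + mtr (W * V * W' * B' * X')) * t
        - mtr (B' * W' * X') * ti - mtr (W * V * B' * X') * t ^ 3)
    + \<tau>\<^sup>2 * t ^ 4 * (t\<^sup>2 * D + 1 - mtr B * t + mtr (W * B) * t ^ 3)"
proof -
  have inv: "W * W' = 1" "W' * W = 1" "B * B' = 1" "B' * B = 1" "X * X' = 1" "X' * X = 1"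
    by (simp_all add: W'_def B'_def X'_def mult_madj madj_times dets)
  have inv': "W * (W' * z) = z" "W' * (W * z) = z" "B * (B' * z) = z" "B' * (B * z) = z"
    "X * (X' * z) = z" "X' * (X * z) = z" for z
    by (simp_all add: mult.assoc[symmetric] inv)
  have adj: "madj W' = W" "madj B' = B" "madj X' = X" "madj W = W'" "madj B = B'" "madj X = X'"
    by (simp_all add: W'_def B'_def X'_def)
  have dets': "mdet W' = 1" "mdet B' = 1" "mdet X' = 1"
    by (metis inv mdet_mult mdet_one dets mult_1)+
  have tr: "mtr W' = mtr W" "mtr B' = mtr B" "mtr (W' * B') = mtr (W * B)"
    unfolding W'_def B'_def by (cases W; cases B; simp)+
  have comm': "X' * (W * z) = W * (X' * z)" "X' * W = W * X'" for z
    by (metis comm inv' mult.assoc) (metis comm inv inv' mult.assoc mult.right_neutral)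
  have scalar0: "t ^ 4 * r = t ^ 4 - k * t\<^sup>2 + 1 + t ^ 3 * (h - m * t\<^sup>2 + t ^ 3)"
    if "r = 1 + (ti\<^sup>2)\<^sup>2 - ti\<^sup>2 * k + t\<^sup>2 - t * (m - ti\<^sup>2 * h)" for r k m h
    using that t by Groebner_Basis.algebra
  have scalar1: "r = t\<^sup>2 * (t ^ 4 - k * t\<^sup>2 + 1) + 1 - m * t + h * t ^ 3"
    if "r = t\<^sup>2 + (t ^ 3)\<^sup>2 - t * t ^ 3 * k + 1 - (t * m - t ^ 3 * h)" for r k m h
    using that by Groebner_Basis.algebra
  have scalar2: "t * a - b - t ^ 3 * c - t * t * b + t * d + t * t ^ 3 * e - ti\<^sup>2 * t * f + ti\<^sup>2 * e + ti\<^sup>2 * t ^ 3 * g =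
      e * (t ^ 4 + ti\<^sup>2) - b * (t\<^sup>2 + 1) + (a + d + g) * t - f * ti - c * t ^ 3" for a b c d e f g
    using t by Groebner_Basis.algebra
  define R0 where "R0 = W * V * W - smul t (W * B') - smul (ti\<^sup>2) (W * V)"
  define R1 where "R1 = smul t (A * X) - X - smul (t ^ 3) (X * B * W)"
  have "R0 = W * B' * (W' * B' * (W - smul (ti\<^sup>2) 1) - smul t 1)"
    by (simp add: R0_def V_def right_diff_distrib mult.assoc)
  then have "mdet R0 = mdet (W' * B' * (W - smul (ti\<^sup>2) 1) - smul t 1)"
    by (simp only: mdet_mult dets dets' mult_1)
  also have "\<dots> = mdet (W - smul (ti\<^sup>2) 1) + t\<^sup>2 - t * mtr (W' * B' * (W - smul (ti\<^sup>2) 1))"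
    unfolding mdet_minus[of _ "smul t 1"] by (simp only: mdet_mult dets dets' mult_1 madj_smul madj_one
      smul_mult mult_1_right mtr_smul mdet_smul mdet_one)
  also have "mdet (W - smul (ti\<^sup>2) 1) = 1 + (ti\<^sup>2)\<^sup>2 - ti\<^sup>2 * mtr W"
    by (simp add: mdet_minus dets)
  also have "mtr (W' * B' * (W - smul (ti\<^sup>2) 1)) = mtr B - ti\<^sup>2 * mtr (W * B)"
    by (simp add: right_diff_distrib mtr_minus mtr_cyclic[of "W' * B'" W] inv' tr del: mult.assoc)
  finally have R0: "t ^ 4 * mdet R0 = D + t ^ 3 * (mtr (W * B) - mtr B * t\<^sup>2 + t ^ 3)"
    unfolding D_def by (rule scalar0)
  have AX: "A * X = X * (B * W) * B * (W' * B')" unfolding A(2) by (simp add: mult.assoc)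
  have "R1 = X * (B * W) * (smul t B - 1 - smul (t ^ 3) (B * W)) * (W' * B')"
    unfolding R1_def AX by (simp add: right_diff_distrib left_diff_distrib mult.assoc inv inv')
  then have "mdet R1 = mdet (B * (smul t 1 - smul (t ^ 3) W) - 1)"
    by (simp add: mdet_mult dets dets') (simp add: right_diff_distrib mtr_cyclic[of B W] mdet_minus mdet_mult
        left_diff_distrib madj_minus mtr_minus algebra_simps)
  also have "\<dots> = mdet (smul t 1 - smul (t ^ 3) W) + 1 - mtr (B * (smul t 1 - smul (t ^ 3) W))"
    unfolding mdet_minus[of _ 1] by (simp only: mdet_mult dets mult_1 madj_one mult_1_right mdet_one)
  also have "mtr (B * (smul t 1 - smul (t ^ 3) W)) = t * mtr B - t ^ 3 * mtr (W * B)"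
    by (simp add: right_diff_distrib mtr_minus mtr_cyclic[of B W])
  also have "mdet (smul t 1 - smul (t ^ 3) W) = t\<^sup>2 + (t ^ 3)\<^sup>2 - t * t ^ 3 * mtr W"
    by (simp add: mdet_minus dets adj tr)
  finally have R1: "mdet R1 = t\<^sup>2 * D + 1 - mtr B * t + mtr (W * B) * t ^ 3"
    unfolding D_def by (rule scalar1)
  have "madj R1 = smul t (madj (A * X)) - X' - smul (t ^ 3) (W' * B' * X')"
    by (simp add: R1_def madj_minus madj_mult adj mult.assoc)
  moreover have U: "madj (A * X) = B * W * V * X'"
    unfolding A(2) V_def by (simp add: madj_mult adj mult.assoc)
  moreover have XA: "B * W * V * X' = X' * madj A"
    using U by (simp add: madj_mult adj)
  moreover have A': "A * madj A = 1"
    unfolding mult_madj A V_def by (simp add: mdet_mult dets dets')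
  ultimately have adjR1: "madj R1 = smul t (B * W * V * X') - X' - smul (t ^ 3) (W' * B' * X')" by simp
  have conj: "mtr (A * (z * madj A)) = mtr z" for z
    unfolding mtr_cyclic[of A] by (simp add: mult.assoc m2_commute_inverse[OF A'])
  have "W * V * W * (B * W * V * X') = A * (B' * X' * madj A)"
    unfolding XA A(1) by (simp add: mult.assoc inv')
  then have t1: "mtr (W * V * W * (B * W * V * X')) = mtr (B' * X')" by (simp only: conj)
  have "W * V * (B * W * V * X') = A * (B' * W' * X' * madj A)"
    unfolding XA A(1) by (simp add: mult.assoc inv')
  then have t2: "mtr (W * V * (B * W * V * X')) = mtr (B' * W' * X')" by (simp only: conj)
  have t3: "mtr (W * B' * (B * W * V * X')) = mtr (W * V * W * X')"
    using mtr_cyclic[of W "W * V * X'"] by (simp add: mult.assoc inv' comm')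
  have t4: "mtr (W * B' * (W' * B' * X')) = mtr (W * V * X')" by (simp add: V_def mult.assoc)
  have t5: "mtr (W * V * W * (W' * B' * X')) = mtr (W * V * B' * X')" by (simp add: mult.assoc inv')
  have t6: "mtr (W * V * (W' * B' * X')) = mtr (W * V * W' * B' * X')" by (simp add: mult.assoc)
  let ?i = "ti\<^sup>2"
  have "mtr (R0 * madj R1) =
      t * mtr (W * V * W * (B * W * V * X')) - mtr (W * V * W * X') - t ^ 3 * mtr (W * V * W * (W' * B' * X'))
    - t * t * mtr (W * B' * (B * W * V * X')) + t * mtr (W * B' * X') + t * t ^ 3 * mtr (W * B' * (W' * B' * X'))
    - ?i * t * mtr (W * V * (B * W * V * X')) + ?i * mtr (W * V * X') + ?i * t ^ 3 * mtr (W * V * (W' * B' * X'))"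
    unfolding R0_def adjR1
    by (simp only: left_diff_distrib right_diff_distrib smul_mult smul_smul mtr_minus mtr_smul smul_minus)
      (simp add: algebra_simps)
  also have "\<dots> = mtr (W * V * X') * (t ^ 4 + ?i) - mtr (W * V * W * X') * (t\<^sup>2 + 1)
        + (mtr (B' * X') + mtr (W * B' * X') + mtr (W * V * W' * B' * X')) * t
        - mtr (B' * W' * X') * ti - mtr (W * V * B' * X') * t ^ 3"
    unfolding t1 t2 t3 t4 t5 t6 by (rule scalar2)
  finally have cross: "mtr (R0 * madj R1) = \<dots>" .
  have "mdet (R0 + smul \<tau> R1) = mdet R0 + \<tau>\<^sup>2 * mdet R1 + \<tau> * mtr (R0 * madj R1)"
    by (simp add: mdet_add)
  then have "t ^ 4 * mdet (R0 + smul \<tau> R1) = t ^ 4 * mdet R0 + \<tau> * t ^ 4 * mtr (R0 * madj R1) + \<tau>\<^sup>2 * t ^ 4 * mdet R1"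
    by (simp add: algebra_simps)
  then show ?thesis unfolding R0 R1 cross unfolding R0_def R1_def .
qed

text \<open>
The mixed traces for diagonal \<open>W\<close> and \<open>X\<close>. Only the diagonal entries of
\<open>V = B\<^sup>-\<^sup>1W\<^sup>-\<^sup>1B\<^sup>-\<^sup>1\<close>, which are \<open>P / s\<close> and \<open>s Q\<close>, enter, and \<open>gh\<close> can be eliminated because \<open>B\<close> has
determinant one. The hypothesis \<open>sum\<close> names the trace of \<open>WVX\<^sup>-\<^sup>1\<close>; by the other three the remaining
traces depend on \<open>\<nu>\<close>, \<open>F\<close>, \<open>G\<close>, \<open>s\<close> and \<open>S\<close> only.
\<close>
lemma eigenbasis_traces:
  fixes F G g h s si S Si \<nu> :: "'a::field"
  assumes inv: "s * si = 1" "S * Si = 1" and gh: "g * h = F * G - 1"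
  defines "P \<equiv> G\<^sup>2 + (F * G - 1) * s\<^sup>2" and "Q \<equiv> F\<^sup>2 + (F * G - 1) * si\<^sup>2"
  assumes sum: "Si * P + S * Q = - \<nu>"
    and diff: "(s\<^sup>2 - 1) * (Si * P - s * S * Q) = s * (S + s * Si)"
    and th: "(s * F + si * G) * \<nu> = - (F * S + G * Si)"
    and mu: "(1 + s) * (s * S * F + Si * G) = - (s * (F + G) * \<nu>)"
    and s: "s + 1 \<noteq> 0"
  defines "W \<equiv> M2 s 0 0 si" and "X \<equiv> M2 S 0 0 Si" and "B \<equiv> M2 F g h G"
  defines "V \<equiv> madj B * madj W * madj B"
  shows "mtr (W * V * madj X) = - \<nu>"
    and "mtr (W * V * W * madj X) = (S + s * Si) / (s + 1) + \<nu> * (1 - s - si)"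
    and "mtr (madj B * madj X) + mtr (W * madj B * madj X) + mtr (W * V * madj W * madj B * madj X)
           = 2 * (F * S + G * Si)"
    and "mtr (madj B * madj W * madj X) = F * (s * S) + G * (si * Si)"
    and "mtr (W * V * madj B * madj X) = F * (s * S) + G * (si * Si)"
proof -
  have "mtr (W * V * madj X) = Si * P + S * Q"
    unfolding W_def X_def B_def V_def P_def Q_def using inv gh by simp Groebner_Basis.algebra
  then show "mtr (W * V * madj X) = - \<nu>" by (simp add: sum)
  have "mtr (W * V * W * madj X) = s * Si * P + si * S * Q"
    unfolding W_def X_def B_def V_def P_def Q_def using inv gh by simp Groebner_Basis.algebra
  moreover have "(s + 1) * (s * Si * P + si * S * Q) = S + s * Si + (s + 1) * \<nu> * (1 - s - si)"
    using inv sum diff by Groebner_Basis.algebra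
  ultimately show "mtr (W * V * W * madj X) = (S + s * Si) / (s + 1) + \<nu> * (1 - s - si)"
    using s by (simp add: field_simps)
  have "mtr (madj B * madj X) + mtr (W * madj B * madj X) + mtr (W * V * madj W * madj B * madj X)
      = F * S + G * Si + (s * F + si * G) * (Si * P + S * Q)"
    unfolding W_def X_def B_def V_def P_def Q_def using inv gh by simp Groebner_Basis.algebra
  then show "mtr (madj B * madj X) + mtr (W * madj B * madj X) + mtr (W * V * madj W * madj B * madj X)
      = 2 * (F * S + G * Si)"
    unfolding sum using th by Groebner_Basis.algebra
  show "mtr (madj B * madj W * madj X) = F * (s * S) + G * (si * Si)"
    by (simp add: W_def X_def B_def algebra_simps)
  have "mtr (W * V * madj B * madj X) = (F + G) * (Si * P + S * Q) - (F * S + G * Si)"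
    unfolding W_def X_def B_def V_def P_def Q_def using inv gh by simp Groebner_Basis.algebra
  then show "mtr (W * V * madj B * madj X) = F * (s * S) + G * (si * Si)"
    unfolding sum using mu inv by Groebner_Basis.algebra
qed

section \<open>The sum on the right-hand side\<close>

text \<open>
The left-hand side telescopes because the first factor is the reciprocal characteristic polynomial
of the recurrence.
\<close>
lemma forward_sum:
  fixes u :: "nat \<Rightarrow> 'a::comm_ring_1"
  assumes rec: "\<And>j. u (j + 2) = k * u (j + 1) - u j"
  shows "(1 - k * z + z\<^sup>2) * (\<Sum>j<n. u (j + 1) * z ^ j) = u 1 - u 0 * z - u (n + 1) * z ^ n + u n * z ^ (n + 1)"
proof (induction n)
  case (Suc n)
  have step: "u (Suc n + 1) = k * u (n + 1) - u n" using rec[of n] by simp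
  have "(1 - k * z + z\<^sup>2) * (\<Sum>j<Suc n. u (j + 1) * z ^ j) =
      u 1 - u 0 * z - u (n + 1) * z ^ n + u n * z ^ (n + 1) + (1 - k * z + z\<^sup>2) * (u (n + 1) * z ^ n)"
    by (simp only: sum.lessThan_Suc distrib_left Suc)
  also have "\<dots> = u 1 - u 0 * z - u (Suc n + 1) * z ^ Suc n + u (Suc n) * z ^ (Suc n + 1)"
    unfolding step by (simp add: algebra_simps power2_eq_square)
  finally show ?case .
qed simp

lemma reversed_sum:
  fixes u :: "nat \<Rightarrow> 'a::comm_ring_1"
  assumes rec: "\<And>j. u (j + 2) = k * u (j + 1) - u j"
  shows "(1 - k * z + z\<^sup>2) * (\<Sum>j<n. u (j + 1) * z ^ (n - 1 - j)) =
    u 1 * z ^ (n + 1) - u 0 * z ^ n - u (n + 1) * z + u n"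
proof (induction n)
  case (Suc n)
  have step: "u (Suc n + 1) = k * u (n + 1) - u n" using rec[of n] by simp
  have "(\<Sum>j<n. u (j + 1) * z ^ (n - j)) = z * (\<Sum>j<n. u (j + 1) * z ^ (n - 1 - j))"
    unfolding sum_distrib_left
  proof (rule sum.cong)
    fix j assume "j \<in> {..<n}"
    then have "n - j = Suc (n - 1 - j)" by auto
    then show "u (j + 1) * z ^ (n - j) = z * (u (j + 1) * z ^ (n - 1 - j))" by (simp add: ac_simps)
  qed simp
  then have "(\<Sum>j<Suc n. u (j + 1) * z ^ (Suc n - 1 - j)) =
      z * (\<Sum>j<n. u (j + 1) * z ^ (n - 1 - j)) + u (n + 1)"
    by simp
  then have "(1 - k * z + z\<^sup>2) * (\<Sum>j<Suc n. u (j + 1) * z ^ (Suc n - 1 - j)) =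
      z * ((1 - k * z + z\<^sup>2) * (\<Sum>j<n. u (j + 1) * z ^ (n - 1 - j))) + (1 - k * z + z\<^sup>2) * u (n + 1)"
    by (simp only: distrib_left mult.left_commute)
  also have "\<dots> = u 1 * z ^ (Suc n + 1) - u 0 * z ^ Suc n - u (Suc n + 1) * z + u (Suc n)"
    unfolding Suc step by (simp add: algebra_simps power2_eq_square)
  finally show ?case .
qed simp

lemma sum_pairs: "(\<Sum>i<2 * n. f i) = (\<Sum>j<n. f (2 * j) + f (2 * j + 1 :: nat) :: 'a::comm_monoid_add)"
  by (induction n) (simp_all add: ac_simps)

text \<open>
The right-hand side is written in the form in which the determinant of \<open>reduced\<close> appears,
separated by the powers of \<open>t\<^sup>2\<^sup>n\<close>. The coefficients of even and odd index are two solutions of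
the same recurrence, shifted by one; they are summed forwards in the lower half of the polynomial
and backwards in the upper half.
\<close>
lemma alexander_sum:
  fixes F G s si t \<nu> :: "'a::field" and lam :: "nat \<Rightarrow> 'a"
  assumes n: "n \<ge> 1" and si: "s * si = 1" and ss: "s - si \<noteq> 0"
  defines "od \<equiv> \<lambda>j. (s ^ j - si ^ j) / (s - si)"
  assumes even: "\<And>j. j < n \<Longrightarrow> lam (2 * j) = F * s ^ (j + 1) + G * si ^ (j + 1)"
    and odd: "\<And>j. j + 1 < n \<Longrightarrow> lam (2 * j + 1) = od j"
    and last: "lam (2 * n - 1) = od (n - 1) - \<nu>"
  defines "D \<equiv> t ^ 4 - (s + si) * t\<^sup>2 + 1" and "\<tau> \<equiv> t ^ (2 * n)"
  shows "D * (1 + (\<Sum>i = 0..2 * n - 1. lam i * (t ^ (i + 3) + t ^ (4 * n - i + 3))) + t ^ (4 * n + 6)) =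
    (D + t ^ 3 * (s * F + si * G - (F + G) * t\<^sup>2 + t ^ 3))
    + \<tau> * (- \<nu> * (t ^ 8 + t\<^sup>2) - ((s ^ n + s * si ^ n) / (s + 1) + \<nu> * (1 - s - si)) * (t ^ 6 + t ^ 4)
        + 2 * (F * s ^ n + G * si ^ n) * t ^ 5 - (F * (s * s ^ n) + G * (si * si ^ n)) * (t ^ 7 + t ^ 3))
    + \<tau>\<^sup>2 * t ^ 4 * (t\<^sup>2 * D + 1 - (F + G) * t + (s * F + si * G) * t ^ 3)"
proof -
  let ?z = "t\<^sup>2" and ?k = "s + si"
  define u where "u j = F * s ^ j + G * si ^ j" for j
  \<comment> \<open>The odd coefficients continue the recurrence to index \<open>-1\<close> with the value \<open>-1\<close>; this value produces the terms \<open>t\<^sup>6\<close> and its mirror image.\<close>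
  define v where "v j = (if j = 0 then - 1 else od (j - 1))" for j
  have si': "si * s = 1" using si by (simp add: mult.commute)
  have si0: "si * (s * x) = x" "s * (si * x) = x" for x using si by (simp_all add: mult.assoc[symmetric] si')
  have urec: "u (j + 2) = ?k * u (j + 1) - u j" for j
    by (simp add: u_def algebra_simps si0)
  have od: "od 0 = 0" "od 1 = 1" "od (j + 2) = ?k * od (j + 1) - od j" for j
  proof -
    show "od (j + 2) = ?k * od (j + 1) - od j"
      using ss unfolding od_def by (simp add: diff_divide_distrib[symmetric] add_divide_distrib[symmetric])
        (simp add: algebra_simps si0)
  qed (use ss in \<open>simp_all add: od_def\<close>)
  have vrec: "v (j + 2) = ?k * v (j + 1) - v j" for j
    using od(1,2) od(3)[of "j - 1"] by (cases j) (simp_all add: v_def)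
  have fw: "(1 - ?k * ?z + ?z\<^sup>2) * (\<Sum>j<n. u (j + 1) * ?z ^ j) = u 1 - u 0 * ?z - u (n + 1) * ?z ^ n + u n * ?z ^ (n + 1)"
    "(1 - ?k * ?z + ?z\<^sup>2) * (\<Sum>j<n. v (j + 1) * ?z ^ j) = v 1 - v 0 * ?z - v (n + 1) * ?z ^ n + v n * ?z ^ (n + 1)"
    by (rule forward_sum, rule urec) (rule forward_sum, rule vrec)
  have bw: "(1 - ?k * ?z + ?z\<^sup>2) * (\<Sum>j<n. u (j + 1) * ?z ^ (n - 1 - j)) = u 1 * ?z ^ (n + 1) - u 0 * ?z ^ n - u (n + 1) * ?z + u n"
    "(1 - ?k * ?z + ?z\<^sup>2) * (\<Sum>j<n. v (j + 1) * ?z ^ (n - 1 - j)) = v 1 * ?z ^ (n + 1) - v 0 * ?z ^ n - v (n + 1) * ?z + v n"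
    by (rule reversed_sum, rule urec) (rule reversed_sum, rule vrec)
  have D: "1 - ?k * ?z + ?z\<^sup>2 = D" by (simp add: D_def flip: power_mult)
  have \<tau>: "?z ^ n = \<tau>" by (simp add: \<tau>_def power_mult)
  define eu ou eu' ou' where "eu = (\<Sum>j<n. u (j + 1) * ?z ^ j)" and "ou = (\<Sum>j<n. v (j + 1) * ?z ^ j)"
    and "eu' = (\<Sum>j<n. u (j + 1) * ?z ^ (n - 1 - j))" and "ou' = (\<Sum>j<n. v (j + 1) * ?z ^ (n - 1 - j))"
  let ?f = "\<lambda>i. t ^ (i + 3) + t ^ (4 * n - i + 3)"
  have pow: "?f (2 * j) = t ^ 3 * ?z ^ j + t ^ 5 * \<tau> * ?z ^ (n - 1 - j)"
    "?f (2 * j + 1) = t ^ 4 * ?z ^ j + t ^ 4 * \<tau> * ?z ^ (n - 1 - j)" if "j < n" for j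
  proof -
    have "4 * n - 2 * j + 3 = 5 + 2 * n + 2 * (n - 1 - j)" "4 * n - (2 * j + 1) + 3 = 4 + 2 * n + 2 * (n - 1 - j)"
      using that by auto
    then have "t ^ (4 * n - 2 * j + 3) = t ^ 5 * \<tau> * ?z ^ (n - 1 - j)"
      "t ^ (4 * n - (2 * j + 1) + 3) = t ^ 4 * \<tau> * ?z ^ (n - 1 - j)"
      by (simp_all only: power_add power_mult \<tau>_def)
    moreover have "t ^ (2 * j + 3) = t ^ 3 * ?z ^ j" "t ^ (2 * j + 1 + 3) = t ^ 4 * ?z ^ j"
    proof -
      have "2 * j + 3 = 3 + 2 * j" "2 * j + 1 + 3 = 4 + 2 * j" by simp_all
      then show "t ^ (2 * j + 3) = t ^ 3 * ?z ^ j" "t ^ (2 * j + 1 + 3) = t ^ 4 * ?z ^ j"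
        by (simp_all only: power_add power_mult)
    qed
    ultimately show "?f (2 * j) = t ^ 3 * ?z ^ j + t ^ 5 * \<tau> * ?z ^ (n - 1 - j)"
      "?f (2 * j + 1) = t ^ 4 * ?z ^ j + t ^ 4 * \<tau> * ?z ^ (n - 1 - j)"
      by (simp_all only:)
  qed
  have summand: "lam (2 * j) * ?f (2 * j) + lam (2 * j + 1) * ?f (2 * j + 1) =
      t ^ 3 * (u (j + 1) * ?z ^ j) + t ^ 5 * \<tau> * (u (j + 1) * ?z ^ (n - 1 - j))
      + t ^ 4 * (v (j + 1) * ?z ^ j) + t ^ 4 * \<tau> * (v (j + 1) * ?z ^ (n - 1 - j))
      - (if j = n - 1 then \<nu> * (t ^ 4 * ?z ^ (n - 1) + t ^ 4 * \<tau>) else 0)" if "j < n" for j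
  proof -
    have lam_odd: "lam (2 * j + 1) = v (j + 1) - (if j = n - 1 then \<nu> else 0)"
    proof (cases "j = n - 1")
      case True
      then have "2 * j + 1 = 2 * n - 1" using n by simp
      then show ?thesis using last True n by (simp add: v_def)
    next
      case False
      then show ?thesis using odd[of j] that by (simp add: v_def)
    qed
    show ?thesis unfolding pow[OF that] even[OF that] lam_odd u_def
      by (cases "j = n - 1") (simp_all add: algebra_simps)
  qed
  have z1: "t ^ 4 * ?z ^ (n - 1) = t\<^sup>2 * \<tau>"
    using n unfolding \<tau>[symmetric] by (cases n) (simp_all add: eval_nat_numeral ac_simps)
  have "(\<Sum>i = 0..2 * n - 1. lam i * ?f i) = (\<Sum>i<2 * n. lam i * ?f i)"
    using n by (intro sum.cong) auto
  also have "\<dots> = (\<Sum>j<n. lam (2 * j) * ?f (2 * j) + lam (2 * j + 1) * ?f (2 * j + 1))"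
    by (rule sum_pairs)
  also have "\<dots> = (\<Sum>j<n. t ^ 3 * (u (j + 1) * ?z ^ j) + t ^ 5 * \<tau> * (u (j + 1) * ?z ^ (n - 1 - j))
      + t ^ 4 * (v (j + 1) * ?z ^ j) + t ^ 4 * \<tau> * (v (j + 1) * ?z ^ (n - 1 - j))
      - (if j = n - 1 then \<nu> * (t ^ 4 * ?z ^ (n - 1) + t ^ 4 * \<tau>) else 0))"
    by (rule sum.cong[OF HOL.refl]) (rule summand, simp)
  also have "\<dots> = t ^ 3 * eu + t ^ 5 * \<tau> * eu' + t ^ 4 * ou + t ^ 4 * \<tau> * ou' - \<nu> * (t\<^sup>2 * \<tau> + t ^ 4 * \<tau>)"
    using n unfolding eu_def eu'_def ou_def ou'_def z1
    by (simp add: sum.distrib sum_subtractf sum_distrib_left[symmetric])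
  finally have S: "(\<Sum>i = 0..2 * n - 1. lam i * ?f i) = \<dots>" .
  have diff: "(s + 1) * (v n - v (n + 1)) = - (s ^ n + s * si ^ n)"
  proof -
    obtain k where k: "n = Suc k" using n by (cases n) auto
    have "(s - si) * ((s + 1) * (v n - v (n + 1))) = (s + 1) * (s ^ k - si ^ k - (s ^ n - si ^ n))"
      using ss by (simp add: v_def k od_def diff_divide_distrib[symmetric])
    also have "\<dots> = (s - si) * (- (s ^ n + s * si ^ n))"
      unfolding k by (simp add: algebra_simps si0)
    finally show ?thesis using ss by simp
  qed
  have s1: "s + 1 \<noteq> 0"
  proof
    assume "s + 1 = 0"
    then have "s = - 1" by (simp add: eq_neg_iff_add_eq_0)
    then show False using si ss by (simp add: minus_equation_iff)
  qed
  have vd: "(s ^ n + s * si ^ n) / (s + 1) = v (n + 1) - v n"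
    using diff s1 by (simp add: field_simps)
  have t6: "t ^ (4 * n + 6) = \<tau>\<^sup>2 * t ^ 6"
    by (simp add: \<tau>_def power_add power_mult[symmetric] ac_simps)
  have uv: "u 0 = F + G" "u 1 = s * F + si * G" "v 0 = - 1" "v 1 = 0" "u n = F * s ^ n + G * si ^ n"
    "u (n + 1) = F * (s * s ^ n) + G * (si * si ^ n)"
    using od(1) by (simp_all add: u_def v_def)
  have De: "D * eu = s * F + si * G - (F + G) * ?z - u (n + 1) * \<tau> + u n * \<tau> * ?z"
    "D * eu' = (s * F + si * G) * \<tau> * ?z - (F + G) * \<tau> - u (n + 1) * ?z + u n"
    "D * ou = ?z - v (n + 1) * \<tau> + v n * \<tau> * ?z"
    "D * ou' = \<tau> - v (n + 1) * ?z + v n"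
    using fw bw unfolding D eu_def[symmetric] eu'_def[symmetric] ou_def[symmetric] ou'_def[symmetric]
      uv(1-4) power_add \<tau> by (simp_all add: mult.assoc)
  have "D * (1 + (\<Sum>i = 0..2 * n - 1. lam i * ?f i) + t ^ (4 * n + 6)) =
      D + D * (\<tau>\<^sup>2 * t ^ 6) + t ^ 3 * (D * eu) + t ^ 5 * \<tau> * (D * eu') + t ^ 4 * (D * ou) + t ^ 4 * \<tau> * (D * ou')
      - \<nu> * (t\<^sup>2 * \<tau> + t ^ 4 * \<tau>) * D"
    unfolding S t6 by (simp add: algebra_simps)
  also have "\<dots> = (D + t ^ 3 * (s * F + si * G - (F + G) * t\<^sup>2 + t ^ 3))
    + \<tau> * (- \<nu> * (t ^ 8 + t\<^sup>2) - (v (n + 1) - v n + \<nu> * (1 - s - si)) * (t ^ 6 + t ^ 4)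
        + 2 * u n * t ^ 5 - u (n + 1) * (t ^ 7 + t ^ 3))
    + \<tau>\<^sup>2 * t ^ 4 * (t\<^sup>2 * D + 1 - (F + G) * t + (s * F + si * G) * t ^ 3)"
    unfolding De unfolding D_def by Groebner_Basis.algebra
  finally show ?thesis unfolding vd uv(5,6) .
qed

section \<open>Two quadratic relations modulo \<open>r0\<close>\<close>

text \<open>
\<open>r0\<close>, and \<open>alpha\<close> and \<open>beta\<close> up to simple factors, as polynomials in \<open>u = m\<^sup>2\<close>, \<open>s\<close> and \<open>T = s\<^sup>2\<^sup>n\<close>. In
this form the dependence on \<open>n\<close> has disappeared.
\<close>
definition red_r0 :: "complex \<Rightarrow> complex \<Rightarrow> complex \<Rightarrow> complex" where
  "red_r0 u s T = (u^4 + 1) * (s - 1) * (s + 1)^2 * (T - s^2) * s^2 * T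
   - (u^3 + u) * (s^3 * T^3 + (2 * s^6 + s^5 - 4 * s^4 + s^3 + s^2 - s - 1) * s * T^2 - (s^6 + s^5 - s^4 - s^3 + 4 * s^2 - s - 2) * s^2 * T + s^6)
   + u^2 * ((s^2 + 1) * s^2 * T^3 + (s^6 + 2*s^5 - 3*s^4 - 2*s^3 + 6*s^2 - 4*s - 2) * s^3 * T^2
            - (2*s^6 + 4*s^5 - 6*s^4 + 2*s^3 + 3*s^2 - 2*s - 1) * T + (s^2 + 1) * s^5)"

definition red_alpha :: "complex \<Rightarrow> complex \<Rightarrow> complex \<Rightarrow> complex" where
  "red_alpha u s T = - (u^3 * (s - 1) * s^2 * (s*T + 1))
      + u^2 * (s^2 * T * (s^4 - 2*s^2 + 3*s - 1) + s^4 - 3*s^3 + 2*s^2 - 1)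
      - u * s * (T * (2*s^3 - s^2 + 1) - s * (s^3 - s + 2)) + s^2 * (T - s^2)"

definition red_beta :: "complex \<Rightarrow> complex \<Rightarrow> complex \<Rightarrow> complex" where
  "red_beta u s T = u^3 * s * T * (s^2 - 1) * (s^3 + 1)
   - u^2 * (s^2 * T^2 * (s^3 - s^2 + 1) + T * (s - 1) * (s^3 + s + 1) * (s^3 + s^2 + 1)
            - s^2 * (s^3 - s + 1))
   + u * s * (s^3 + 1) * (T - 1) * (T + s^2) - s^2 * (T - s^2) * (T + s)"

text \<open>
With \<open>\<xi> = A / B = m \<alpha> / \<beta>\<close>, the left-hand side is \<open>B\<^sup>2\<close> times a quadratic polynomial in \<open>\<xi>\<close>. Its
vanishing makes the images of \<open>axba\<close> and \<open>wxb\<close> agree when \<open>w\<close> is mapped to the triangular matrix with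
diagonal \<open>s\<close>, \<open>s\<^sup>-\<^sup>1\<close> that commutes with the image of \<open>x\<close>. The cofactor of \<open>red_r0\<close> is the quotient in a
polynomial division.
\<close>
lemma first_quadratic_identity:
  fixes u s T :: complex
  defines "H \<equiv> 1 - u*s + u*s*T - s^2*T" and "H' \<equiv> u - s + s*T - u*s^2*T"
    and "A \<equiv> (s^2 - 1) * T * red_alpha u s T" and "B \<equiv> s * red_beta u s T"
  shows "u*T*H*B^2 + s*T*(u^2 - 1)*(s + 1)*A*B + s*H'*A^2 = red_r0 u s T * (s * T * (
      u^4 * s^7 * T - u^4 * s^5 * T + u^4 * s^4 * T - u^4 * s^2 * T - u^3 * s^9 * T^2
      + 2 * u^3 * s^8 * T^2 - u^3 * s^8 * T - u^3 * s^7 * T^2 - 2 * u^3 * s^6 * T^2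
      - u^3 * s^6 * T + u^3 * s^6 + 2 * u^3 * s^5 * T^2 - u^3 * s^5 * T + u^3 * s^4 * T
      - 2 * u^3 * s^4 - u^3 * s^3 * T^2 + u^3 * s^3 * T + 2 * u^3 * s^3 + u^3 * s^2
      + u^3 * s * T - 2 * u^3 * s + u^3 + u^2 * s^8 * T^2 - u^2 * s^8 * T + 4 * u^2 * s^7 * T
      - u^2 * s^7 - u^2 * s^6 * T^2 + 2 * u^2 * s^5 * T^2 - 6 * u^2 * s^5 * T
      + 6 * u^2 * s^4 * T - 2 * u^2 * s^4 + u^2 * s^3 + u^2 * s^2 * T^2 - 4 * u^2 * s^2 * T
      + u^2 * s * T - u^2 * s + u * s^7 * T - 2 * u * s^6 * T^2 + 2 * u * s^6 + u * s^5 * T^2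
      - 2 * u * s^5 * T + 2 * u * s^4 * T - u * s^4 - 2 * u * s^3 * T^2 + 2 * u * s^3
      - u * s^2 * T - s^6 * T - s^5 + s^4 * T^2 + s^3 * T))"
  unfolding red_r0_def red_alpha_def red_beta_def A_def B_def H_def H'_def
  by Groebner_Basis.algebra

text \<open>
In the same sense this is \<open>B\<^sup>2\<close> times a quadratic polynomial in \<open>\<xi>\<close>. Its vanishing implies the
identity \<open>tr (WB) \<nu> = - tr (XB)\<close> in the eigenbasis, with \<open>\<nu> = (s\<^sup>2 - 1) Y / (B H s\<^sup>n)\<close>. Again the cofactor comes
from polynomial division.
\<close>
lemma second_quadratic_identity:
  fixes u s T :: complex
  defines "H \<equiv> 1 - u*s + u*s*T - s^2*T"
    and "A \<equiv> (s^2 - 1) * T * red_alpha u s T" and "B \<equiv> s * red_beta u s T"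
  defines "Y \<equiv> (1 + u)*T*B + (1 - s*T)*A" and "Ga \<equiv> s * ((1 - s)*A + T*(u - s)*B)"
  shows "(s^2 * (H*B - Ga) + Ga) * (s^2 - 1) * Y + s*H*B*(T*(H*B - Ga) + Ga) =
     red_r0 u s T * (s * (s - 1) * (s + 1) * T * (
      u^4 * s^9 * T - u^4 * s^8 * T + 2 * u^4 * s^6 * T - 2 * u^4 * s^5 * T + u^4 * s^3 * T
      - u^4 * s^2 * T - u^3 * s^10 * T + 2 * u^3 * s^9 * T - u^3 * s^8 * T^2
      - 4 * u^3 * s^8 * T + u^3 * s^8 + 2 * u^3 * s^7 * T^2 - 2 * u^3 * s^7 * T - u^3 * s^7
      - 2 * u^3 * s^6 * T^2 + 8 * u^3 * s^6 * T - 8 * u^3 * s^5 * T + 2 * u^3 * s^5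
      + u^3 * s^4 * T^2 + 2 * u^3 * s^4 * T - 2 * u^3 * s^4 - u^3 * s^3 * T^2
      + 4 * u^3 * s^3 * T + u^3 * s^3 - 2 * u^3 * s^2 * T + u^3 * s * T - u^2 * s^11 * T^2
      + 3 * u^2 * s^10 * T^2 - 2 * u^2 * s^9 * T^2 + u^2 * s^9 * T - u^2 * s^9
      - 4 * u^2 * s^8 * T^2 + u^2 * s^8 * T + 2 * u^2 * s^8 + 10 * u^2 * s^7 * T^2
      - u^2 * s^7 * T - 5 * u^2 * s^7 - 6 * u^2 * s^6 * T^2 + 4 * u^2 * s^6 * T + u^2 * s^6
      - u^2 * s^5 * T^2 - 4 * u^2 * s^5 * T + 6 * u^2 * s^5 + 5 * u^2 * s^4 * T^2
      + u^2 * s^4 * T - 10 * u^2 * s^4 - 2 * u^2 * s^3 * T^2 - u^2 * s^3 * T + 4 * u^2 * s^3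
      + u^2 * s^2 * T^2 - u^2 * s^2 * T + 2 * u^2 * s^2 - 3 * u^2 * s + u^2 - u * s^10 * T
      + 2 * u * s^9 * T^2 + 3 * u * s^9 * T - 5 * u * s^8 * T^2 - 4 * u * s^8 * T + 2 * u * s^8
      + 3 * u * s^7 * T^2 - 3 * u * s^7 + 2 * u * s^6 * T^2 + 5 * u * s^6 * T + 6 * u * s^6
      - 6 * u * s^5 * T^2 - 5 * u * s^5 * T - 2 * u * s^5 + 3 * u * s^4 * T^2 - 3 * u * s^4
      - 2 * u * s^3 * T^2 + 4 * u * s^3 * T + 5 * u * s^3 - 3 * u * s^2 * T - 2 * u * s^2
      + u * s * T + s^9 * T - 2 * s^8 * T - s^7 * T^2 + s^7 * T - s^7 + 2 * s^6 * T^2 - s^6 * T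
      + s^6 - s^5 * T^2 + s^5 * T - 2 * s^5 + s^4 * T^2 - s^4 * T + s^4 + 2 * s^3 * T - s^2 * T))"
  unfolding red_r0_def red_alpha_def red_beta_def A_def B_def H_def Y_def Ga_def
  by Groebner_Basis.algebra

lemma pretzel_polynomials:
  fixes m s :: complex
  assumes "n \<ge> 1"
  defines "T \<equiv> s ^ (2 * n)"
  shows "r0 n m s = red_r0 (m\<^sup>2) s T"
    and "alpha n m s = (s\<^sup>2 - 1) * T * red_alpha (m\<^sup>2) s T"
    and "beta n m s = m * (s * red_beta (m\<^sup>2) s T)"
proof -
  obtain k where n: "n = Suc k" using assms(1) by (cases n) auto
  have T: "T = s\<^sup>2 * s ^ (2 * k)" by (simp add: T_def n power_add power2_eq_square)
  have p: "s ^ (2 * n + 2) = T * s\<^sup>2" "s ^ (2 * n + 1) = T * s" "s ^ (4 * n) = T\<^sup>2" "s ^ (4 * n + 1) = T\<^sup>2 * s"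
    "s ^ (4 * n + 3) = T\<^sup>2 * s ^ 3" "s ^ (6 * n + 2) = T ^ 3 * s\<^sup>2" "s ^ (6 * n + 3) = T ^ 3 * s ^ 3"
    "s ^ (2 * n - 2) = s ^ (2 * k)"
  proof -
    have e: "4 * n = 2 * n * 2" "6 * n = 2 * n * 3" by simp_all
    show "s ^ (2 * n + 2) = T * s\<^sup>2" "s ^ (2 * n + 1) = T * s" "s ^ (4 * n) = T\<^sup>2" "s ^ (4 * n + 1) = T\<^sup>2 * s"
      "s ^ (4 * n + 3) = T\<^sup>2 * s ^ 3" "s ^ (6 * n + 2) = T ^ 3 * s\<^sup>2" "s ^ (6 * n + 3) = T ^ 3 * s ^ 3"
      by (simp_all only: e power_add power_mult T_def power_one_right)
  qed (simp add: n)
  show "r0 n m s = red_r0 (m\<^sup>2) s T"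
    unfolding r0_def red_r0_def p T_def[symmetric] by Groebner_Basis.algebra
  show "alpha n m s = (s\<^sup>2 - 1) * T * red_alpha (m\<^sup>2) s T"
    unfolding alpha_def red_alpha_def p T_def[symmetric] by Groebner_Basis.algebra
  show "beta n m s = m * (s * red_beta (m\<^sup>2) s T)"
    unfolding beta_def red_beta_def p T_def[symmetric] unfolding T by Groebner_Basis.algebra
qed

section \<open>The representation in an eigenbasis\<close>

text \<open>
The numbers \<open>F\<close> and \<open>G\<close> are the diagonal entries of the image of \<open>b\<close> in the eigenbasis
\<open>(1, 1 / p)\<close>, \<open>(0, 1)\<close> of the image of \<open>w\<close>, and \<open>b12\<close> and the right-hand side of the third claim are
its off-diagonal entries. By the first quadratic equation all four become affine in \<open>\<xi>\<close>, so that
\<open>k\<close> and the corresponding lower left entry for \<open>a\<close> are proportional to the off-diagonal ones, with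
factors built from \<open>s\<close>, \<open>T\<close> and \<open>\<omega>\<close>. By the second equation \<open>\<omega>\<close> is a root of a quadratic polynomial over the field
generated by \<open>s\<close> and \<open>T\<close>.
\<close>
lemma eigenbasis_parameters:
  fixes m s T S \<xi> :: complex
  assumes nz: "m \<noteq> 0" "s \<noteq> 0" "S \<noteq> 0" "\<xi> \<noteq> 0" and T: "T = S\<^sup>2"
    and p0: "s * T + 1 \<noteq> 0" and s1: "s + 1 \<noteq> 0" "s - 1 \<noteq> 0"
  defines "H \<equiv> 1 - m\<^sup>2 * s + m\<^sup>2 * s * T - s\<^sup>2 * T" and "p \<equiv> s * T + 1"
  assumes H0: "H \<noteq> 0"
    and q1: "m\<^sup>2 * T * H + s * T * (m ^ 4 - 1) * (s + 1) * \<xi>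
        + s * (m\<^sup>2 - s + s * T - m\<^sup>2 * s\<^sup>2 * T) * \<xi>\<^sup>2 = 0"
  defines "\<mu> \<equiv> m + 1 / m" and "y \<equiv> m / \<xi>"
  defines "\<gamma> \<equiv> s * ((1 - s) * \<xi> + T * (m\<^sup>2 - s))" and "Y \<equiv> (1 + m\<^sup>2) * T + (1 - s * T) * \<xi>"
  assumes q2: "(s\<^sup>2 * (H - \<gamma>) + \<gamma>) * (s\<^sup>2 - 1) * Y + s * H * (T * (H - \<gamma>) + \<gamma>) = 0"
  defines "G \<equiv> \<mu> * \<gamma> / H" and "\<omega> \<equiv> Y / H"
  defines "F \<equiv> \<mu> - G"
  defines "b12 \<equiv> - ((s - m * y) * (m * s - y) / (s * m * y))" and "z \<equiv> y / s"
  defines "k \<equiv> - ((m\<^sup>2 - s) * p / (m * (s + 1)))"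
  shows "F = z + b12 / p"
    and "k * (s + 1) * \<omega> = - (T * b12)"
    and "((1 / m - s * \<mu> / (s + 1)) / p) * s * (s + 1) * \<omega> = z + (G - z) / p"
    and "(s\<^sup>2 - 1)\<^sup>2 * \<omega>\<^sup>2 + (s\<^sup>2 - T) * \<omega> - T = 0"
    and "(s * F + G / s) * ((s\<^sup>2 - 1) * \<omega>) = - (T * F + G)"
    and "(1 + s) * (s * T * F + G) = - (s * \<mu> * ((s\<^sup>2 - 1) * \<omega>))"
proof -
  have H: "H = 1 - m\<^sup>2 * s + m\<^sup>2 * s * T - s\<^sup>2 * T" by (simp add: H_def)
  have GH: "G * H = \<mu> * \<gamma>" and FH: "F * H = \<mu> * (H - \<gamma>)" and YH: "Y = \<omega> * H"
    unfolding F_def G_def \<omega>_def using H0 by (simp_all add: field_simps)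
  \<comment> \<open>This combination is \<open>1 - sT\<close> times the expression in \<open>q2\<close>.\<close>
  have "s * (s - 1) * ((s\<^sup>2 - 1)\<^sup>2 * Y\<^sup>2 + (s\<^sup>2 - T) * H * Y - T * H\<^sup>2) = 0"
    using q2 unfolding \<gamma>_def Y_def H by Groebner_Basis.algebra
  then have "(s\<^sup>2 - 1)\<^sup>2 * Y\<^sup>2 + (s\<^sup>2 - T) * H * Y - T * H\<^sup>2 = 0"
    using nz s1 by simp
  then have "H\<^sup>2 * ((s\<^sup>2 - 1)\<^sup>2 * \<omega>\<^sup>2 + (s\<^sup>2 - T) * \<omega> - T) = 0"
    unfolding YH by Groebner_Basis.algebra
  then show "(s\<^sup>2 - 1)\<^sup>2 * \<omega>\<^sup>2 + (s\<^sup>2 - T) * \<omega> - T = 0" using H0 by simp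
  have "H\<^sup>2 * ((s\<^sup>2 * F + G) * ((s\<^sup>2 - 1) * \<omega>) + s * (T * F + G)) = 0"
    using q2 GH FH unfolding YH by Groebner_Basis.algebra
  then have III': "(s\<^sup>2 * F + G) * ((s\<^sup>2 - 1) * \<omega>) = - (s * (T * F + G))"
    using H0 by (simp add: eq_neg_iff_add_eq_0)
  have sFG: "s * (s * F + G / s) = s\<^sup>2 * F + G"
    using nz by (simp add: field_simps power2_eq_square)
  have "s * ((s * F + G / s) * ((s\<^sup>2 - 1) * \<omega>)) = s * (- (T * F + G))"
    unfolding mult.assoc[of s "s * F + G / s", symmetric] sFG III' by (simp add: algebra_simps)
  then show "(s * F + G / s) * ((s\<^sup>2 - 1) * \<omega>) = - (T * F + G)"
    by (rule mult_left_cancel[OF nz(2), THEN iffD1])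
  have "(1 + s) * (s * T * (H - \<gamma>) + \<gamma>) = - (s * ((s\<^sup>2 - 1) * Y))"
    unfolding \<gamma>_def Y_def H by Groebner_Basis.algebra
  then have "H * ((1 + s) * (s * T * F + G)) = H * (- (s * \<mu> * ((s\<^sup>2 - 1) * \<omega>)))"
    using GH FH unfolding YH by Groebner_Basis.algebra
  then show "(1 + s) * (s * T * F + G) = - (s * \<mu> * ((s\<^sup>2 - 1) * \<omega>))"
    by (rule mult_left_cancel[OF H0, THEN iffD1])
  have fg: "F = \<mu> * (H - \<gamma>) / H" using FH H0 by (simp add: field_simps)
  have b12: "b12 = - ((s * \<xi> - m\<^sup>2) * (s * \<xi> - 1) / (s * m * \<xi>))"
    unfolding b12_def y_def using nz by (simp add: field_simps power2_eq_square)
  have z: "z = m / (s * \<xi>)" unfolding z_def y_def by simp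
  have \<mu>: "\<mu> = (m\<^sup>2 + 1) / m" unfolding \<mu>_def using nz by (simp add: field_simps power2_eq_square)
  have p: "p \<noteq> 0" "p = s * T + 1" using p0 by (simp_all add: p_def)
  have "(m\<^sup>2 + 1) * (H - \<gamma>) * (s * \<xi> * p) = (m\<^sup>2 * p - (s * \<xi> - m\<^sup>2) * (s * \<xi> - 1)) * H"
    using q1 unfolding \<gamma>_def H p(2) by Groebner_Basis.algebra
  then show "F = z + b12 / p"
    unfolding fg \<mu> z b12 using H0 nz p(1) by (simp add: divide_simps) (simp add: field_simps power2_eq_square)?
  have "(m\<^sup>2 - s) * p * Y * s * \<xi> = - (T * (s * \<xi> - m\<^sup>2) * (s * \<xi> - 1)) * H"
    using q1 unfolding Y_def H p(2) by Groebner_Basis.algebra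
  then have "- ((m\<^sup>2 - s) * p / m) * (Y / H) = - (T * b12)"
    unfolding b12 using H0 nz by (simp add: field_simps power2_eq_square) Groebner_Basis.algebra
  moreover have "k * (s + 1) = - ((m\<^sup>2 - s) * p / m)" unfolding k_def using s1(1) by simp
  ultimately show "k * (s + 1) * \<omega> = - (T * b12)" by (simp only: \<omega>_def)
  have "(1 - m\<^sup>2 * s) * s * Y * s * \<xi> = m\<^sup>2 * (p - 1) * H + (m\<^sup>2 + 1) * \<gamma> * s * \<xi>"
    using q1 unfolding Y_def \<gamma>_def H p(2) by Groebner_Basis.algebra
  then have "(1 - m\<^sup>2 * s) * s * Y / (m * p * H) = z + (G - z) / p"
    unfolding G_def \<mu> z using H0 nz p(1) by (simp add: field_simps power2_eq_square) Groebner_Basis.algebra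
  moreover have "((1 / m - s * \<mu> / (s + 1)) / p) * (s + 1) = (1 - m\<^sup>2 * s) / (m * p)"
  proof -
    have "(1 / m - s * \<mu> / (s + 1)) * (s + 1) = (s + 1) / m - s * \<mu>"
      using s1(1) by (simp add: left_diff_distrib)
    also have "\<dots> = (1 - m\<^sup>2 * s) / m" unfolding \<mu> using nz by (simp add: field_simps)
    finally show ?thesis using p(1) by (simp add: field_simps)
  qed
  then have "((1 / m - s * \<mu> / (s + 1)) / p) * (s + 1) * (s * \<omega>) = (1 - m\<^sup>2 * s) / (m * p) * (s * \<omega>)" by simp
  ultimately show "((1 / m - s * \<mu> / (s + 1)) / p) * s * (s + 1) * \<omega> = z + (G - z) / p"
    unfolding \<omega>_def by (simp add: ac_simps)
qed


text \<open>
The off-diagonal entries of the two relations for \<open>A\<close> are the corresponding entries of \<open>B\<close> times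
\<open>Z\<close> or times \<open>(s\<^sup>2 - 1) P / s - s\<close>, up to monomials. Comparison with the known ratios \<open>k : g\<close> and
\<open>l : h\<close> determines \<open>Z\<close>, hence \<open>P\<close> and \<open>Q\<close>, in terms of \<open>\<omega>\<close>. One nonzero off-diagonal entry is
enough, since both give the same two equations.
\<close>
lemma eigenbasis_relations:
  fixes F G g h s si S Si k l \<omega> T :: complex
  assumes inv: "s * si = 1" "S * Si = 1" and gh: "g * h = F * G - 1" and T: "T = S\<^sup>2"
  defines "P \<equiv> G\<^sup>2 + (F * G - 1) * s\<^sup>2" and "Q \<equiv> F\<^sup>2 + (F * G - 1) * si\<^sup>2"
  defines "W \<equiv> M2 s 0 0 si" and "X \<equiv> M2 S 0 0 Si" and "B \<equiv> M2 F g h G"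
  assumes A: "M2 a k l d = W * (madj B * madj W * madj B) * W * B"
      "M2 a k l d * X = X * B * W * B * madj W * madj B"
    and kg: "k * (s + 1) * \<omega> = - (T * g)" and lh: "l * s * (s + 1) * \<omega> = h" and kl: "k \<noteq> 0 \<or> l \<noteq> 0"
    and \<omega>: "(s\<^sup>2 - 1)\<^sup>2 * \<omega>\<^sup>2 + (s\<^sup>2 - T) * \<omega> - T = 0" and s2: "s\<^sup>2 - 1 \<noteq> 0"
  shows "Si * P + S * Q = - ((s\<^sup>2 - 1) * \<omega> * Si)"
    and "(s\<^sup>2 - 1) * (Si * P - s * S * Q) = s * (S + s * Si)"
proof -
  define Z where "Z = (s\<^sup>2 - 1) * Q + 1"
  have S0: "S \<noteq> 0" "Si \<noteq> 0" "s \<noteq> 0" using inv by auto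
  then have T0: "T \<noteq> 0" using T by simp
  have "\<omega> \<noteq> 0" using \<omega> T0 by auto
  note e1 = A(1)[unfolded W_def B_def madj.simps times_m2.simps m2.inject]
    and e2 = A(2)[unfolded W_def B_def X_def madj.simps times_m2.simps m2.inject]
  have k1: "k = g * ((s\<^sup>2 - 1) * P * si - s)"
    using e1[THEN conjunct2, THEN conjunct1] inv gh unfolding P_def by Groebner_Basis.algebra
  have l1: "l = - (h * Z * si)"
    using e1[THEN conjunct2, THEN conjunct2, THEN conjunct1] inv gh unfolding Q_def Z_def
    by Groebner_Basis.algebra
  have "k * Si = S * g * Z"
    using e2[THEN conjunct2, THEN conjunct1] inv gh unfolding Q_def Z_def by Groebner_Basis.algebra
  moreover have "l * S = Si * h * (1 - (s\<^sup>2 - 1) * P * si\<^sup>2)"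
    using e2[THEN conjunct2, THEN conjunct2, THEN conjunct1] inv gh unfolding P_def
    by Groebner_Basis.algebra
  ultimately have k2: "k = T * g * Z" and l2: "l * T = h * (1 - (s\<^sup>2 - 1) * P * si\<^sup>2)"
    using inv unfolding T by Groebner_Basis.algebra+
  have *: "(s\<^sup>2 - 1) * P * si - s = T * Z \<and> Z * (s + 1) * \<omega> = - 1"
  proof (cases "k = 0")
    case False
    then have "g \<noteq> 0" using k1 by auto
    have "g * ((s\<^sup>2 - 1) * P * si - s - T * Z) = 0" using k1 k2 by Groebner_Basis.algebra
    moreover have "T * g * (Z * (s + 1) * \<omega> + 1) = 0" using k2 kg by Groebner_Basis.algebra
    ultimately show ?thesis using \<open>g \<noteq> 0\<close> T0 by (simp add: eq_neg_iff_add_eq_0)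
  next
    case True
    then have "h \<noteq> 0" using kl l1 by auto
    have "h * (Z * (s + 1) * \<omega> + 1) = 0" using l1 lh inv by Groebner_Basis.algebra
    moreover have "h * ((s\<^sup>2 - 1) * P * si - s - T * Z) = 0" using l1 l2 inv by Groebner_Basis.algebra
    ultimately show ?thesis using \<open>h \<noteq> 0\<close> by (simp add: eq_neg_iff_add_eq_0)
  qed
  show "(s\<^sup>2 - 1) * (Si * P - s * S * Q) = s * (S + s * Si)"
    using * inv unfolding T Z_def by Groebner_Basis.algebra
  have "(s\<^sup>2 - 1) * \<omega> * (P + T * Q) = - ((s\<^sup>2 - 1) * \<omega> * ((s\<^sup>2 - 1) * \<omega>))"
  proof -
    have "(s\<^sup>2 - 1) * P = s * (T * Z) + s\<^sup>2" using * inv by Groebner_Basis.algebra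
    then have "(s\<^sup>2 - 1) * (P + T * Q) = (s + 1) * T * Z + s\<^sup>2 - T"
      unfolding Z_def by Groebner_Basis.algebra
    then show ?thesis using * \<omega> by Groebner_Basis.algebra
  qed
  then have "P + T * Q = - ((s\<^sup>2 - 1) * \<omega>)" using s2 \<open>\<omega> \<noteq> 0\<close> by (simp add: mult_left_cancel flip: mult_minus_right)
  then show "Si * P + S * Q = - ((s\<^sup>2 - 1) * \<omega> * Si)"
    using inv unfolding T by Groebner_Basis.algebra
qed

text \<open>
The conclusions are exactly the data that \<open>mdet_reduced\<close> needs. The trace identities are proved
after conjugation by a matrix \<open>E\<close> whose columns are the eigenvectors of \<open>w\<close> and \<open>x\<close>.
\<close>
lemma pretzel_traces:
  fixes m s S \<xi> :: complex and \<Psi> :: "pretzel_gen free_group \<Rightarrow> complex m2"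
  assumes rep: "pretzel_rep \<Psi> n"
  assumes nz: "m \<noteq> 0" "s \<noteq> 0" "\<xi> \<noteq> 0" 
  defines "S \<equiv> s ^ n" and "T \<equiv> s ^ (2 * n)"
  defines "p \<equiv> s * T + 1"
  assumes p0: "p \<noteq> 0" and s1: "s + 1 \<noteq> 0" "s - 1 \<noteq> 0"
  defines "H \<equiv> 1 - m\<^sup>2 * s + m\<^sup>2 * s * T - s\<^sup>2 * T" 
  assumes H0: "H \<noteq> 0"
    and q1: "m\<^sup>2 * T * H + s * T * (m ^ 4 - 1) * (s + 1) * \<xi>
        + s * (m\<^sup>2 - s + s * T - m\<^sup>2 * s\<^sup>2 * T) * \<xi>\<^sup>2 = 0"
  defines "\<mu> \<equiv> m + 1 / m" and "y \<equiv> m / \<xi>"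
  defines "\<gamma> \<equiv> s * ((1 - s) * \<xi> + T * (m\<^sup>2 - s))" and "Y \<equiv> (1 + m\<^sup>2) * T + (1 - s * T) * \<xi>"
  assumes q2: "(s\<^sup>2 * (H - \<gamma>) + \<gamma>) * (s\<^sup>2 - 1) * Y + s * H * (T * (H - \<gamma>) + \<gamma>) = 0"
  defines "G \<equiv> \<mu> * \<gamma> / H" and "F \<equiv> \<mu> - \<mu> * \<gamma> / H" and "\<nu> \<equiv> (s\<^sup>2 - 1) * (Y / H) * (1 / S)"
  defines "b12 \<equiv> - ((s - m * y) * (m * s - y) / (s * m * y))" and "z \<equiv> y / s"
  defines "k \<equiv> - ((m\<^sup>2 - s) * p / (m * (s + 1)))"
  defines "A \<equiv> \<Psi> (gen GenA)" and "B \<equiv> \<Psi> (gen GenB)" and "X \<equiv> \<Psi> (gen GenX)" and "W \<equiv> \<Psi> pretzel_word"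
  assumes A: "A = M2 m k 0 (1 / m)" and B: "B = M2 z b12 z (\<mu> - z)"
    and X: "X = M2 S 0 ((S - 1 / S) / p) (1 / S)"
  defines "V \<equiv> madj B * madj W * madj B"
  shows "mdet A = 1" "mdet B = 1" "mdet X = 1" "mdet W = 1"
    and "mtr A = \<mu>" "mtr B = F + G" "mtr W = s + 1 / s" "mtr (W * B) = s * F + 1 / s * G"
    and "X * W = W * X" "A = W * V * W * B" "A * X = X * B * W * B * madj W * madj B"
    and "mtr (W * V * madj X) = - \<nu>"
    and "mtr (W * V * W * madj X) = (S + s * (1 / S)) / (s + 1) + \<nu> * (1 - s - 1 / s)"
    and "mtr (madj B * madj X) + mtr (W * madj B * madj X) + mtr (W * V * madj W * madj B * madj X)
           = 2 * (F * S + G * (1 / S))"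
    and "mtr (madj B * madj W * madj X) = F * (s * S) + G * (1 / s * (1 / S))"
    and "mtr (W * V * madj B * madj X) = F * (s * S) + G * (1 / s * (1 / S))"
proof -
  interpret pretzel_rep \<Psi> n by (rule rep)
  have S0: "S \<noteq> 0" using nz by (simp add: S_def)
  have TS: "T = S\<^sup>2" by (simp add: T_def S_def power_mult[symmetric] mult.commute)
  have y0: "y \<noteq> 0" using nz by (simp add: y_def)
  define \<omega> where "\<omega> = Y / H"
  note par = eigenbasis_parameters[of m s S \<xi> T, folded H_def p_def \<mu>_def y_def \<gamma>_def Y_def,
    OF nz(1,2) S0 nz(3) TS p0 s1 H0 q1 q2, folded F_def G_def b12_def z_def k_def \<omega>_def]
  have s2: "s\<^sup>2 - 1 \<noteq> 0"
    using s1 by (simp add: power2_eq_square square_diff_one_factored)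
  have b12p: "b12 = p * (F - z)" using par(1) p0 by (simp add: field_simps)
  have FG: "F + G = \<mu>" by (simp add: F_def G_def)
  show dA: "mdet A = 1" and "mtr A = \<mu>" unfolding A using nz by (simp_all add: \<mu>_def)
  have "z * (\<mu> - z) - b12 * z = 1"
    unfolding z_def b12_def \<mu>_def using nz y0 by (simp add: field_simps power2_eq_square)
  then show dB: "mdet B = 1" unfolding B by simp
  show "mtr B = F + G" unfolding B FG by simp
  show dX: "mdet X = 1" unfolding X using S0 by simp
  define W0 where "W0 = M2 s 0 ((s - 1 / s) / p) (1 / s)"
  define E where "E = M2 1 0 (1 / p) (1::complex)"
  have E: "mdet E = 1" by (simp add: E_def)
  define cj where "cj z = madj E * z * E" for z
  note cj = m2_conjugate[OF E, folded cj_def]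
  define g h where "g = b12" and "h = z + (G - z) / p"
  define l where "l = (1 / m - s * \<mu> / (s + 1)) / p"
  have cX: "cj X = M2 S 0 0 (1 / S)" unfolding cj_def E_def X using p0 by (simp add: field_simps)
  have cW0: "cj W0 = M2 s 0 0 (1 / s)" unfolding cj_def E_def W0_def using p0 by (simp add: field_simps)
  have G': "\<mu> - z - b12 / p = G" using par(1) FG by (simp add: field_simps)
  have cB: "cj B = M2 F g h G"
    unfolding cj_def E_def B g_def h_def using par(1) G' p0 by (simp add: field_simps)
  have cA: "cj A = M2 (m + k / p) k l (1 / m - k / p)"
  proof -
    have "m + k / p = s * \<mu> / (s + 1)"
      unfolding k_def \<mu>_def using p0 nz s1 by (simp add: divide_simps) (simp add: algebra_simps power2_eq_square)
    then have "l = 1 / (m * p) - (m + k / p) / p" unfolding l_def by (simp add: diff_divide_distrib)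
    then show ?thesis unfolding cj_def E_def A using p0 nz by (simp add: add_divide_distrib diff_divide_distrib)
  qed
  have inj: "u = v" if "cj u = cj v" for u v
  proof -
    have "E * cj u * madj E = u" for u
      by (simp add: cj_def mult.assoc mult_madj E) (simp add: mult.assoc[symmetric] mult_madj E)
    then show ?thesis using that by metis
  qed
  have gh: "g * h = F * G - 1"
    using dB cj(4)[of B] unfolding cB by (simp add: algebra_simps)
  have C: "X * B = M2 (S * z) (S * b12) (S * z * (1 + s) / p) (S * ((1 - 1 / T) / p * b12 + (\<mu> - z) / T))"
  proof -
    have pS: "p / S = s * S + 1 / S" unfolding p_def TS using S0 by (simp add: field_simps power2_eq_square)
    have "(S - 1 / S) / p + 1 / S = (S - 1 / S + p / S) / p" using p0 by (simp add: add_divide_distrib)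
    also have "\<dots> = S * (1 + s) / p" unfolding pS by (simp add: algebra_simps)
    finally have slope: "(S - 1 / S) / p + 1 / S = S * (1 + s) / p" .
    have c21: "(S - 1 / S) / p * z + 1 / S * z = S * z * (1 + s) / p"
      unfolding distrib_right[symmetric] slope by simp
    have ST: "S - 1 / S = S * (1 - 1 / T)" "1 / S = S / T"
      unfolding TS using S0 by (simp_all add: field_simps power2_eq_square)
    have c22: "(S - 1 / S) / p * b12 + 1 / S * (\<mu> - z) = S * ((1 - 1 / T) / p * b12 + (\<mu> - z) / T)"
      unfolding ST(1) unfolding ST(2) by (simp add: distrib_left)
    show ?thesis unfolding X B times_m2.simps c21 c22 by simp
  qed
  have b12: "b12 = - ((s * \<xi> - m\<^sup>2) * (s * \<xi> - 1) / (s * m * \<xi>))"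
    unfolding b12_def y_def using nz by (simp add: field_simps power2_eq_square)
  have z: "z = m / (s * \<xi>)" unfolding z_def y_def by simp
  have \<mu>: "\<mu> = (m\<^sup>2 + 1) / m" unfolding \<mu>_def using nz by (simp add: field_simps power2_eq_square)
  define c21 c22 where "c21 = S * z * (1 + s) / p" and "c22 = S * ((1 - 1 / T) / p * b12 + (\<mu> - z) / T)"
  have T0: "T \<noteq> 0" using nz by (simp add: T_def)
  have 11: "m * (m * (S * z) + k * c21) = s * (S * z)"
    unfolding k_def c21_def using nz s1 p0 by (simp add: divide_simps) (simp add: algebra_simps power2_eq_square)
  have 21: "(s - 1 / s) / p * (S * z) + c21 / s = c21"
    unfolding c21_def using nz s1 p0 by (simp add: divide_simps) (simp add: algebra_simps power2_eq_square)
  have 12: "k * (m * (S * z) + k * c21) + (m * (S * b12) + k * c22) / m = s * (S * b12)"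
  proof -
    have "- ((m\<^sup>2 - s) * p * s * T * m\<^sup>2)
        - (s * \<xi> - m\<^sup>2) * (s * \<xi> - 1) * ((1 - s\<^sup>2) * m\<^sup>2 * T - (m\<^sup>2 - s) * (T - 1))
        - (m\<^sup>2 - s) * p * ((m\<^sup>2 + 1) * s * \<xi> - m\<^sup>2) = 0" (is "?poly = 0")
      using q1 unfolding H_def p_def by Groebner_Basis.algebra
    moreover have "m\<^sup>2 * (s + 1) * T * (s * m * \<xi>)
        * (k * (s * z) / m + b12 + k / m * ((1 - 1 / T) / p * b12 + (\<mu> - z) / T) - s * b12) = ?poly"
    proof -
      define e K c where "e = s * m * \<xi>" and "K = k / m * (m\<^sup>2 * (s + 1))"
        and "c = (1 - 1 / T) / p * b12 + (\<mu> - z) / T"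
      have K: "K = - ((m\<^sup>2 - s) * p)"
      proof -
        have "k * (s + 1) = - ((m\<^sup>2 - s) * p / m)" unfolding k_def using s1 by simp
        moreover have "K = m * (k * (s + 1))"
          unfolding K_def using nz by (simp add: power2_eq_square)
        ultimately show ?thesis using nz by simp
      qed
      have e: "e * z = m\<^sup>2" "e * b12 = - ((s * \<xi> - m\<^sup>2) * (s * \<xi> - 1))" "e * \<mu> = (m\<^sup>2 + 1) * s * \<xi>"
        unfolding e_def z b12 \<mu> using nz by (simp_all add: power2_eq_square)
      have c: "T * (p * c) = (T - 1) * b12 + p * (\<mu> - z)"
        unfolding c_def using T0 p0 by (simp add: field_simps)
      have "m\<^sup>2 * (s + 1) * T * e * (k * (s * z) / m + b12 + k / m * c - s * b12) =
          K * s * T * (e * z) + m\<^sup>2 * (1 - s\<^sup>2) * T * (e * b12) + K * e * (T * c)"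
        unfolding K_def by (simp add: algebra_simps power2_eq_square)
      also have "K * e * (T * c) = - ((m\<^sup>2 - s) * (e * (T * (p * c))))"
        unfolding K by (simp add: ac_simps)
      also have "e * (T * (p * c)) = (T - 1) * (e * b12) + p * (e * \<mu> - e * z)"
        unfolding c by (simp add: algebra_simps)
      also have "K * s * T * (e * z) + m\<^sup>2 * (1 - s\<^sup>2) * T * (e * b12)
          + - ((m\<^sup>2 - s) * ((T - 1) * (e * b12) + p * (e * \<mu> - e * z))) = ?poly"
        unfolding e K by Groebner_Basis.algebra
      finally show ?thesis unfolding e_def c_def .
    qed
    ultimately have e: "k * (s * z) / m + b12 + k / m * ((1 - 1 / T) / p * b12 + (\<mu> - z) / T) = s * b12"
      using nz s1 T0 by simp
    have "k * (m * (S * z) + k * c21) = k * (m * (m * (S * z) + k * c21)) / m" using nz by simp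
    also have "\<dots> = S * (k * (s * z) / m)" unfolding 11 by simp
    finally have "k * (m * (S * z) + k * c21) + (m * (S * b12) + k * c22) / m =
        S * (k * (s * z) / m + b12 + k / m * ((1 - 1 / T) / p * b12 + (\<mu> - z) / T))"
      unfolding c22_def using nz by (simp add: add_divide_distrib distrib_left ac_simps)
    then show ?thesis unfolding e by simp
  qed
  have dW0: "mdet W0 = 1" unfolding W0_def using nz by simp
  \<comment> \<open>The lower right entries agree because both products have determinant one and the same three other entries.\<close>
  define q22 r22 where "q22 = k * c21 / m + c22 / m / m" and "r22 = (s - 1 / s) / p * (S * b12) + c22 / s"
  have C': "X * B = M2 (S * z) (S * b12) c21 c22" unfolding C c21_def c22_def ..
  have L: "A * (X * B) * A = M2 (s * (S * z)) (s * (S * b12)) c21 q22"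
  proof -
    have "(m * (S * z) + k * c21) * m = s * (S * z)" using 11 by (simp only: mult.commute)
    moreover have "(m * (S * z) + k * c21) * k + (m * (S * b12) + k * c22) * (1 / m) = s * (S * b12)"
      using 12 by (simp add: mult.commute)
    ultimately show ?thesis unfolding C' A times_m2.simps m2.inject q22_def using nz by simp
  qed
  have R: "W0 * (X * B) = M2 (s * (S * z)) (s * (S * b12)) c21 r22"
    unfolding C' W0_def times_m2.simps m2.inject r22_def using 21 by simp
  have "mdet (A * (X * B) * A) = mdet (W0 * (X * B))" by (simp add: mdet_mult dA dB dX dW0)
  then have "s * (S * z) * q22 = s * (S * z) * r22" unfolding L R by simp
  then have "q22 = r22" using nz S0 y0 by (simp add: z_def)
  then have AX: "A * (X * B) * A = W0 * (X * B)" unfolding L R by simp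
  have "W * (X * B) = W0 * (X * B)"
    using aca AX unfolding A_def B_def X_def W_def pc_eq by (simp add: mult.assoc)
  then have "W * (X * B) * \<Psi> (- (gen GenX + gen GenB)) = W0 * (X * B) * \<Psi> (- (gen GenX + gen GenB))" by simp
  then have W: "W = W0" unfolding X_def B_def pc_eq[symmetric] by (simp add: mult.assoc inv_right)
  show dW: "mdet W = 1" and "mtr W = s + 1 / s" unfolding W W0_def using nz by simp_all
  show comm: "X * W = W * X" unfolding X_def W_def by (rule px_commute)
  have inv': "pb' = madj B" "pw' = madj W"
    using image_uminus dB dW unfolding B_def W_def by blast+
  show A1: "A = W * V * W * B" and A2: "A * X = X * B * W * B * madj W * madj B"
    using meridian_relations unfolding inv' V_def A_def[symmetric] B_def[symmetric] X_def[symmetric] W_def[symmetric] by simp_all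
  have cW: "cj W = M2 s 0 0 (1 / s)" using cW0 W by simp
  show "mtr (W * B) = s * F + 1 / s * G"
    unfolding cj(3)[of "W * B", symmetric] cj(1) cW cB by simp
  have cV: "cj V = madj (M2 F g h G) * madj (M2 s 0 0 (1 / s)) * madj (M2 F g h G)"
    unfolding V_def cj cB cW ..
  have si: "s * (1 / s) = 1" "S * (1 / S) = 1" using nz S0 by simp_all
  \<comment> \<open>Otherwise \<open>m\<^sup>2 = s\<close> and \<open>m\<^sup>2 s = 1\<close>, hence \<open>s\<^sup>2 = 1\<close>.\<close>
  have kl: "k \<noteq> 0 \<or> l \<noteq> 0"
  proof (rule ccontr)
    assume "\<not> ?thesis"
    then have "m\<^sup>2 = s" and "1 / m = s * \<mu> / (s + 1)"
      using p0 nz s1 by (simp_all add: k_def l_def)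
    then have "1 = m\<^sup>2 * s" using nz s1 unfolding \<mu>_def by (simp add: field_simps power2_eq_square)
    then show False using \<open>m\<^sup>2 = s\<close> s2 by (simp add: power2_eq_square)
  qed
  have lh: "l * s * (s + 1) * \<omega> = h" using par(3) unfolding l_def h_def .
  have kg: "k * (s + 1) * \<omega> = - (T * g)" using par(2) unfolding g_def .
  have cA1: "M2 (m + k / p) k l (1 / m - k / p) =
      M2 s 0 0 (1 / s) * (madj (M2 F g h G) * madj (M2 s 0 0 (1 / s)) * madj (M2 F g h G)) * M2 s 0 0 (1 / s) * M2 F g h G"
    using arg_cong[OF A1, of cj] unfolding cj cA cV cW cB .
  have cA2: "M2 (m + k / p) k l (1 / m - k / p) * M2 S 0 0 (1 / S) = M2 S 0 0 (1 / S) * M2 F g h G * M2 s 0 0 (1 / s)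
      * M2 F g h G * madj (M2 s 0 0 (1 / s)) * madj (M2 F g h G)"
    using arg_cong[OF A2, of cj] unfolding cj cA cX cW cB .
  note rel = eigenbasis_relations[OF si gh TS cA1 cA2 kg lh kl par(4) s2]
  have \<nu>: "\<nu> = (s\<^sup>2 - 1) * \<omega> * (1 / S)" by (simp add: \<nu>_def \<omega>_def)
  have "(s * F + 1 / s * G) * \<nu> = ((s * F + G / s) * ((s\<^sup>2 - 1) * \<omega>)) * (1 / S)"
    unfolding \<nu> by simp
  also have "\<dots> = - (F * S + G * (1 / S))"
    unfolding par(5) TS using S0 by (simp add: field_simps power2_eq_square)
  finally have th: "(s * F + 1 / s * G) * \<nu> = - (F * S + G * (1 / S))" .
  have "(1 + s) * (s * S * F + 1 / S * G) = (1 + s) * (s * T * F + G) * (1 / S)"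
    unfolding TS using S0 by (simp add: field_simps power2_eq_square)
  also have "\<dots> = - (s * (F + G) * \<nu>)"
    unfolding par(6) FG \<nu> by simp
  finally have mu: "(1 + s) * (s * S * F + 1 / S * G) = - (s * (F + G) * \<nu>)" .
  note tr = eigenbasis_traces[OF si gh rel(1)[folded \<nu>] rel(2) th mu s1(1)]
  have tr_cj: "mtr x = mtr (cj x)" for x by (simp add: cj(3))
  show "mtr (W * V * madj X) = - \<nu>"
    unfolding tr_cj[of "W * V * madj X"] cj cX cW cV by (rule tr(1))
  show "mtr (W * V * W * madj X) = (S + s * (1 / S)) / (s + 1) + \<nu> * (1 - s - 1 / s)"
    unfolding tr_cj[of "W * V * W * madj X"] cj cX cW cV by (rule tr(2))
  show "mtr (madj B * madj X) + mtr (W * madj B * madj X) + mtr (W * V * madj W * madj B * madj X)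
           = 2 * (F * S + G * (1 / S))"
    unfolding tr_cj[of "madj B * madj X"] tr_cj[of "W * madj B * madj X"] 
      tr_cj[of "W * V * madj W * madj B * madj X"] cj cX cW cV cB by (rule tr(3))
  show "mtr (madj B * madj W * madj X) = F * (s * S) + G * (1 / s * (1 / S))"
    unfolding tr_cj[of "madj B * madj W * madj X"] cj cX cW cB by (rule tr(4))
  show "mtr (W * V * madj B * madj X) = F * (s * S) + G * (1 / s * (1 / S))"
    unfolding tr_cj[of "W * V * madj B * madj X"] cj cX cW cV cB by (rule tr(5))
qed

section \<open>Assembling the polynomial\<close>

definition of_mat :: "'a mat \<Rightarrow> 'a m2" where
  "of_mat M = M2 (M $$ (0, 0)) (M $$ (0, 1)) (M $$ (1, 0)) (M $$ (1, 1))"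

lemma of_mat_mult:
  assumes "M \<in> carrier_mat 2 2" "N \<in> carrier_mat 2 2"
  shows "of_mat (M * N) = of_mat M * of_mat N"
  using assms by (auto simp: of_mat_def scalar_prod_def numeral_2_eq_2)

lemma mdet_of_mat:
  assumes "M \<in> carrier_mat 2 2"
  shows "mdet (of_mat M) = det M"
proof -
  have "to_mat (of_mat M) = M" using assms by (intro eq_matI) (auto simp: of_mat_def less_2_cases_iff)
  then show ?thesis by (metis det_to_mat)
qed

abbreviation "cmap \<equiv> map_m2 const_fract"

lemma cmap_mult: "cmap (x * y) = cmap x * cmap y" and cmap_one: "cmap 1 = 1"
  and cmap_madj: "cmap (madj x) = madj (cmap x)" and mdet_cmap: "mdet (cmap x) = const_fract (mdet x)"
  and mtr_cmap: "mtr (cmap x) = const_fract (mtr x)"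
  by (cases x; cases y; simp add: one_m2_def const_fract_add const_fract_mult const_fract_one
      const_fract_zero const_fract_uminus const_fract_minus)+

text \<open>
The constant coefficient is one. This gives all nonvanishing conditions on determinants of the form
\<open>det (t\<^sup>j M - 1)\<close> with \<open>det M = 1\<close>.
\<close>
lemma tvar_quadratic_nonzero:
  assumes "j > 0"
  shows "tvar ^ (2 * j) - const_fract c * tvar ^ j + 1 \<noteq> (0 :: 'a::field poly fract)"
proof -
  have t: "tvar ^ i = (to_fract (monom 1 i) :: 'a poly fract)" for i
    unfolding tvar_def by (induction i) (simp_all add: monom_0 one_pCons[symmetric] monom_Suc flip: to_fract_mult)
  have eq: "tvar ^ (2 * j) - const_fract c * tvar ^ j + 1 = to_fract (monom 1 (2 * j) - [:c:] * monom 1 j + 1)"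
    unfolding t const_fract_def by (simp only: to_fract_add to_fract_diff to_fract_mult to_fract_1)
  have "poly (monom 1 (2 * j) - [:c:] * monom 1 j + 1) 0 = 1"
    using assms by (simp add: poly_monom zero_power)
  then have "monom 1 (2 * j) - [:c:] * monom 1 j + 1 \<noteq> 0" by (metis poly_0 zero_neq_one)
  then show ?thesis unfolding eq by (simp only: to_fract_eq_0_iff not_False_eq_True)
qed

context
  fixes n :: nat and \<rho> :: "pretzel_gen free_group set \<Rightarrow> complex mat" and ab :: "pretzel_gen free_group set \<Rightarrow> int"
  assumes \<rho>: "\<rho> \<in> hom (pretzel_group n) (special_linear 2)"
    and ab: "ab \<in> hom (pretzel_group n) integer_group"
begin

definition const_rep :: "pretzel_gen free_group \<Rightarrow> complex m2" where
  "const_rep u = of_mat (\<rho> (proj (pretzel_rels n) u))"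

lemma proj_in: "proj (pretzel_rels n) u \<in> carrier (pretzel_group n)"
  unfolding pretzel_group_def by (rule proj_carrier)

lemma rho_SL2: "\<rho> (proj (pretzel_rels n) u) \<in> carrier_mat 2 2" "det (\<rho> (proj (pretzel_rels n) u)) = 1"
  using hom_in_carrier[OF \<rho> proj_in[of u]] by (simp_all add: special_linear_def)

lemma mdet_const_rep: "mdet (const_rep u) = 1"
  by (simp add: const_rep_def mdet_of_mat rho_SL2)

lemma const_rep_plus: "const_rep (u + v) = const_rep u * const_rep v"
  using hom_mult[OF \<rho> proj_in[of u] proj_in[of v]]
  unfolding pretzel_group_def proj_plus[symmetric]
  by (simp add: const_rep_def special_linear_def of_mat_mult rho_SL2)

lemma const_rep_zero: "const_rep 0 = 1"
proof -
  have "madj (const_rep 0) * (const_rep 0 * const_rep 0) = madj (const_rep 0) * const_rep 0"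
    using const_rep_plus[of 0 0] by simp
  then show ?thesis by (simp add: mult.assoc[symmetric] madj_times mdet_const_rep)
qed

lemma ab_plus: "ab (proj (pretzel_rels n) (u + v)) = ab (proj (pretzel_rels n) u) + ab (proj (pretzel_rels n) v)"
  using hom_mult[OF ab proj_in[of u] proj_in[of v]] unfolding pretzel_group_def proj_plus[symmetric]
  by (simp add: integer_group_def)

lemma ab_zero: "ab (proj (pretzel_rels n) 0) = 0"
  using ab_plus[of 0 0] by simp

lemma ab_uminus: "ab (proj (pretzel_rels n) (- u)) = - ab (proj (pretzel_rels n) u)"
  using ab_plus[of u "- u"] by (simp add: ab_zero)

abbreviation "rep \<equiv> twisted_rep (pretzel_rels n) \<rho> ab"

lemma rep_eq: "rep u = smul (tvar powi ab (proj (pretzel_rels n) u)) (cmap (const_rep u))"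
  by (simp add: twisted_rep_def const_rep_def of_mat_def Let_def)

lemma tvar_nonzero: "(tvar :: complex poly fract) \<noteq> 0"
  by (simp add: tvar_def)

lemma pretzel_rep_const: "pretzel_rep const_rep n"
proof unfold_locales
  show "\<forall>r\<in>set (pretzel_rels n). const_rep r = 1"
    using proj_relator const_rep_zero unfolding const_rep_def by metis
qed (rule const_rep_plus const_rep_zero)+

lemma pretzel_rep_twisted: "pretzel_rep rep n"
proof unfold_locales
  interpret c: pretzel_rep const_rep n by (rule pretzel_rep_const)
  show "rep (u + v) = rep u * rep v" for u v
    by (simp add: rep_eq ab_plus const_rep_plus cmap_mult power_int_add tvar_nonzero mult.commute)
  show "rep 0 = 1"
    by (simp add: rep_eq ab_zero const_rep_zero cmap_one)
  show "\<forall>r\<in>set (pretzel_rels n). rep r = 1"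
  proof
    fix r assume r: "r \<in> set (pretzel_rels n)"
    then show "rep r = 1"
      using proj_relator[OF r] c.relators by (simp add: rep_eq ab_zero cmap_one)
  qed
qed

end

text \<open>
Here \<open>\<eta>\<^sub>1 = Y \<beta>\<close> and \<open>s (\<eta>\<^sub>1 + \<eta>\<^sub>2) = \<gamma> \<beta>\<close>, so \<open>\<beta>\<close> cancels from all coefficients.
\<close>
lemma lam_closed_form:
  fixes m s :: complex and n :: nat
  defines "T \<equiv> s ^ (2 * n)" and "\<alpha> \<equiv> alpha n m s" and "\<beta> \<equiv> beta n m s"
  defines "H \<equiv> 1 - m\<^sup>2 * s + m\<^sup>2 * s * T - s\<^sup>2 * T" and "\<mu> \<equiv> m + 1 / m" and "\<xi> \<equiv> m * \<alpha> / \<beta>"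
  assumes nz: "m \<noteq> 0" "s \<noteq> 0" "\<beta> \<noteq> 0" "H \<noteq> 0" and n: "n \<ge> 1"
  defines "\<gamma> \<equiv> s * ((1 - s) * \<xi> + T * (m\<^sup>2 - s))" and "Y \<equiv> (1 + m\<^sup>2) * T + (1 - s * T) * \<xi>"
  defines "G \<equiv> \<mu> * \<gamma> / H" and "F \<equiv> \<mu> - \<mu> * \<gamma> / H" and "\<nu> \<equiv> (s\<^sup>2 - 1) * (Y / H) * (1 / s ^ n)"
  shows "j < n \<Longrightarrow> lam n m s (2 * j) = F * s ^ (j + 1) + G * (1 / s) ^ (j + 1)"
    and "j + 1 < n \<Longrightarrow> lam n m s (2 * j + 1) = (s ^ j - (1 / s) ^ j) / (s - 1 / s)"
    and "lam n m s (2 * n - 1) = (s ^ (n - 1) - (1 / s) ^ (n - 1)) / (s - 1 / s) - \<nu>"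
    and "Hfac n m s = H"
proof -
  show H: "Hfac n m s = H" by (simp add: Hfac_def H_def T_def power_add mult.assoc power2_eq_square ac_simps)
  have p: "s ^ (2 * n + 1) = s * T" by (simp add: T_def)
  have \<xi>: "m * \<alpha> = \<xi> * \<beta>" using nz by (simp add: \<xi>_def)
  have e1: "eta1 n m s = Y * \<beta>"
  proof -
    have "eta1 n m s = (m * \<alpha>) * (1 - s * T) + T * \<beta> * (1 + m\<^sup>2)"
      unfolding eta1_def Let_def p \<alpha>_def[symmetric] \<beta>_def[symmetric] T_def[symmetric] by (simp add: algebra_simps)
    then show ?thesis unfolding \<xi> Y_def by (simp add: algebra_simps)
  qed
  have e12: "s * (eta1 n m s + eta2 n m s) = \<gamma> * \<beta>"
  proof -
    have eta: "eta1 n m s + eta2 n m s = (m * \<alpha>) * (1 - s) + T * \<beta> * (m\<^sup>2 - s)"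
      unfolding eta1_def eta2_def Let_def p \<alpha>_def[symmetric] \<beta>_def[symmetric] T_def[symmetric] by (simp add: algebra_simps)
    show ?thesis unfolding eta \<xi> \<gamma>_def by (simp add: algebra_simps)
  qed
  have inv: "s powi (- int k) = (1 / s) ^ k" for k
    by (simp add: power_int_minus power_inverse divide_inverse)
  show "lam n m s (2 * j) = F * s ^ (j + 1) + G * (1 / s) ^ (j + 1)" if "j < n"
  proof -
    let ?a = "s ^ (j + 1)" and ?b = "(1 / s) ^ (j + 1)"
    have "2 * j \<noteq> 2 * n - 1" using that by presburger
    then have "lam n m s (2 * j) = (1 + m\<^sup>2) * (H * ?a * \<beta> - (?a - ?b) * (s * (eta1 n m s + eta2 n m s))) / (H * m * \<beta>)"
      using inv[of "j + 1"] by (simp add: lam_def Let_def H \<beta>_def[symmetric] ac_simps)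
    also have "\<dots> = F * ?a + G * ?b"
      unfolding e12 F_def G_def \<mu>_def using nz by (simp add: field_simps power2_eq_square)
    finally show ?thesis .
  qed
  show "lam n m s (2 * j + 1) = (s ^ j - (1 / s) ^ j) / (s - 1 / s)" if "j + 1 < n"
  proof -
    have "2 * j + 1 \<noteq> 2 * n - 1" using that by presburger
    then show ?thesis using inv[of j] by (simp add: lam_def Let_def divide_inverse)
  qed
  have "s powi (int n - 1) = s ^ (n - 1)" "s powi (- (int n - 1)) = (1 / s) ^ (n - 1)"
    using n inv[of "n - 1"] by (simp_all add: of_nat_diff power_int_def nat_diff_distrib)
  then have "lam n m s (2 * n - 1) = (s ^ (n - 1) - (1 / s) ^ (n - 1)) / (s - 1 / s)
      - (s\<^sup>2 - 1) * eta1 n m s / (H * s ^ n * \<beta>)"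
    by (simp add: lam_def Let_def H \<beta>_def[symmetric] divide_inverse)
  then show "lam n m s (2 * n - 1) = (s ^ (n - 1) - (1 / s) ^ (n - 1)) / (s - 1 / s) - \<nu>"
    unfolding e1 \<nu>_def using nz by simp
qed

lemma rho_entries:
  fixes m s :: complex and n :: nat
  assumes nz: "m \<noteq> 0" "s \<noteq> 0" "alpha n m s \<noteq> 0" "beta n m s \<noteq> 0" 
  defines "p \<equiv> s * s ^ (2 * n) + 1" and "y \<equiv> beta n m s / alpha n m s"
  shows "of_mat (rho_a n m s) = M2 m (- ((m\<^sup>2 - s) * p / (m * (s + 1)))) 0 (1 / m)"
    and "of_mat (rho_b n m s) = M2 (y / s) (- ((s - m * y) * (m * s - y) / (s * m * y))) (y / s) (m + 1 / m - y / s)"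
    and "of_mat (rho_x n s) = M2 (s ^ n) 0 ((s ^ n - 1 / s ^ n) / p) (1 / s ^ n)"
proof -
  show "of_mat (rho_a n m s) = M2 m (- ((m\<^sup>2 - s) * p / (m * (s + 1)))) 0 (1 / m)"
    by (simp add: of_mat_def rho_a_def mat_of_rows_list_def p_def divide_inverse)
  show "of_mat (rho_x n s) = M2 (s ^ n) 0 ((s ^ n - 1 / s ^ n) / p) (1 / s ^ n)"
    by (simp add: of_mat_def rho_x_def mat_of_rows_list_def p_def power_int_minus divide_inverse)
  have b: "beta n m s = y * alpha n m s" and "y \<noteq> 0" using nz by (simp_all add: y_def)
  then show "of_mat (rho_b n m s) = M2 (y / s) (- ((s - m * y) * (m * s - y) / (s * m * y))) (y / s) (m + 1 / m - y / s)"
    using nz unfolding rho_b_def Let_def b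
    by (simp add: of_mat_def mat_of_rows_list_def) (simp add: field_simps power2_eq_square)
qed

theorem theorem3p1:
  fixes n k :: nat
    and m s :: complex
    and \<rho> :: "pretzel_gen free_group set \<Rightarrow> complex mat"
    and ab :: "pretzel_gen free_group set \<Rightarrow> int"
  assumes "n \<ge> 1" and "m \<noteq> 0" and "s \<noteq> 0" and "r0 n m s = 0"
    and "s + 1 \<noteq> 0" and "s^(2*n+1) + 1 \<noteq> 0" and "s - inverse s \<noteq> 0"
    and "alpha n m s \<noteq> 0" and "beta n m s \<noteq> 0" and "Hfac n m s \<noteq> 0"
    and "\<rho> \<in> hom (pretzel_group n) (special_linear 2)"
    and "\<rho> (pretzel_elem n GenA) = rho_a n m s"
    and "\<rho> (pretzel_elem n GenB) = rho_b n m s"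
    and "\<rho> (pretzel_elem n GenX) = rho_x n s"
    and "ab \<in> hom (pretzel_group n) integer_group"
    and "ab (pretzel_elem n GenA) = 1"
    and "ab (pretzel_elem n GenB) = 1"
    and "ab (pretzel_elem n GenX) = 2 * int n"
    and "k < length pretzel_gens"
    and "twisted_alexander_denom 2 pretzel_gens (pretzel_rels n) \<rho> ab k \<noteq> 0"
  shows "\<exists>e::int. twisted_alexander 2 pretzel_gens (pretzel_rels n) \<rho> ab k =
    tvar powi e *
      (1 + (\<Sum>i = 0..2*n-1. const_fract (lam n m s i) * (tvar^(i+3) + tvar^(4*n-i+3))) + tvar^(4*n+6))"
proof -
  note hyps = assms
  note n = assms(1) and nz = assms(2,3) and hom = assms(11) and abh = assms(15)
  define S T p where "S = s ^ n" and "T = s ^ (2 * n)" and "p = s * T + 1"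
  define H \<mu> where "H = 1 - m\<^sup>2 * s + m\<^sup>2 * s * T - s\<^sup>2 * T" and "\<mu> = m + 1 / m"
  define \<xi> where "\<xi> = m * alpha n m s / beta n m s"
  define \<gamma> Y where "\<gamma> = s * ((1 - s) * \<xi> + T * (m\<^sup>2 - s))" and "Y = (1 + m\<^sup>2) * T + (1 - s * T) * \<xi>"
  define G F \<nu> where "G = \<mu> * \<gamma> / H" and "F = \<mu> - \<mu> * \<gamma> / H" and "\<nu> = (s\<^sup>2 - 1) * (Y / H) * (1 / S)"
  have s1: "s - 1 \<noteq> 0" using hyps(7) by auto
  have p0: "p \<noteq> 0" using hyps(6) by (simp add: p_def T_def)
  have \<xi>0: "\<xi> \<noteq> 0" using nz hyps(8,9) by (simp add: \<xi>_def)
  have Hfac: "Hfac n m s = H"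
    by (simp add: Hfac_def H_def T_def power_add power2_eq_square ac_simps)
  have H0: "H \<noteq> 0" using hyps(10) by (simp add: Hfac)
  note lam = lam_closed_form[of m s n, folded T_def, folded H_def \<mu>_def \<xi>_def, folded \<gamma>_def Y_def,
      folded G_def F_def S_def, folded \<nu>_def, OF nz hyps(9) H0 n]
  define A' B' where "A' = (s\<^sup>2 - 1) * T * red_alpha (m\<^sup>2) s T" and "B' = s * red_beta (m\<^sup>2) s T"
  note poly = pretzel_polynomials[OF n, of m s, folded T_def, folded A'_def B'_def]
  have B'0: "B' \<noteq> 0" using hyps(9) poly(3) by auto
  have A': "A' = \<xi> * B'" unfolding \<xi>_def poly(2,3) using nz B'0 by simp
  have q1: "m\<^sup>2 * T * H + s * T * (m ^ 4 - 1) * (s + 1) * \<xi>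
        + s * (m\<^sup>2 - s + s * T - m\<^sup>2 * s\<^sup>2 * T) * \<xi>\<^sup>2 = 0" (is "?q1 = 0")
  proof -
    have "B'\<^sup>2 * ?q1 = m\<^sup>2 * T * H * B'\<^sup>2 + s * T * ((m\<^sup>2)\<^sup>2 - 1) * (s + 1) * A' * B'
        + s * (m\<^sup>2 - s + s * T - m\<^sup>2 * s\<^sup>2 * T) * A'\<^sup>2"
      unfolding A' by Groebner_Basis.algebra
    also have "\<dots> = 0"
      using first_quadratic_identity[of "m\<^sup>2" T s, folded A'_def B'_def H_def] poly(1) hyps(4) by simp
    finally show ?thesis using B'0 by simp
  qed
  have q2: "(s\<^sup>2 * (H - \<gamma>) + \<gamma>) * (s\<^sup>2 - 1) * Y + s * H * (T * (H - \<gamma>) + \<gamma>) = 0" (is "?q2 = 0")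
  proof -
    have Y': "(1 + m\<^sup>2) * T * B' + (1 - s * T) * A' = Y * B'"
      and \<gamma>': "s * ((1 - s) * A' + T * (m\<^sup>2 - s) * B') = \<gamma> * B'"
      unfolding A' Y_def \<gamma>_def by (simp_all add: algebra_simps)
    have "B'\<^sup>2 * ?q2 = (s\<^sup>2 * (H * B' - \<gamma> * B') + \<gamma> * B') * (s\<^sup>2 - 1) * (Y * B')
        + s * H * B' * (T * (H * B' - \<gamma> * B') + \<gamma> * B')"
      by Groebner_Basis.algebra
    also have "\<dots> = 0"
      using second_quadratic_identity[of s "m\<^sup>2" T, folded A'_def B'_def H_def, unfolded Y' \<gamma>'] poly(1) hyps(4) by simp
    finally show ?thesis using B'0 by simp
  qed
  have y: "m / \<xi> = beta n m s / alpha n m s" using nz hyps(8,9) by (simp add: \<xi>_def)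
  note ent = rho_entries[OF nz hyps(8,9), folded T_def S_def, folded p_def, folded y]
  note tr = pretzel_traces[OF pretzel_rep_const[OF hom abh] nz \<xi>0, folded T_def S_def, folded p_def, OF p0 hyps(5) s1,
     folded H_def \<mu>_def \<gamma>_def Y_def, OF H0 q1 q2, folded F_def G_def \<nu>_def]
  define \<Psi> where "\<Psi> = const_rep n \<rho>"
  define A B X W where "A = \<Psi> (gen GenA)" and "B = \<Psi> (gen GenB)" and "X = \<Psi> (gen GenX)"
    and "W = \<Psi> pretzel_word"
  have ABX: "A = M2 m (- ((m\<^sup>2 - s) * p / (m * (s + 1)))) 0 (1 / m)"
    "B = M2 (m / \<xi> / s) (- ((s - m * (m / \<xi>)) * (m * s - m / \<xi>) / (s * m * (m / \<xi>)))) (m / \<xi> / s) (\<mu> - m / \<xi> / s)"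
    "X = M2 S 0 ((S - 1 / S) / p) (1 / S)"
    unfolding A_def B_def X_def \<Psi>_def const_rep_def[OF hom abh] pretzel_elem_def[symmetric] hyps(12-14) ent \<mu>_def by (rule HOL.refl)+
  define V where "V = madj B * madj W * madj B"
  note tr = tr[folded \<Psi>_def, folded A_def B_def X_def W_def, OF ABX, folded V_def]
  interpret c: pretzel_rep \<Psi> n unfolding \<Psi>_def by (rule pretzel_rep_const[OF hom abh])
  let ?r = "twisted_rep (pretzel_rels n) \<rho> ab"
  interpret r: pretzel_rep ?r n by (rule pretzel_rep_twisted[OF hom abh])
  define t :: "complex poly fract" where "t = tvar"
  define \<tau> where "\<tau> = t ^ (2 * n)"
  have t0: "t \<noteq> 0" unfolding t_def by (rule tvar_nonzero[OF hom abh])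
  have tt: "inverse t * t = 1" using t0 by simp
  let ?K = "const_fract :: complex \<Rightarrow> complex poly fract"
  define A\<^sub>t B\<^sub>t X\<^sub>t W\<^sub>t where "A\<^sub>t = cmap A" and "B\<^sub>t = cmap B" and "X\<^sub>t = cmap X" and "W\<^sub>t = cmap W"
  have rep: "?r u = smul (t powi ab (proj (pretzel_rels n) u)) (cmap (\<Psi> u))" for u
    unfolding t_def \<Psi>_def by (rule rep_eq[OF hom abh])
  have ab1: "ab (proj (pretzel_rels n) (gen GenA)) = 1" "ab (proj (pretzel_rels n) (gen GenB)) = 1"
    "ab (proj (pretzel_rels n) (gen GenX)) = int (2 * n)"
    using hyps(16-18) by (simp_all add: pretzel_elem_def)
  note ab' = ab_plus[OF hom abh] ab_uminus[OF hom abh]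
  have abw: "ab (proj (pretzel_rels n) pretzel_word) = 2"
    unfolding pretzel_word_def diff_conv_add_uminus ab' ab1 by simp
  have \<Psi>_minus: "\<Psi> (- u) = madj (\<Psi> u)" for u
    by (rule c.image_uminus) (simp add: \<Psi>_def mdet_const_rep[OF hom abh])
  have img: "r.pa = smul t A\<^sub>t" "r.pb = smul t B\<^sub>t" "r.px = smul \<tau> X\<^sub>t" "r.pw = smul (t\<^sup>2) W\<^sub>t"
    "r.pb' = smul (inverse t) (madj B\<^sub>t)" "r.pw' = smul ((inverse t)\<^sup>2) (madj W\<^sub>t)"
    unfolding rep ab' ab1 abw A\<^sub>t_def B\<^sub>t_def X\<^sub>t_def W\<^sub>t_def A_def B_def X_def W_def \<Psi>_minus cmap_madj
    by (simp_all add: \<tau>_def power_int_minus power_inverse del: of_nat_mult)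
  have ac: "r.pa * r.pc = smul (t ^ (2 * n + 2)) (cmap (\<Psi> (gen GenA + (gen GenX + gen GenB))))"
  proof -
    have "ab (proj (pretzel_rels n) (gen GenA + (gen GenX + gen GenB))) = int (2 * n + 2)"
      unfolding ab' ab1 by simp
    then have "?r (gen GenA + (gen GenX + gen GenB)) =
        smul (t ^ (2 * n + 2)) (cmap (\<Psi> (gen GenA + (gen GenX + gen GenB))))"
      by (simp only: rep power_int_of_nat)
    then show ?thesis by (simp only: r.hom_plus)
  qed
  have dets: "mdet A\<^sub>t = 1" "mdet B\<^sub>t = 1" "mdet X\<^sub>t = 1" "mdet W\<^sub>t = 1"
    by (simp_all add: A\<^sub>t_def B\<^sub>t_def X\<^sub>t_def W\<^sub>t_def mdet_cmap tr(1-4) const_fract_one)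
  have quad: "mdet (smul e z - 1) = e\<^sup>2 - mtr z * e + 1" if "mdet z = 1" for e and z :: "complex poly fract m2"
    using that by (simp add: mdet_minus mult.commute)
  have D: "mdet (r.pw - 1) = t ^ 4 - mtr W\<^sub>t * t\<^sup>2 + 1"
    unfolding img(4) quad[OF dets(4)] by (simp flip: power_mult)
  have D0: "mdet (r.pw - 1) \<noteq> 0"
    using tvar_quadratic_nonzero[of 2 "mtr W"] unfolding D unfolding W\<^sub>t_def mtr_cmap t_def by simp
  have a0: "mdet (r.pa - 1) \<noteq> 0"
    using tvar_quadratic_nonzero[of 1 "mtr A"] unfolding img(1) quad[OF dets(1)] unfolding A\<^sub>t_def mtr_cmap t_def by simp
  have ac0: "mdet (1 + r.pa * r.pc) \<noteq> 0"
  proof -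
    let ?z = "\<Psi> (gen GenA + (gen GenX + gen GenB))"
    have "mdet (cmap ?z) = 1"
      by (simp add: mdet_cmap \<Psi>_def mdet_const_rep[OF hom abh] const_fract_one)
    then have "mdet (1 + smul e (cmap ?z)) = e\<^sup>2 - ?K (- mtr ?z) * e + 1" for e
      by (simp add: mdet_add mtr_cmap const_fract_uminus madj_one cmap_madj[symmetric] algebra_simps)
        (cases ?z; simp add: const_fract_add)
    then have "mdet (1 + r.pa * r.pc) = (t ^ (2 * n + 2))\<^sup>2 - ?K (- mtr ?z) * t ^ (2 * n + 2) + 1"
      unfolding ac by blast
    also have "\<dots> \<noteq> 0"
      using tvar_quadratic_nonzero[of "2 * n + 2" "- mtr ?z"] unfolding t_def power_mult[symmetric]
      by (simp only: mult.commute[of "2 * n + 2" 2]) simp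
    finally show ?thesis .
  qed
  define q where "q = mdet r.pa * mdet r.px * mdet r.reduced / (mdet r.pw * mdet (r.pw - 1))"
  note quot = r.twisted_quotient[OF D0 ac0 a0, folded q_def]
  have rl: "pretzel_rels n = [r.rel1, r.rel2]" by (simp add: pretzel_rels_def Let_def)
  have mat: "twisted_alexander_matrix 2 pretzel_gens (pretzel_rels n) \<rho> ab k =
      blocks (der ?r g r.rel1) (der ?r h r.rel1) (der ?r g r.rel2) (der ?r h r.rel2)"
    if "take k pretzel_gens @ drop (Suc k) pretzel_gens = [g, h]" for g h
    using twisted_alexander_matrix_blocks[OF that, of r.rel1 r.rel2 \<rho> ab] unfolding rl[symmetric] Let_def .
  have den: "twisted_alexander_denom 2 pretzel_gens (pretzel_rels n) \<rho> ab k = mdet (?r (gen (pretzel_gens ! k)) - 1)"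
    by (simp add: twisted_alexander_denom_mdet ev_minus r.hom_zero)
  have ta: "twisted_alexander 2 pretzel_gens (pretzel_rels n) \<rho> ab k = q"
  proof -
    have "k = 0 \<or> k = 1 \<or> k = 2" using hyps(19) by (auto simp: pretzel_gens_def)
    then have "det (twisted_alexander_matrix 2 pretzel_gens (pretzel_rels n) \<rho> ab k) =
        q * twisted_alexander_denom 2 pretzel_gens (pretzel_rels n) \<rho> ab k"
    proof (elim disjE)
      assume k: "k = 0"
      then show ?thesis unfolding den by (subst mat[of GenB GenX]) (simp_all add: pretzel_gens_def quot(1)[unfolded One_nat_def])
    next
      assume k: "k = 1"
      then show ?thesis unfolding den by (subst mat[of GenA GenX]) (simp_all add: pretzel_gens_def quot(2)[unfolded One_nat_def])
    next
      assume k: "k = 2"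
      then show ?thesis unfolding den by (subst mat[of GenA GenB]) (simp_all add: pretzel_gens_def quot(3)[unfolded One_nat_def] numeral_2_eq_2)
    qed
    then show ?thesis unfolding twisted_alexander_def using hyps(20) by simp
  qed
  define V\<^sub>t where "V\<^sub>t = madj B\<^sub>t * madj W\<^sub>t * madj B\<^sub>t"
  have red: "r.reduced = W\<^sub>t * V\<^sub>t * W\<^sub>t - smul t (W\<^sub>t * madj B\<^sub>t) - smul ((inverse t)\<^sup>2) (W\<^sub>t * V\<^sub>t)
      + smul \<tau> (smul t (A\<^sub>t * X\<^sub>t) - X\<^sub>t - smul (t ^ 3) (X\<^sub>t * B\<^sub>t * W\<^sub>t))"
  proof -
    let ?i = "inverse t"
    have "r.pw * r.pb' * r.pw' * r.pb' * r.pw = smul (t\<^sup>2 * ?i * ?i\<^sup>2 * ?i * t\<^sup>2) (W\<^sub>t * V\<^sub>t * W\<^sub>t)"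
      and "r.pw * r.pb' = smul (t\<^sup>2 * ?i) (W\<^sub>t * madj B\<^sub>t)"
      and "r.pw * r.pb' * r.pw' * r.pb' = smul (t\<^sup>2 * ?i * ?i\<^sup>2 * ?i) (W\<^sub>t * V\<^sub>t)"
      and "r.pa * r.px = smul \<tau> (smul t (A\<^sub>t * X\<^sub>t))"
      and "r.px * r.pb * r.pw = smul \<tau> (smul (t * t\<^sup>2) (X\<^sub>t * B\<^sub>t * W\<^sub>t))"
      unfolding img V\<^sub>t_def by (simp_all add: ac_simps)
    moreover have "t\<^sup>2 * ?i * ?i\<^sup>2 * ?i * t\<^sup>2 = 1" "t\<^sup>2 * ?i = t" "t\<^sup>2 * ?i * ?i\<^sup>2 * ?i = ?i\<^sup>2" "t * t\<^sup>2 = t ^ 3"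
      using t0 by (simp_all add: field_simps power2_eq_square power3_eq_cube)
    ultimately show ?thesis
      unfolding r.reduced_def by (simp only: img(3) smul_one smul_minus) simp
  qed
  have V\<^sub>t: "V\<^sub>t = cmap V" unfolding V\<^sub>t_def V_def B\<^sub>t_def W\<^sub>t_def by (simp only: cmap_mult cmap_madj)
  note hats = A\<^sub>t_def B\<^sub>t_def X\<^sub>t_def W\<^sub>t_def V\<^sub>t cmap_madj[symmetric] cmap_mult[symmetric] mtr_cmap
  have rels: "X\<^sub>t * W\<^sub>t = W\<^sub>t * X\<^sub>t" "A\<^sub>t = W\<^sub>t * V\<^sub>t * W\<^sub>t * B\<^sub>t" "A\<^sub>t * X\<^sub>t = X\<^sub>t * B\<^sub>t * W\<^sub>t * B\<^sub>t * madj W\<^sub>t * madj B\<^sub>t"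
    unfolding hats using tr(9-11) by simp_all
  have traces: "mtr B\<^sub>t = ?K F + ?K G" "mtr W\<^sub>t = ?K s + ?K (1 / s)" "mtr (W\<^sub>t * B\<^sub>t) = ?K s * ?K F + ?K (1 / s) * ?K G"
    "mtr (W\<^sub>t * V\<^sub>t * madj X\<^sub>t) = - ?K \<nu>"
    "mtr (W\<^sub>t * V\<^sub>t * W\<^sub>t * madj X\<^sub>t) = (?K s ^ n + ?K s * ?K (1 / s) ^ n) / (?K s + 1) + ?K \<nu> * (1 - ?K s - ?K (1 / s))"
    "mtr (madj B\<^sub>t * madj X\<^sub>t) + mtr (W\<^sub>t * madj B\<^sub>t * madj X\<^sub>t) + mtr (W\<^sub>t * V\<^sub>t * madj W\<^sub>t * madj B\<^sub>t * madj X\<^sub>t)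
       = 2 * (?K F * ?K s ^ n + ?K G * ?K (1 / s) ^ n)"
    "mtr (madj B\<^sub>t * madj W\<^sub>t * madj X\<^sub>t) = ?K F * (?K s * ?K s ^ n) + ?K G * (?K (1 / s) * ?K (1 / s) ^ n)"
    "mtr (W\<^sub>t * V\<^sub>t * madj B\<^sub>t * madj X\<^sub>t) = ?K F * (?K s * ?K s ^ n) + ?K G * (?K (1 / s) * ?K (1 / s) ^ n)"
    unfolding hats const_fract_add[symmetric] tr(6-8) tr(12-16)
    by (simp_all add: const_fract_simps S_def power_divide)
  have inv: "?K s * ?K (1 / s) = 1" using nz by (simp add: const_fract_one flip: const_fract_mult)
  have ss: "?K s - ?K (1 / s) \<noteq> 0"
    using hyps(7) unfolding const_fract_minus[symmetric] const_fract_eq_0_iff by (simp add: inverse_eq_divide)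
  have odd: "(?K s ^ j - ?K (1 / s) ^ j) / (?K s - ?K (1 / s)) = ?K ((s ^ j - (1 / s) ^ j) / (s - 1 / s))" for j
    by (simp only: const_fract_simps)
  have key: "t ^ 4 * mdet r.reduced = mdet (r.pw - 1) *
      (1 + (\<Sum>i = 0..2*n-1. ?K (lam n m s i) * (t^(i+3) + t^(4*n-i+3))) + t^(4*n+6))" (is "_ = _ * ?P")
  proof -
    note sum = alexander_sum[OF n inv ss, of "\<lambda>i. ?K (lam n m s i)" "?K F" "?K G" "?K \<nu>" t, folded \<tau>_def]
    have lamK: "?K (lam n m s (2 * j)) = ?K F * ?K s ^ (j + 1) + ?K G * ?K (1 / s) ^ (j + 1)" if "j < n" for j
      unfolding lam(1)[OF that] by (simp only: const_fract_add const_fract_mult const_fract_power)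
    have lamK': "?K (lam n m s (2 * j + 1)) = (?K s ^ j - ?K (1 / s) ^ j) / (?K s - ?K (1 / s))" if "j + 1 < n" for j
      unfolding lam(2)[OF that] odd ..
    have lamK'': "?K (lam n m s (2 * n - 1)) = (?K s ^ (n - 1) - ?K (1 / s) ^ (n - 1)) / (?K s - ?K (1 / s)) - ?K \<nu>"
      unfolding lam(3) odd const_fract_minus[of _ \<nu>] ..
    define D\<^sub>t where "D\<^sub>t = t ^ 4 - (?K s + ?K (1 / s)) * t\<^sup>2 + 1"
    have "t ^ 4 * inverse t = t ^ 3" "t ^ 4 * (inverse t)\<^sup>2 = t\<^sup>2"
      using t0 by (simp_all add: field_simps eval_nat_numeral)
    then have match: "(D\<^sub>t + e) + \<tau> * t ^ 4 * (- \<nu>' * (t ^ 4 + (inverse t)\<^sup>2) - b * (t\<^sup>2 + 1) + c * t - l * inverse t - l * t ^ 3) + f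
       = (D\<^sub>t + e) + \<tau> * (- \<nu>' * (t ^ 8 + t\<^sup>2) - b * (t ^ 6 + t ^ 4) + c * t ^ 5 - l * (t ^ 7 + t ^ 3)) + f"
      for e \<nu>' b c l f
      by Groebner_Basis.algebra
    show ?thesis
      unfolding D unfolding traces(2) red
        mdet_reduced[OF dets(4,2,3) rels(1) tt rels(2)[unfolded V\<^sub>t_def] rels(3), folded V\<^sub>t_def] traces
      by (subst sum[OF lamK lamK' lamK''], assumption, assumption)
        (unfold D\<^sub>t_def[symmetric], rule match)
  qed
  have "q = t powi (4 * int n - 6) * (1 + (\<Sum>i = 0..2*n-1. ?K (lam n m s i) * (t^(i+3) + t^(4*n-i+3))) + t^(4*n+6))"
    (is "_ = _ * ?P")
  proof -
    have q: "q = t\<^sup>2 * \<tau>\<^sup>2 * mdet r.reduced / ((t\<^sup>2)\<^sup>2 * mdet (r.pw - 1))"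
      unfolding q_def img(1,3) mdet_smul dets using img(4) by (simp add: dets)
    have "t ^ 6 * q = \<tau>\<^sup>2 * (t ^ 4 * mdet r.reduced) / mdet (r.pw - 1)"
      unfolding q using t0 D0 by (simp add: field_simps)
    also have "\<dots> = \<tau>\<^sup>2 * ?P" unfolding key using D0 by simp
    finally have "q = \<tau>\<^sup>2 / t ^ 6 * ?P" using t0 by (simp add: field_simps)
    moreover have "t powi (4 * int n - 6) = \<tau>\<^sup>2 / t ^ 6"
    proof -
      have "t powi (4 * int n - 6) = t powi int (4 * n) / t powi int 6"
        using t0 by (simp add: power_int_diff)
      then show ?thesis by (simp only: power_int_of_nat \<tau>_def power_mult[symmetric]) (simp add: mult.commute)
    qed
    ultimately show ?thesis by simp
  qed
  then show ?thesis unfolding ta t_def by blast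
qed

end
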